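(* Let $p$ be an odd prime and $A$ a complete discrete valuation ring with maximal ideal generated by $p$ and residue field $\mathbb F=A/pA$ algebraic over $\mathbb F_p$. Let $a_1,a_2,a_3\in A$ with $(a_1-a_2)(a_2-a_3)(a_3-a_1)\in A^\times$. Let $H_1=\sum_{i=1}^3 a_ix_i^2$, $H_2=\sum_{i=1}^3 x_i^2$ in $A[x_1,x_2,x_3]$, and let $N(z_1,z_2)$, $A_{p-1}(z_1,z_2)\in A[z_1,z_2]$, $Q\in A[x_1,x_2,x_3]$, $X=\mathrm{Spec}\,A[x_1,x_2,x_3][1/Q]$, $E_c$, $E_c^0$, $\omega_c$, $\phi_c$ be as defined in the context. Then there exists a $p$-derivation $\delta^X$ on $\mathcal O(\widehat X)$ such that: 1) The following equalities hold in $\mathcal O(\widehat X)$: $\delta^XH_1=\delta^XH_2=0$. 2) For any point $c=(c_1,c_2)\in A^2$ with $\delta c_1=\delta c_2=0$ and $N(c_1,c_2)\cdot A_{p-1}(c_1,c_2)\not\equiv 0 \bmod p$, the Frobenius lift $\phi_c$ on $\widehat{E_c^0}$ attached to $\delta^X$ and the canonical $1$-form $\omega_c$ on $E_c^0$ satisfy the following congruence on $\widehat{E_c^0}$: $$\frac{\phi_c^*}{p}\,\omega_c\equiv A_{p-1}(c_1,c_2)^{-1}\cdot\omega_c \mod p .$$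
   Context: Hats denote $p$-adic completion of rings or schemes; for affine $X=\mathrm{Spec}\,B$, $\mathcal O(\widehat X)=\widehat B=\varprojlim B/p^nB$. A Frobenius lift on a ring $B$ is a ring endomorphism $\phi$ of $B$ with $\phi(b)\equiv b^p \bmod pB$. If $p$ is a non-zero divisor in $B$, a $p$-derivation on $B$ is a map of sets $\delta:B\to B$ such that $\phi(b):=b^p+p\,\delta b$ is a ring homomorphism; $\phi$ is then the Frobenius lift attached to $\delta$. The ring $A$ has a unique $p$-derivation, also denoted $\delta$, and a unique Frobenius lift; all $p$-derivations and Frobenius lifts on $A$-algebras are assumed compatible with those on $A$. Polynomials: $N(z_1,z_2)=\prod_{i=1}^3(z_1-a_iz_2)$. Put $$F=\big((a_2-a_3)x^2+z_1-a_2z_2\big)\big((a_3-a_1)x^2-z_1+a_1z_2\big)\in A[z_1,z_2][x],$$ and let $A_{p-1}=A_{p-1}(z_1,z_2)\in A[z_1,z_2]$ (the Hasse invariant of $F$) be the coefficient of $x^{p-1}$ in $F^{(p-1)/2}$. Set $Q=x_1x_2\cdot N(H_1,H_2)\cdot A_{p-1}(H_1,H_2)$ and $X=\mathrm{Spec}\,A[x_1,x_2,x_3][1/Q]$. Level sets: for $c=(c_1,c_2)\in A^2$, $E_c=\mathrm{Spec}\,A[x_1,x_2,x_3]/(H_1-c_1,H_2-c_2)$ with inclusion $i_c:E_c\to\mathbb A^3$, and $E_c^0:=E_c\cap X$. When $N(c_1,c_2)A_{p-1}(c_1,c_2)\in A^\times$ one has $E_c^0=\mathrm{Spec}\,A[x_1,x_2,x_3][1/(x_1x_2)]/(H_1-c_1,H_2-c_2)$.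 When $N(c_1,c_2)\in A^\times$, $E_c$ is smooth over $A$ and carries the canonical $1$-form $$\omega_c=i_c^*\frac{dx_1}{(a_2-a_3)x_2x_3}=i_c^*\frac{dx_2}{(a_3-a_1)x_3x_1}=i_c^*\frac{dx_3}{(a_1-a_2)x_1x_2},$$ whose restriction to $E_c^0$ is still denoted $\omega_c$. The Frobenius lift $\phi_c$: if $\delta^X$ is a $p$-derivation on $\mathcal O(\widehat X)$ with $\delta^XH_1=\delta^XH_2=0$ and $\delta c_1=\delta c_2=0$, then the attached Frobenius lift $\phi^X$ satisfies $\phi^X(H_i)=H_i^p$ and $\phi(c_i)=c_i^p$, so it induces a Frobenius lift $\phi_c$ on $\mathcal O(\widehat{E_c^0})$, called the Frobenius lift attached to $\delta^X$. It acts on ($p$-adically completed) $1$-forms by $\phi_c^*(f\,dg)=\phi_c(f)\,d(\phi_c(g))$; since $\phi_c$ is a Frobenius lift, $\phi_c^*$ of any $1$-form is divisible by $p$, and $\frac{\phi_c^*}{p}$ denotes the result of dividing by $p$. *)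

theory Defs
  imports
    "HOL-Algebra.QuotRing"
    "HOL-Algebra.Module"
    "HOL-Algebra.Finite_Extensions"
    "HOL-Computational_Algebra.Primes"
    "HOL-Computational_Algebra.Polynomial"
    "HOL-Computational_Algebra.Fraction_Field"
begin

section \<open>General algebra\<close>

text \<open>The base ring is a type of class idom, so that polynomial rings and fraction fields can
  be taken from the type class library.  Quotients, completions and modules are records in the
  style of HOL-Algebra, and type_ring passes from the former to the latter.\<close>

definition type_ring :: "'b::comm_ring_1 set \<Rightarrow> 'b ring" where
  "type_ring S = \<lparr>carrier = S, mult = (*), one = 1, zero = 0, add = (+)\<rparr>"

text \<open>The localization B[1/f] of a domain B at a nonzero element f, inside Frac B.\<close>

definition localization_at :: "'b::idom \<Rightarrow> 'b fract ring" where
  "localization_at f = type_ring {Fract g (f ^ n) | g n. True}"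

definition multiples :: "('b, 'm) ring_scheme \<Rightarrow> nat \<Rightarrow> 'b set" where
  "multiples M k = (\<lambda>x. [k] \<cdot>\<^bsub>M\<^esub> x) ` carrier M"

definition congruent_mod :: "nat \<Rightarrow> ('b, 'm) ring_scheme \<Rightarrow> 'b \<Rightarrow> 'b \<Rightarrow> bool" where
  "congruent_mod k M x y \<longleftrightarrow> (\<exists>z \<in> multiples M k. x = y \<oplus>\<^bsub>M\<^esub> z)"

text \<open>The unique y with k y = x.\<close>

definition divide_by :: "nat \<Rightarrow> ('b, 'm) ring_scheme \<Rightarrow> 'b \<Rightarrow> 'b" where
  "divide_by k M x = (THE y. y \<in> carrier M \<and> [k] \<cdot>\<^bsub>M\<^esub> y = x)"

text \<open>The map on cosets modulo N induced by h: the coset C is sent to the coset of N (in M)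
  containing h x for x in C.  All x in C give the same coset whenever the induced map is
  well defined, so the union below is that coset.\<close>

definition coset_map :: "('b, 'm) ring_scheme \<Rightarrow> 'b set \<Rightarrow> ('c \<Rightarrow> 'b) \<Rightarrow> 'c set \<Rightarrow> 'b set" where
  "coset_map M N h C = (\<Union>x\<in>C. N +>\<^bsub>M\<^esub> h x)"


section \<open>\<open>p\<close>-adic completion\<close>

text \<open>Elements of the inverse limit of the M/p^n M are sequences of cosets.  The transition map
  sends a coset of p^(n+1) M to the unique coset of p^n M that contains it, so compatibility of
  a sequence is inclusion.  Only the additive structure of M is used, so that threads and
  to_completion serve for rings and for modules.\<close>

definition threads :: "nat \<Rightarrow> ('b, 'm) ring_scheme \<Rightarrow> (nat \<Rightarrow> 'b set) set" where
  "threads p M = {s. \<forall>n. s n \<in> a_rcosets\<^bsub>M\<^esub> (multiples M (p ^ n)) \<and> s (Suc n) \<subseteq> s n}"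

definition to_completion :: "nat \<Rightarrow> ('b, 'm) ring_scheme \<Rightarrow> 'b \<Rightarrow> nat \<Rightarrow> 'b set" where
  "to_completion p M x = (\<lambda>n. multiples M (p ^ n) +>\<^bsub>M\<^esub> x)"

definition ring_completion :: "nat \<Rightarrow> ('b, 'm) ring_scheme \<Rightarrow> (nat \<Rightarrow> 'b set) ring" where
  "ring_completion p R = \<lparr>carrier = threads p R,
     mult = (\<lambda>s t n. s n \<otimes>\<^bsub>R Quot multiples R (p ^ n)\<^esub> t n),
     one = to_completion p R \<one>\<^bsub>R\<^esub>,
     zero = to_completion p R \<zero>\<^bsub>R\<^esub>,
     add = (\<lambda>s t n. s n \<oplus>\<^bsub>R Quot multiples R (p ^ n)\<^esub> t n)\<rparr>"

definition padically_complete :: "nat \<Rightarrow> ('b, 'm) ring_scheme \<Rightarrow> bool" where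
  "padically_complete p R \<longleftrightarrow>
     bij_betw (to_completion p R) (carrier R) (carrier (ring_completion p R))"

text \<open>The map into the completion of M induced by an additive map h into M.\<close>

definition completion_map ::
  "nat \<Rightarrow> ('b, 'm) ring_scheme \<Rightarrow> ('c \<Rightarrow> 'b) \<Rightarrow> (nat \<Rightarrow> 'c set) \<Rightarrow> nat \<Rightarrow> 'b set" where
  "completion_map p M h s = (\<lambda>n. coset_map M (multiples M (p ^ n)) h (s n))"


section \<open>\<open>p\<close>-derivations\<close>

definition frobenius_of :: "nat \<Rightarrow> ('b, 'm) ring_scheme \<Rightarrow> ('b \<Rightarrow> 'b) \<Rightarrow> 'b \<Rightarrow> 'b" where
  "frobenius_of p R \<delta> b = b [^]\<^bsub>R\<^esub> p \<oplus>\<^bsub>R\<^esub> [p] \<cdot>\<^bsub>R\<^esub> \<delta> b"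

text \<open>Only meaningful, and only used, when p is not a zero divisor in R.\<close>

definition p_derivation :: "nat \<Rightarrow> ('b, 'm) ring_scheme \<Rightarrow> ('b \<Rightarrow> 'b) \<Rightarrow> bool" where
  "p_derivation p R \<delta> \<longleftrightarrow>
     \<delta> \<in> carrier R \<rightarrow> carrier R \<and> frobenius_of p R \<delta> \<in> ring_hom R R"


section \<open>Kaehler differentials\<close>

text \<open>Module records extend ring records; their fields mult and one play no role and are left
  unspecified.\<close>

definition free_module :: "('r, 'k) ring_scheme \<Rightarrow> 'i set \<Rightarrow> ('r, 'i \<Rightarrow> 'r) module" where
  "free_module R I = \<lparr>carrier = {f. (\<forall>i\<in>I. f i \<in> carrier R) \<and> (\<forall>i. i \<notin> I \<longrightarrow> f i = \<zero>\<^bsub>R\<^esub>) \<and>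
                                   finite {i. f i \<noteq> \<zero>\<^bsub>R\<^esub>}},
     mult = undefined, one = undefined,
     zero = (\<lambda>i. \<zero>\<^bsub>R\<^esub>),
     add = (\<lambda>f g i. f i \<oplus>\<^bsub>R\<^esub> g i),
     module.smult = (\<lambda>r f i. r \<otimes>\<^bsub>R\<^esub> f i)\<rparr>"

definition basis_symbol :: "('r, 'k) ring_scheme \<Rightarrow> 'i \<Rightarrow> 'i \<Rightarrow> 'r" where
  "basis_symbol R i = (\<lambda>j. if j = i then \<one>\<^bsub>R\<^esub> else \<zero>\<^bsub>R\<^esub>)"

definition submodule_generated ::
  "('r, 'k) ring_scheme \<Rightarrow> ('r, 'b, 'm) module_scheme \<Rightarrow> 'b set \<Rightarrow> 'b set" where
  "submodule_generated R M G = \<Inter>{N. submodule N R M \<and> G \<subseteq> N}"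

definition quotient_module ::
  "('r, 'b, 'm) module_scheme \<Rightarrow> 'b set \<Rightarrow> ('r, 'b set) module" where
  "quotient_module M N = \<lparr>carrier = a_rcosets\<^bsub>M\<^esub> N,
     mult = undefined, one = undefined,
     zero = N,
     add = set_add M,
     module.smult = (\<lambda>r. coset_map M N (\<lambda>x. r \<odot>\<^bsub>M\<^esub> x))\<rparr>"

definition module_completion ::
  "nat \<Rightarrow> ('r, 'b, 'm) module_scheme \<Rightarrow> ('r, nat \<Rightarrow> 'b set) module" where
  "module_completion p M = \<lparr>carrier = threads p M,
     mult = undefined, one = undefined,
     zero = to_completion p M \<zero>\<^bsub>M\<^esub>,
     add = (\<lambda>s t n. s n \<oplus>\<^bsub>quotient_module M (multiples M (p ^ n))\<^esub> t n),
     module.smult = (\<lambda>r s n. r \<odot>\<^bsub>quotient_module M (multiples M (p ^ n))\<^esub> s n)\<rparr>"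

text \<open>Differentials of R relative to the subring K: the free R-module on symbols dr, modulo
  additivity, the Leibniz rule, and da = 0 for a in K.\<close>

definition kaehler_relations :: "('r, 'k) ring_scheme \<Rightarrow> 'r set \<Rightarrow> ('r \<Rightarrow> 'r) set" where
  "kaehler_relations R K =
     (let M = free_module R (carrier R); D = basis_symbol R in
       {D (r \<oplus>\<^bsub>R\<^esub> s) \<ominus>\<^bsub>M\<^esub> (D r \<oplus>\<^bsub>M\<^esub> D s) | r s. r \<in> carrier R \<and> s \<in> carrier R} \<union>
       {D (r \<otimes>\<^bsub>R\<^esub> s) \<ominus>\<^bsub>M\<^esub> (r \<odot>\<^bsub>M\<^esub> D s \<oplus>\<^bsub>M\<^esub> s \<odot>\<^bsub>M\<^esub> D r)
         | r s. r \<in> carrier R \<and> s \<in> carrier R} \<union>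
       {D a | a. a \<in> K})"

definition kaehler_submodule :: "('r, 'k) ring_scheme \<Rightarrow> 'r set \<Rightarrow> ('r \<Rightarrow> 'r) set" where
  "kaehler_submodule R K =
     submodule_generated R (free_module R (carrier R)) (kaehler_relations R K)"

definition kaehler :: "('r, 'k) ring_scheme \<Rightarrow> 'r set \<Rightarrow> ('r, ('r \<Rightarrow> 'r) set) module" where
  "kaehler R K = quotient_module (free_module R (carrier R)) (kaehler_submodule R K)"

definition completed_forms ::
  "nat \<Rightarrow> ('r, 'k) ring_scheme \<Rightarrow> 'r set \<Rightarrow> ('r, nat \<Rightarrow> ('r \<Rightarrow> 'r) set set) module" where
  "completed_forms p R K = module_completion p (kaehler R K)"

definition differential ::
  "nat \<Rightarrow> ('r, 'k) ring_scheme \<Rightarrow> 'r set \<Rightarrow> 'r \<Rightarrow> nat \<Rightarrow> ('r \<Rightarrow> 'r) set set" where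
  "differential p R K g =
     to_completion p (kaehler R K)
       (kaehler_submodule R K +>\<^bsub>free_module R (carrier R)\<^esub> basis_symbol R g)"

text \<open>Pullback of forms along a ring endomorphism phi of R that maps K to K.  On the free module,
  phi sends a sum of terms f dg to the sum of the terms phi(f) d(phi(g)); this passes to the
  quotient and then to the completion.\<close>

definition free_pullback ::
  "('r, 'k) ring_scheme \<Rightarrow> ('r \<Rightarrow> 'r) \<Rightarrow> ('r \<Rightarrow> 'r) \<Rightarrow> ('r \<Rightarrow> 'r)" where
  "free_pullback R \<phi> f =
     (\<lambda>h. \<Oplus>\<^bsub>R\<^esub>g \<in> {g \<in> carrier R. f g \<noteq> \<zero>\<^bsub>R\<^esub> \<and> \<phi> g = h}. \<phi> (f g))"

definition forms_pullback ::
  "nat \<Rightarrow> ('r, 'k) ring_scheme \<Rightarrow> 'r set \<Rightarrow> ('r \<Rightarrow> 'r) \<Rightarrow>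
    (nat \<Rightarrow> ('r \<Rightarrow> 'r) set set) \<Rightarrow> nat \<Rightarrow> ('r \<Rightarrow> 'r) set set" where
  "forms_pullback p R K \<phi> =
     completion_map p (kaehler R K)
       (coset_map (free_module R (carrier R)) (kaehler_submodule R K) (free_pullback R \<phi>))"


section \<open>The base ring\<close>

definition discrete_valuation_ring :: "('b, 'm) ring_scheme \<Rightarrow> bool" where
  "discrete_valuation_ring R \<longleftrightarrow>
     principal_domain R \<and> \<not> field R \<and> (\<exists>!I. maximalideal I R)"

abbreviation residue_field :: "nat \<Rightarrow> ('b, 'm) ring_scheme \<Rightarrow> 'b set ring" where
  "residue_field p R \<equiv> R Quot (PIdl\<^bsub>R\<^esub> ([p] \<cdot>\<^bsub>R\<^esub> \<one>\<^bsub>R\<^esub>))"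

text \<open>The prime field of R/pR is the image of the integers.\<close>

definition residue_field_algebraic :: "nat \<Rightarrow> ('b, 'm) ring_scheme \<Rightarrow> bool" where
  "residue_field_algebraic p R \<longleftrightarrow>
     (let k = residue_field p R; k0 = range (\<lambda>m::int. [m] \<cdot>\<^bsub>k\<^esub> \<one>\<^bsub>k\<^esub>)
      in \<forall>x \<in> carrier k. ring.algebraic k k0 x)"


section \<open>The polynomials\<close>

text \<open>A[x1,x2,x3] is the type of threefold iterated univariate polynomials, with x1 innermost and
  x3 outermost; likewise A[z1,z2], with z1 innermost, and A[z1,z2][x].\<close>

definition cst :: "'a::idom \<Rightarrow> 'a poly poly poly" where "cst b = [:[:[:b:]:]:]"
definition x1 :: "'a::idom poly poly poly" where "x1 = [:[:[:0, 1:]:]:]"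
definition x2 :: "'a::idom poly poly poly" where "x2 = [:[:0, 1:]:]"
definition x3 :: "'a::idom poly poly poly" where "x3 = [:0, 1:]"

definition z1 :: "'a::idom poly poly" where "z1 = [:[:0, 1:]:]"
definition z2 :: "'a::idom poly poly" where "z2 = [:0, 1:]"

text \<open>The value f(u,v) of f in A[z1,z2] in an A-algebra with structure map kappa.\<close>

definition eval2 :: "('a::idom \<Rightarrow> 'b::idom) \<Rightarrow> 'a poly poly \<Rightarrow> 'b \<Rightarrow> 'b \<Rightarrow> 'b" where
  "eval2 \<kappa> f u v = poly (map_poly (\<lambda>g. poly (map_poly \<kappa> g) u) f) v"

text \<open>Only the values a 1, a 2, a 3 of the family a are used.\<close>

definition H1 :: "(nat \<Rightarrow> 'a::idom) \<Rightarrow> 'a poly poly poly" where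
  "H1 a = cst (a 1) * x1 ^ 2 + cst (a 2) * x2 ^ 2 + cst (a 3) * x3 ^ 2"

definition H2 :: "'a::idom poly poly poly" where
  "H2 = x1 ^ 2 + x2 ^ 2 + x3 ^ 2"

definition Npoly :: "(nat \<Rightarrow> 'a::idom) \<Rightarrow> 'a poly poly" where
  "Npoly a = (\<Prod>i=1..3. z1 - [:[:a i:]:] * z2)"

definition Fpoly :: "(nat \<Rightarrow> 'a::idom) \<Rightarrow> 'a poly poly poly" where
  "Fpoly a =
     (let x = [:0, 1:] in
       ([:[:[:a 2 - a 3:]:]:] * x ^ 2 + [:z1 - [:[:a 2:]:] * z2:]) *
       ([:[:[:a 3 - a 1:]:]:] * x ^ 2 + [:- z1 + [:[:a 1:]:] * z2:]))"

definition hasse :: "nat \<Rightarrow> (nat \<Rightarrow> 'a::idom) \<Rightarrow> 'a poly poly" where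
  "hasse p a = Polynomial.coeff (Fpoly a ^ ((p - 1) div 2)) (p - 1)"

definition Qpoly :: "nat \<Rightarrow> (nat \<Rightarrow> 'a::idom) \<Rightarrow> 'a poly poly poly" where
  "Qpoly p a = x1 * x2 * eval2 cst (Npoly a) (H1 a) H2 * eval2 cst (hasse p a) (H1 a) H2"


section \<open>The rings of functions\<close>

text \<open>Qpoly is nonzero when p is odd and the a i are distinct modulo p, so that O(X) is a subring of the
  fraction field of A[x1,x2,x3].\<close>

definition OX :: "nat \<Rightarrow> (nat \<Rightarrow> 'a::idom) \<Rightarrow> 'a poly poly poly fract ring" where
  "OX p a = localization_at (Qpoly p a)"

definition OX_hat :: "nat \<Rightarrow> (nat \<Rightarrow> 'a::idom) \<Rightarrow> (nat \<Rightarrow> 'a poly poly poly fract set) ring" where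
  "OX_hat p a = ring_completion p (OX p a)"

definition fun_X ::
  "nat \<Rightarrow> (nat \<Rightarrow> 'a::idom) \<Rightarrow> 'a poly poly poly \<Rightarrow> nat \<Rightarrow> 'a poly poly poly fract set" where
  "fun_X p a f = to_completion p (OX p a) (Fract f 1)"

definition level_ideal ::
  "nat \<Rightarrow> (nat \<Rightarrow> 'a::idom) \<Rightarrow> 'a \<Rightarrow> 'a \<Rightarrow> 'a poly poly poly fract set" where
  "level_ideal p a c1 c2 =
     Idl\<^bsub>OX p a\<^esub> {Fract (H1 a - cst c1) 1, Fract (H2 - cst c2) 1}"

text \<open>The intersection of E_c with X.\<close>

definition OE ::
  "nat \<Rightarrow> (nat \<Rightarrow> 'a::idom) \<Rightarrow> 'a \<Rightarrow> 'a \<Rightarrow> 'a poly poly poly fract set ring" where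
  "OE p a c1 c2 = OX p a Quot level_ideal p a c1 c2"

definition OE_hat ::
  "nat \<Rightarrow> (nat \<Rightarrow> 'a::idom) \<Rightarrow> 'a \<Rightarrow> 'a \<Rightarrow> (nat \<Rightarrow> 'a poly poly poly fract set set) ring" where
  "OE_hat p a c1 c2 = ring_completion p (OE p a c1 c2)"

definition restrict_to_E ::
  "nat \<Rightarrow> (nat \<Rightarrow> 'a::idom) \<Rightarrow> 'a \<Rightarrow> 'a \<Rightarrow>
    (nat \<Rightarrow> 'a poly poly poly fract set) \<Rightarrow> nat \<Rightarrow> 'a poly poly poly fract set set" where
  "restrict_to_E p a c1 c2 =
     completion_map p (OE p a c1 c2) (\<lambda>b. level_ideal p a c1 c2 +>\<^bsub>OX p a\<^esub> b)"

definition fun_E ::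
  "nat \<Rightarrow> (nat \<Rightarrow> 'a::idom) \<Rightarrow> 'a \<Rightarrow> 'a \<Rightarrow>
    'a poly poly poly \<Rightarrow> nat \<Rightarrow> 'a poly poly poly fract set set" where
  "fun_E p a c1 c2 f =
     to_completion p (OE p a c1 c2) (level_ideal p a c1 c2 +>\<^bsub>OX p a\<^esub> Fract f 1)"

text \<open>Restriction to E is surjective; phi_c is the map through which the composition of the
  Frobenius lift on X with restriction to E factors.\<close>

definition frobenius_E ::
  "nat \<Rightarrow> (nat \<Rightarrow> 'a::idom) \<Rightarrow> 'a \<Rightarrow> 'a \<Rightarrow>
    ((nat \<Rightarrow> 'a poly poly poly fract set) \<Rightarrow> nat \<Rightarrow> 'a poly poly poly fract set) \<Rightarrow>
    (nat \<Rightarrow> 'a poly poly poly fract set set) \<Rightarrow> nat \<Rightarrow> 'a poly poly poly fract set set" where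
  "frobenius_E p a c1 c2 \<delta>X y =
     (THE z. \<exists>x \<in> carrier (OX_hat p a). restrict_to_E p a c1 c2 x = y \<and>
        z = restrict_to_E p a c1 c2 (frobenius_of p (OX_hat p a) \<delta>X x))"


section \<open>Forms on the level sets\<close>

definition base_E ::
  "nat \<Rightarrow> (nat \<Rightarrow> 'a::idom) \<Rightarrow> 'a \<Rightarrow> 'a \<Rightarrow> (nat \<Rightarrow> 'a poly poly poly fract set set) set" where
  "base_E p a c1 c2 = range (\<lambda>b. fun_E p a c1 c2 (cst b))"

abbreviation forms_E where
  "forms_E p a c1 c2 \<equiv> completed_forms p (OE_hat p a c1 c2) (base_E p a c1 c2)"

text \<open>dx3 / ((a1 - a2) x1 x2): since x1 x2 is invertible on X, this one of the three expressions
  for the canonical form is available on all of the intersection of E_c with X, and it agrees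
  with the other two wherever those make sense.\<close>

definition omega ::
  "nat \<Rightarrow> (nat \<Rightarrow> 'a::idom) \<Rightarrow> 'a \<Rightarrow> 'a \<Rightarrow>
    nat \<Rightarrow> ((nat \<Rightarrow> 'a poly poly poly fract set set) \<Rightarrow> nat \<Rightarrow> 'a poly poly poly fract set set) set set"
  where
  "omega p a c1 c2 =
     inv\<^bsub>OE_hat p a c1 c2\<^esub> (fun_E p a c1 c2 (cst (a 1 - a 2) * x1 * x2))
       \<odot>\<^bsub>forms_E p a c1 c2\<^esub>
     differential p (OE_hat p a c1 c2) (base_E p a c1 c2) (fun_E p a c1 c2 x3)"

definition frobenius_pullback_div_p where
  "frobenius_pullback_div_p p a c1 c2 \<delta>X \<eta> =
     divide_by p (forms_E p a c1 c2)
       (forms_pullback p (OE_hat p a c1 c2) (base_E p a c1 c2) (frobenius_E p a c1 c2 \<delta>X) \<eta>)"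

end

theory Submission
  imports Defs
begin

text \<open>On the level set one has \<open>((a1 - a2) x1 x2)^2 = F(c1, c2)(x3)\<close>, so for a Frobenius lift
  with \<open>\<phi> x3 = x3^p + p \<delta> x3\<close> the form \<open>\<phi>* \<omega> / p\<close> is congruent to \<open>h^(-1) \<omega>\<close> modulo \<open>p\<close> as soon as
  \<open>x3^(p - 1) dx3 + d (\<delta> x3) = h^(-1) F^((p - 1)/2) dx3\<close>, where \<open>h\<close> is the Hasse invariant.
  The coefficients of \<open>x3^(p - 1)\<close> on the two sides agree by the definition of \<open>h\<close>, and every other monomial
  of \<open>F^((p - 1)/2)\<close> has an antiderivative over \<open>A\<close> because its degree is at most \<open>2 p - 2\<close>; this
  gives an explicit \<open>\<delta> x3\<close> with coefficients in \<open>A[H1, H2, 1/h]\<close>.  Then \<open>\<phi> x1\<close> and \<open>\<phi> x2\<close> are determined by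
  \<open>\<phi> H1 = H1^p\<close> and \<open>\<phi> H2 = H2^p\<close>: they are square roots, which exist by Hensel's lemma since \<open>2 x1 x2\<close>
  is invertible.

  All differentials are computed through the vector field \<open>D\<close> that kills \<open>H1\<close> and \<open>H2\<close> and is dual to
  \<open>\<omega>\<close>: on the image of \<open>O(X)\<close> one has \<open>db = D b \<omega>\<close>.  Conversely \<open>D\<close> induces a linear form on the completed
  differentials, which shows that they have no \<open>p\<close>-torsion, so that division by \<open>p\<close> is unambiguous.\<close>

section \<open>Congruences modulo multiples\<close>

text \<open>The criterion for \<open>\<delta> x3\<close> arises as follows. Put t = (a1 - a2) x1 x2,
  so that \<omega> = dx3 / t. Since \<phi> t \<equiv> t^p modulo p, the form \<phi>*\<omega> / p is
  congruent to t^(-p) (x3^(p - 1) dx3 + d (\<delta> x3)), while F^((p - 1)/2) becomes t^(p - 1).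
  Thus \<phi> x1 and \<phi> x2 matter only modulo p, which is why no formula for them is needed. The
  factor 1/h can be carried through the antiderivative because h is a polynomial in H1 and H2 and so
  is constant along \<open>D\<close>. The main obstacle is that the differentials are those of a
  completed ring, which has many more functions than O(X). Statements about arbitrary forms are
  therefore made modulo p^n, where a function can be replaced by one from O(X). The same density
  argument replaces exactness of completion when the Frobenius lift is passed from X to a level set.
  Underneath lies an algebraic fact: the ideal (H1 - c1, H2 - c2) contains f whenever it contains p
  f.\<close>

lemma (in abelian_subgroup) coset_eq_iff:
  assumes "x \<in> carrier G" "y \<in> carrier G"
  shows "H +> x = H +> y \<longleftrightarrow> x \<ominus> y \<in> H"
  using assms a_rcos_module [OF assms(2,1)] a_rcos_self a_repr_independence'
  by (metis a_minus_def)

context abelian_group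
begin

lemma multiplesI: "x \<in> carrier G \<Longrightarrow> [k] \<cdot> x \<in> multiples G k"
  by (auto simp: multiples_def)

lemma multiplesE:
  assumes "x \<in> multiples G k"
  obtains y where "y \<in> carrier G" "x = [k] \<cdot> y"
  using assms by (auto simp: multiples_def)

lemma multiples_carrier: "x \<in> multiples G k \<Longrightarrow> x \<in> carrier G"
  by (auto simp: multiples_def)

lemma nat_add_pow_minus:
  "x \<in> carrier G \<Longrightarrow> [(k::nat)] \<cdot> (\<ominus> x) = \<ominus> ([k] \<cdot> x)"
  using add.nat_pow_inv by simp

lemma nat_add_pow_add:
  "\<lbrakk>x \<in> carrier G; y \<in> carrier G\<rbrakk> \<Longrightarrow> [(k::nat)] \<cdot> (x \<oplus> y) = [k] \<cdot> x \<oplus> [k] \<cdot> y"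
  by (simp add: add.nat_pow_distrib)

lemma nat_add_pow_diff:
  "\<lbrakk>x \<in> carrier G; y \<in> carrier G\<rbrakk> \<Longrightarrow> [(k::nat)] \<cdot> (x \<ominus> y) = [k] \<cdot> x \<ominus> [k] \<cdot> y"
  by (simp add: a_minus_def nat_add_pow_add nat_add_pow_minus)

lemma nat_add_pow_mult:
  "x \<in> carrier G \<Longrightarrow> [(k::nat)] \<cdot> ([(l::nat)] \<cdot> x) = [(k * l)] \<cdot> x"
  by (simp add: add.nat_pow_pow mult.commute)

lemma multiples_abelian_subgroup: "abelian_subgroup (multiples G k) G"
proof (rule abelian_subgroupI3)
  show "additive_subgroup (multiples G k) G"
  proof (rule additive_subgroupI, rule add.subgroupI)
    show "multiples G k \<subseteq> carrier G"
      by (auto simp: multiples_def)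
    show "multiples G k \<noteq> {}"
      by (auto simp: multiples_def)
    show "\<ominus> x \<in> multiples G k" if "x \<in> multiples G k" for x
      using that by (elim multiplesE) (simp add: nat_add_pow_minus [symmetric] multiplesI)
    show "x \<oplus> y \<in> multiples G k" if "x \<in> multiples G k" "y \<in> multiples G k" for x y
      using that by (elim multiplesE) (simp add: nat_add_pow_add [symmetric] multiplesI)
  qed
qed (rule abelian_group_axioms)

lemma multiples_zero: "\<zero> \<in> multiples G k"
  and multiples_add: "\<lbrakk>x \<in> multiples G k; y \<in> multiples G k\<rbrakk> \<Longrightarrow> x \<oplus> y \<in> multiples G k"
  and multiples_minus: "x \<in> multiples G k \<Longrightarrow> \<ominus> x \<in> multiples G k"
proof -
  interpret abelian_subgroup "multiples G k" G
    by (rule multiples_abelian_subgroup)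
  show "\<zero> \<in> multiples G k"
    "\<lbrakk>x \<in> multiples G k; y \<in> multiples G k\<rbrakk> \<Longrightarrow> x \<oplus> y \<in> multiples G k"
    "x \<in> multiples G k \<Longrightarrow> \<ominus> x \<in> multiples G k"
    by auto
qed

lemma multiples_diff: "\<lbrakk>x \<in> multiples G k; y \<in> multiples G k\<rbrakk> \<Longrightarrow> x \<ominus> y \<in> multiples G k"
  by (simp add: a_minus_def multiples_add multiples_minus)

lemma multiples_mono: "x \<in> multiples G l \<Longrightarrow> k dvd l \<Longrightarrow> x \<in> multiples G k"
  by (elim multiplesE dvdE) (auto simp: nat_add_pow_mult [symmetric] intro: multiplesI)

lemma congruent_mod_iff:
  assumes "x \<in> carrier G" "y \<in> carrier G"
  shows "congruent_mod k G x y \<longleftrightarrow> x \<ominus> y \<in> multiples G k"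
proof
  assume "congruent_mod k G x y"
  then obtain z where z: "z \<in> multiples G k" "x = y \<oplus> z"
    by (auto simp: congruent_mod_def)
  then have "x \<ominus> y = z"
    using assms multiples_carrier [OF z(1)] by (metis a_comm a_minus_def add.inv_solve_right)
  then show "x \<ominus> y \<in> multiples G k" using z by simp
next
  assume "x \<ominus> y \<in> multiples G k"
  moreover have "x = y \<oplus> (x \<ominus> y)"
    using assms by (simp add: a_minus_def a_lcomm [of y] r_neg)
  ultimately show "congruent_mod k G x y"
    by (auto simp: congruent_mod_def)
qed

lemma congruent_zero_iff:
  "x \<in> carrier G \<Longrightarrow> congruent_mod k G x \<zero> \<longleftrightarrow> x \<in> multiples G k"
  by (auto simp: congruent_mod_def multiples_carrier intro!: bexI [of _ x])

lemma congruent_refl: "x \<in> carrier G \<Longrightarrow> congruent_mod k G x x"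
  by (simp add: congruent_mod_iff r_neg multiples_zero) (simp add: a_minus_def r_neg multiples_zero)

lemma congruent_sym:
  "\<lbrakk>congruent_mod k G x y; x \<in> carrier G; y \<in> carrier G\<rbrakk> \<Longrightarrow> congruent_mod k G y x"
  using multiples_minus [of "x \<ominus> y" k]
  by (simp add: congruent_mod_iff) (simp add: a_minus_def minus_add a_ac)

lemma congruent_trans:
  assumes "congruent_mod k G x y" "congruent_mod k G y z"
    and "x \<in> carrier G" "y \<in> carrier G" "z \<in> carrier G"
  shows "congruent_mod k G x z"
proof -
  have "x \<ominus> z = (x \<ominus> y) \<oplus> (y \<ominus> z)"
    using assms(3-5) by (simp add: a_minus_def a_ac r_neg1 r_neg2)
  then show ?thesis
    using assms multiples_add by (simp add: congruent_mod_iff)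
qed

lemma congruent_add:
  assumes "congruent_mod k G x y" "congruent_mod k G x' y'"
    and "x \<in> carrier G" "y \<in> carrier G" "x' \<in> carrier G" "y' \<in> carrier G"
  shows "congruent_mod k G (x \<oplus> x') (y \<oplus> y')"
proof -
  have "(x \<oplus> x') \<ominus> (y \<oplus> y') = (x \<ominus> y) \<oplus> (x' \<ominus> y')"
    using assms(3-) by (simp add: a_minus_def a_ac minus_add)
  then show ?thesis
    using assms multiples_add by (simp add: congruent_mod_iff)
qed

lemma congruent_minus:
  assumes "congruent_mod k G x y" "x \<in> carrier G" "y \<in> carrier G"
  shows "congruent_mod k G (\<ominus> x) (\<ominus> y)"
proof -
  have "\<ominus> x \<ominus> \<ominus> y = \<ominus> (x \<ominus> y)"
    using assms(2-) by (simp add: a_minus_def a_ac minus_add)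
  then show ?thesis
    using assms multiples_minus by (simp add: congruent_mod_iff)
qed

lemma congruent_diff:
  "\<lbrakk>congruent_mod k G x y; congruent_mod k G x' y';
    x \<in> carrier G; y \<in> carrier G; x' \<in> carrier G; y' \<in> carrier G\<rbrakk>
   \<Longrightarrow> congruent_mod k G (x \<ominus> x') (y \<ominus> y')"
  by (simp add: a_minus_def congruent_add congruent_minus)

lemma congruent_mono:
  "\<lbrakk>congruent_mod l G x y; k dvd l; x \<in> carrier G; y \<in> carrier G\<rbrakk> \<Longrightarrow> congruent_mod k G x y"
  using multiples_mono by (auto simp: congruent_mod_iff)

lemma congruent_multiple:
  "\<lbrakk>x \<in> carrier G; z \<in> carrier G\<rbrakk> \<Longrightarrow> congruent_mod k G (x \<oplus> [k] \<cdot> z) x"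
  by (auto simp: congruent_mod_def multiplesI)

lemma congruentE:
  assumes "congruent_mod k G x y"
  obtains z where "z \<in> carrier G" "x = y \<oplus> [k] \<cdot> z"
  using assms by (auto simp: congruent_mod_def elim: multiplesE)

lemma mult_coset_eq_iff:
  assumes "x \<in> carrier G" "y \<in> carrier G"
  shows "multiples G k +> x = multiples G k +> y \<longleftrightarrow> congruent_mod k G x y"
  using abelian_subgroup.coset_eq_iff [OF multiples_abelian_subgroup assms]
  by (simp add: congruent_mod_iff assms)

lemma multiples_congruent:
  "\<lbrakk>congruent_mod k G x y; y \<in> multiples G k\<rbrakk> \<Longrightarrow> x \<in> multiples G k"
  by (auto simp: congruent_mod_def multiples_add)

lemma diff_zero_imp_eq: "\<lbrakk>x \<ominus> y = \<zero>; x \<in> carrier G; y \<in> carrier G\<rbrakk> \<Longrightarrow> x = y"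
  using add.inv_solve_right [of \<zero> x y] by (simp add: a_minus_def)

text \<open>Cancelling one factor p in p x = p^(n + 1) y turns torsion-freeness into a statement
  about divisibility, the form that is used in the passage to the inverse limit.\<close>

lemma torsion_imp_multiples:
  assumes "\<And>x. x \<in> carrier G \<Longrightarrow> [p] \<cdot> x = \<zero> \<Longrightarrow> x = \<zero>"
    and x: "x \<in> carrier G" "[p] \<cdot> x \<in> multiples G (p ^ Suc n)"
  shows "x \<in> multiples G (p ^ n)"
  using x(2)
proof (rule multiplesE)
  fix y assume y: "y \<in> carrier G" "[p] \<cdot> x = [(p ^ Suc n)] \<cdot> y"
  then have "[p] \<cdot> (x \<ominus> [(p ^ n)] \<cdot> y) = \<zero>"
    using x(1) by (simp add: nat_add_pow_diff nat_add_pow_mult) (simp add: a_minus_def r_neg)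
  then have "x \<ominus> [(p ^ n)] \<cdot> y = \<zero>"
    using assms(1) x(1) y(1) by simp
  then have "x = [(p ^ n)] \<cdot> y"
    using x(1) y(1) by (simp add: diff_zero_imp_eq)
  then show ?thesis using y(1) by (simp add: multiplesI)
qed

end

section \<open>Completions\<close>

text \<open>Threads of cosets are handled through sequences of representatives: operations become
  termwise, and equality of threads becomes a family of congruences.\<close>

definition thread_of :: "nat \<Rightarrow> ('b, 'm) ring_scheme \<Rightarrow> (nat \<Rightarrow> 'b) \<Rightarrow> nat \<Rightarrow> 'b set" where
  "thread_of p M x = (\<lambda>n. multiples M (p ^ n) +>\<^bsub>M\<^esub> x n)"

definition coherent :: "nat \<Rightarrow> ('b, 'm) ring_scheme \<Rightarrow> (nat \<Rightarrow> 'b) \<Rightarrow> bool" where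
  "coherent p M x \<longleftrightarrow> (\<forall>n. x n \<in> carrier M \<and> congruent_mod (p ^ n) M (x (Suc n)) (x n))"

lemma to_completion_conv: "to_completion p M r = thread_of p M (\<lambda>_. r)"
  by (simp add: to_completion_def thread_of_def)

context abelian_group
begin

lemma coherent_carrier: "coherent p G x \<Longrightarrow> x n \<in> carrier G"
  by (simp add: coherent_def)

lemma coherent_const: "r \<in> carrier G \<Longrightarrow> coherent p G (\<lambda>_. r)"
  by (simp add: coherent_def congruent_refl)

lemma coherent_add: "\<lbrakk>coherent p G x; coherent p G y\<rbrakk> \<Longrightarrow> coherent p G (\<lambda>n. x n \<oplus> y n)"
  by (simp add: coherent_def congruent_add)

lemma coherent_minus: "coherent p G x \<Longrightarrow> coherent p G (\<lambda>n. \<ominus> x n)"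
  by (simp add: coherent_def congruent_minus)

lemma coherent_le:
  assumes "coherent p G x" "m \<le> n"
  shows "congruent_mod (p ^ m) G (x n) (x m)"
  using \<open>m \<le> n\<close>
proof (induction n rule: dec_induct)
  case base
  then show ?case using assms(1) by (simp add: coherent_def congruent_refl)
next
  case (step n)
  have "congruent_mod (p ^ m) G (x (Suc n)) (x n)"
    by (rule congruent_mono [of "p ^ n"])
      (use assms(1) step(1) in \<open>auto simp: coherent_def le_imp_power_dvd\<close>)
  then show ?case
    by (rule congruent_trans [OF _ step(3)]) (rule coherent_carrier [OF assms(1)])+
qed

lemma thread_of_mem:
  assumes "coherent p G x"
  shows "thread_of p G x \<in> threads p G"
proof -
  have "thread_of p G x (Suc n) \<subseteq> thread_of p G x n" for n
  proof -
    have x: "x n \<in> carrier G" "x (Suc n) \<in> carrier G"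
      using assms by (auto simp: coherent_def)
    have "multiples G (p ^ Suc n) +> x (Suc n) \<subseteq> multiples G (p ^ n) +> x (Suc n)"
      using multiples_mono [of _ "p ^ Suc n" "p ^ n"] by (auto simp: a_r_coset_def r_coset_def)
    also have "multiples G (p ^ n) +> x (Suc n) = multiples G (p ^ n) +> x n"
      using x assms by (simp add: mult_coset_eq_iff coherent_def)
    finally show ?thesis by (simp add: thread_of_def)
  qed
  moreover have "multiples G (p ^ n) \<subseteq> carrier G" for n
    by (auto simp: multiples_def)
  ultimately show ?thesis
    using assms by (auto simp: threads_def thread_of_def coherent_def intro!: a_rcosetsI)
qed

lemma multiples_rcos_self:
  "x \<in> carrier G \<Longrightarrow> x \<in> multiples G k +> x"
  using abelian_subgroup.a_rcos_self [OF multiples_abelian_subgroup] .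

lemma multiples_rcos_memD:
  assumes "y \<in> multiples G k +> x" "x \<in> carrier G"
  shows "y \<in> carrier G" "congruent_mod k G y x"
  using assms multiples_carrier
  by (auto simp: a_r_coset_def r_coset_def congruent_mod_def a_comm)

text \<open>Inclusion of successive cosets amounts to a congruence between any chosen
  representatives.\<close>

lemma threadE:
  assumes "s \<in> threads p G"
  obtains x where "coherent p G x" "s = thread_of p G x"
proof -
  have "\<exists>x \<in> carrier G. s n = multiples G (p ^ n) +> x" for n
    using assms by (auto simp: threads_def A_RCOSETS_def RCOSETS_def a_r_coset_def)
  then obtain x where x: "\<And>n. x n \<in> carrier G" "\<And>n. s n = multiples G (p ^ n) +> x n"
    by metis
  have "congruent_mod (p ^ n) G (x (Suc n)) (x n)" for n
  proof (rule multiples_rcos_memD)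
    show "x (Suc n) \<in> multiples G (p ^ n) +> x n"
      using assms x multiples_rcos_self [of "x (Suc n)" "p ^ Suc n"] by (auto simp: threads_def)
  qed (rule x)
  then show ?thesis
    using x by (intro that [of x]) (auto simp: coherent_def thread_of_def)
qed

lemma thread_of_eq_iff:
  assumes "\<And>n. x n \<in> carrier G" "\<And>n. y n \<in> carrier G"
  shows "thread_of p G x = thread_of p G y \<longleftrightarrow> (\<forall>n. congruent_mod (p ^ n) G (x n) (y n))"
  using assms by (simp add: thread_of_def fun_eq_iff mult_coset_eq_iff)

lemma multiples_rcos_sum:
  "\<lbrakk>x \<in> carrier G; y \<in> carrier G\<rbrakk> \<Longrightarrow>
    (multiples G k +> x) <+> (multiples G k +> y) = multiples G k +> (x \<oplus> y)"
  by (rule abelian_subgroup.a_rcos_sum [OF multiples_abelian_subgroup])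

end

text \<open>Only carrier, zero and addition of \<open>C\<close> are prescribed, so that
  \<open>ring_completion\<close> and \<open>module_completion\<close> are both instances.\<close>

locale completion = abelian_group G for G (structure) +
  fixes p :: nat and C :: "(nat \<Rightarrow> 'a set, 'c) ring_scheme"
  assumes carrier_C: "carrier C = threads p G"
    and zero_C: "\<zero>\<^bsub>C\<^esub> = to_completion p G \<zero>"
    and add_C: "s \<oplus>\<^bsub>C\<^esub> t = (\<lambda>n. s n <+> t n)"
begin

abbreviation "thr \<equiv> thread_of p G"
abbreviation "emb \<equiv> to_completion p G"

lemma thr_closed: "coherent p G x \<Longrightarrow> thr x \<in> carrier C"
  by (simp add: carrier_C thread_of_mem)

lemma emb_closed: "r \<in> carrier G \<Longrightarrow> emb r \<in> carrier C"
  by (simp add: to_completion_conv thr_closed coherent_const)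

lemma thr_add:
  "\<lbrakk>\<And>n. x n \<in> carrier G; \<And>n. y n \<in> carrier G\<rbrakk> \<Longrightarrow> thr x \<oplus>\<^bsub>C\<^esub> thr y = thr (\<lambda>n. x n \<oplus> y n)"
  by (simp add: add_C thread_of_def multiples_rcos_sum)

lemma thr_zero: "\<zero>\<^bsub>C\<^esub> = thr (\<lambda>_. \<zero>)"
  by (simp add: zero_C to_completion_conv)

lemma carrier_E:
  assumes "s \<in> carrier C"
  obtains x where "coherent p G x" "\<And>n. x n \<in> carrier G" "s = thr x"
  using assms threadE coherent_carrier unfolding carrier_C by metis

lemma completion_abelian_group: "abelian_group C"
proof (rule abelian_groupI)
  fix s t assume st: "s \<in> carrier C" "t \<in> carrier C"
  from st obtain x y where xy: "coherent p G x" "\<And>n. x n \<in> carrier G" "s = thr x"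
    "coherent p G y" "\<And>n. y n \<in> carrier G" "t = thr y"
    by (metis carrier_E)
  show "s \<oplus>\<^bsub>C\<^esub> t \<in> carrier C"
    using xy by (simp add: thr_add thr_closed coherent_add)
  show "s \<oplus>\<^bsub>C\<^esub> t = t \<oplus>\<^bsub>C\<^esub> s"
    using xy by (simp add: thr_add a_comm)
  show "\<zero>\<^bsub>C\<^esub> \<oplus>\<^bsub>C\<^esub> s = s"
    using xy by (simp add: thr_add thr_zero)
  show "\<exists>z\<in>carrier C. z \<oplus>\<^bsub>C\<^esub> s = \<zero>\<^bsub>C\<^esub>"
    using xy by (intro bexI [of _ "thr (\<lambda>n. \<ominus> x n)"])
      (simp_all add: thr_add thr_zero l_neg thr_closed coherent_minus)
  fix u assume "u \<in> carrier C"
  then obtain z where z: "coherent p G z" "\<And>n. z n \<in> carrier G" "u = thr z"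
    by (metis carrier_E)
  show "s \<oplus>\<^bsub>C\<^esub> t \<oplus>\<^bsub>C\<^esub> u = s \<oplus>\<^bsub>C\<^esub> (t \<oplus>\<^bsub>C\<^esub> u)"
    using xy z by (simp add: thr_add a_assoc)
next
  show "\<zero>\<^bsub>C\<^esub> \<in> carrier C"
    by (simp add: thr_zero thr_closed coherent_const)
qed

sublocale C: abelian_group C
  by (rule completion_abelian_group)

lemma emb_add: "\<lbrakk>r \<in> carrier G; r' \<in> carrier G\<rbrakk> \<Longrightarrow> emb (r \<oplus> r') = emb r \<oplus>\<^bsub>C\<^esub> emb r'"
  by (simp add: to_completion_conv thr_add)

lemma thr_nat_pow:
  assumes "\<And>n. x n \<in> carrier G"
  shows "[(k::nat)] \<cdot>\<^bsub>C\<^esub> thr x = thr (\<lambda>n. [k] \<cdot> x n)"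
proof (induction k)
  case 0
  then show ?case by (simp add: thr_zero)
next
  case (Suc k)
  then show ?case using assms by (simp add: thr_add)
qed

lemma thr_minus:
  assumes "coherent p G x"
  shows "\<ominus>\<^bsub>C\<^esub> thr x = thr (\<lambda>n. \<ominus> x n)"
proof (rule C.minus_equality)
  show "thr (\<lambda>n. \<ominus> x n) \<oplus>\<^bsub>C\<^esub> thr x = \<zero>\<^bsub>C\<^esub>"
    using assms by (simp add: coherent_def thr_add thr_zero l_neg)
qed (use assms in \<open>auto simp: thr_closed coherent_minus\<close>)

lemma thr_diff:
  assumes "coherent p G x" "coherent p G y"
  shows "thr x \<ominus>\<^bsub>C\<^esub> thr y = thr (\<lambda>n. x n \<ominus> y n)"
  using assms by (simp add: a_minus_def thr_minus thr_add coherent_carrier)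

lemma emb_nat_pow: "r \<in> carrier G \<Longrightarrow> emb ([(k::nat)] \<cdot> r) = [k] \<cdot>\<^bsub>C\<^esub> emb r"
  by (simp add: to_completion_conv thr_nat_pow)

lemma emb_congruent:
  assumes "congruent_mod k G r r'" "r \<in> carrier G" "r' \<in> carrier G"
  shows "congruent_mod k C (emb r) (emb r')"
  using assms(1)
  by (rule congruentE) (simp add: assms emb_add emb_nat_pow C.congruent_multiple emb_closed)

end

text \<open>The assumption is weaker than absence of p-torsion in \<open>G\<close>: an element
  killed by p need only be divisible by every p^n. This suffices for the completion to be
  torsion-free, and it is what can be shown for the differentials of a completed ring.\<close>

locale torsion_free_completion = completion +
  assumes torsion: "\<lbrakk>x \<in> carrier G; [p] \<cdot> x \<in> multiples G (p ^ Suc n)\<rbrakk> \<Longrightarrow> x \<in> multiples G (p ^ n)"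
begin

lemma torsion_pow:
  "\<lbrakk>x \<in> carrier G; [(p ^ k)] \<cdot> x \<in> multiples G (p ^ (k + n))\<rbrakk> \<Longrightarrow> x \<in> multiples G (p ^ n)"
proof (induction k arbitrary: x)
  case 0
  then show ?case by simp
next
  case (Suc k)
  then have "[p] \<cdot> ([(p ^ k)] \<cdot> x) \<in> multiples G (p ^ Suc (k + n))"
    by (simp add: nat_add_pow_mult)
  then have "[(p ^ k)] \<cdot> x \<in> multiples G (p ^ (k + n))"
    using torsion Suc.prems(1) by simp
  then show ?case using Suc by simp
qed

lemma completion_torsion_free:
  assumes "s \<in> carrier C" "[p] \<cdot>\<^bsub>C\<^esub> s = \<zero>\<^bsub>C\<^esub>"
  shows "s = \<zero>\<^bsub>C\<^esub>"
proof -
  obtain x where x: "coherent p G x" "\<And>n. x n \<in> carrier G" "s = thr x"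
    using assms(1) by (metis carrier_E)
  have "\<And>n. congruent_mod (p ^ n) G ([p] \<cdot> x n) \<zero>"
    using assms(2) x by (simp add: thr_nat_pow thr_zero thread_of_eq_iff)
  \<comment> \<open>Cancelling p costs one power, which the index shift absorbs; coherence then
    brings the conclusion back to \<open>x n\<close>.\<close>
  then have "\<And>n. x (Suc n) \<in> multiples G (p ^ n)"
    using x torsion by (simp add: congruent_zero_iff del: power_Suc)
  then have "\<And>n. congruent_mod (p ^ n) G (x n) \<zero>"
    using x by (metis coherent_def congruent_zero_iff congruent_sym multiples_congruent)
  then show ?thesis
    using x by (simp add: thr_zero thread_of_eq_iff)
qed

text \<open>The kernel of the projection to level n is exactly p^n times the completion. If
  \<open>x n\<close> is divisible by p^n, so are all later terms, and their quotients are again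
  coherent: a congruence modulo p^(n + k) between the terms becomes one modulo p^k after
  division.\<close>

lemma thr_multiple_iff:
  assumes x: "coherent p G x"
  shows "thr x \<in> multiples C (p ^ n) \<longleftrightarrow> x n \<in> multiples G (p ^ n)"
proof
  note xc = coherent_carrier [OF x]
  assume "thr x \<in> multiples C (p ^ n)"
  then obtain t where "t \<in> carrier C" "thr x = [(p ^ n)] \<cdot>\<^bsub>C\<^esub> t"
    by (rule C.multiplesE)
  then obtain y where y: "\<And>n. y n \<in> carrier G" "thr x = thr (\<lambda>m. [(p ^ n)] \<cdot> y m)"
    by (metis carrier_E thr_nat_pow)
  then have "congruent_mod (p ^ n) G (x n) ([(p ^ n)] \<cdot> y n)"
    using xc by (simp add: thread_of_eq_iff)
  then show "x n \<in> multiples G (p ^ n)"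
    using y(1) by (rule multiples_congruent [OF _ multiplesI])
next
  note xc = coherent_carrier [OF x]
  assume xn: "x n \<in> multiples G (p ^ n)"
  have "x (n + k) \<in> multiples G (p ^ n)" for k
    using coherent_le [OF x, of n "n + k"] xn by (simp add: multiples_congruent)
  then have "\<exists>y\<in>carrier G. x (n + k) = [(p ^ n)] \<cdot> y" for k
    by (auto elim: multiplesE)
  then obtain y where y: "\<And>k. y k \<in> carrier G" "\<And>k. x (n + k) = [(p ^ n)] \<cdot> y k"
    by metis
  have "congruent_mod (p ^ k) G (y (Suc k)) (y k)" for k
  proof -
    have "congruent_mod (p ^ (n + k)) G (x (n + Suc k)) (x (n + k))"
      using x by (simp add: coherent_def)
    then have "[(p ^ n)] \<cdot> (y (Suc k) \<ominus> y k) \<in> multiples G (p ^ (n + k))"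
      unfolding y(2) using y(1) by (simp add: congruent_mod_iff nat_add_pow_diff)
    then show ?thesis
      using y(1) torsion_pow by (simp add: congruent_mod_iff)
  qed
  then have "coherent p G y" using y by (simp add: coherent_def)
  moreover have "thr x = [(p ^ n)] \<cdot>\<^bsub>C\<^esub> thr y"
  proof -
    \<comment> \<open>A thread does not change when initial terms of the sequence are
      dropped.\<close>
    have "thr x = thr (\<lambda>k. x (n + k))"
      by (subst thread_of_eq_iff) (simp_all add: xc coherent_le [OF x] congruent_sym)
    also have "\<dots> = [(p ^ n)] \<cdot>\<^bsub>C\<^esub> thr y"
      using y by (simp add: thr_nat_pow)
    finally show ?thesis .
  qed
  ultimately show "thr x \<in> multiples C (p ^ n)"
    by (simp add: thr_closed C.multiplesI)
qed

lemma emb_multiple_iff: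
  "r \<in> carrier G \<Longrightarrow> emb r \<in> multiples C (p ^ n) \<longleftrightarrow> r \<in> multiples G (p ^ n)"
  by (simp add: to_completion_conv thr_multiple_iff coherent_const)

lemma thr_congruent_iff:
  assumes "coherent p G x" "coherent p G y"
  shows "congruent_mod (p ^ n) C (thr x) (thr y) \<longleftrightarrow> congruent_mod (p ^ n) G (x n) (y n)"
proof -
  have "coherent p G (\<lambda>n. x n \<ominus> y n)"
    using assms by (simp add: a_minus_def coherent_add coherent_minus)
  then show ?thesis
    using assms
    by (simp add: C.congruent_mod_iff congruent_mod_iff thr_closed coherent_carrier thr_diff thr_multiple_iff)
qed

lemma emb_dense:
  assumes "s \<in> carrier C"
  obtains r where "r \<in> carrier G" "congruent_mod (p ^ n) C s (emb r)"
proof -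
  obtain x where x: "coherent p G x" "\<And>n. x n \<in> carrier G" "s = thr x"
    using assms(1) by (metis carrier_E)
  then show ?thesis
    by (intro that [of "x n"])
      (simp_all add: to_completion_conv thr_congruent_iff coherent_const congruent_refl)
qed

end

text \<open>Completeness is stated through limits of coherent sequences, so that a complete ring and
  a completion can be treated alike and no cosets appear in later limit arguments.\<close>

locale padic_group = abelian_group G for G (structure) +
  fixes p :: nat
  assumes torsion_free: "\<lbrakk>x \<in> carrier G; [p] \<cdot> x = \<zero>\<rbrakk> \<Longrightarrow> x = \<zero>"
    and separated: "\<lbrakk>x \<in> carrier G; \<And>n. x \<in> multiples G (p ^ n)\<rbrakk> \<Longrightarrow> x = \<zero>"
    and complete: "coherent p G f \<Longrightarrow> \<exists>s\<in>carrier G. \<forall>n. congruent_mod (p ^ n) G s (f n)"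
begin

lemma eqI:
  assumes "x \<in> carrier G" "y \<in> carrier G" "\<And>n. congruent_mod (p ^ n) G x y"
  shows "x = y"
  using assms separated [of "x \<ominus> y"] by (simp add: congruent_mod_iff diff_zero_imp_eq)

lemma cancel:
  assumes "x \<in> carrier G" "y \<in> carrier G" "[p] \<cdot> x = [p] \<cdot> y"
  shows "x = y"
  using assms torsion_free [of "x \<ominus> y"]
  by (simp add: nat_add_pow_diff diff_zero_imp_eq) (simp add: a_minus_def r_neg diff_zero_imp_eq)

end

context torsion_free_completion
begin

lemma completion_padic_group: "padic_group C p"
proof
  fix s assume s: "s \<in> carrier C"
  show "s = \<zero>\<^bsub>C\<^esub>" if "[p] \<cdot>\<^bsub>C\<^esub> s = \<zero>\<^bsub>C\<^esub>"
    using s that by (rule completion_torsion_free)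
  show "s = \<zero>\<^bsub>C\<^esub>" if "\<And>n. s \<in> multiples C (p ^ n)"
  proof -
    obtain x where "coherent p G x" "\<And>n. x n \<in> carrier G" "s = thr x"
      using s by (metis carrier_E)
    then show ?thesis
      using that by (simp add: thr_zero thread_of_eq_iff congruent_zero_iff thr_multiple_iff)
  qed
next
  fix f assume f: "coherent p C f"
  then have "\<exists>x. coherent p G x \<and> f n = thr x" for n
    by (metis carrier_E coherent_def)
  then obtain x where x: "\<And>n. coherent p G (x n)" "\<And>n. f n = thr (x n)"
    by metis
  \<comment> \<open>The diagonal: modulo p^n the limit has to agree with \<open>f n\<close>, hence
    with level n of its thread.\<close>
  define y where "y n = x n n" for n
  have "congruent_mod (p ^ n) G (y (Suc n)) (y n)" for n
  proof -
    have "congruent_mod (p ^ n) G (x (Suc n) (Suc n)) (x (Suc n) n)"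
      using x by (simp add: coherent_def)
    moreover have "congruent_mod (p ^ n) G (x (Suc n) n) (x n n)"
      using f x by (simp add: coherent_def thr_congruent_iff)
    ultimately show ?thesis
      unfolding y_def by (rule congruent_trans) (rule coherent_carrier [OF x(1)])+
  qed
  then have y: "coherent p G y"
    using x by (simp add: coherent_def y_def)
  then show "\<exists>s\<in>carrier C. \<forall>n. congruent_mod (p ^ n) C s (f n)"
    using x by (intro bexI [of _ "thr y"])
      (simp_all add: thr_congruent_iff thr_closed y_def congruent_refl coherent_carrier [OF x(1)])
qed

end

section \<open>Congruences in rings and Hensel's lemma\<close>

context cring
begin

lemma multiples_ideal: "ideal (multiples R k) R"
proof (rule idealI)
  show "ring R" by (rule ring_axioms)
  show "subgroup (multiples R k) (add_monoid R)"
    using multiples_abelian_subgroup [of k]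
    by (simp add: abelian_subgroup_def additive_subgroup_def)
qed (auto simp: multiples_def add_pow_rdistr add_pow_ldistr)

lemma congruent_mult:
  assumes "congruent_mod k R x y" "congruent_mod k R x' y'"
    and "x \<in> carrier R" "y \<in> carrier R" "x' \<in> carrier R" "y' \<in> carrier R"
  shows "congruent_mod k R (x \<otimes> x') (y \<otimes> y')"
proof -
  interpret I: ideal "multiples R k" R by (rule multiples_ideal)
  have "x \<otimes> x' \<ominus> y \<otimes> y' = (x \<ominus> y) \<otimes> x' \<oplus> y \<otimes> (x' \<ominus> y')"
    using assms(3-) by algebra
  moreover have "x \<ominus> y \<in> multiples R k" "x' \<ominus> y' \<in> multiples R k"
    using assms by (simp_all add: congruent_mod_iff)
  ultimately have "x \<otimes> x' \<ominus> y \<otimes> y' \<in> multiples R k"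
    using assms(3-) by (simp add: I.I_l_closed I.I_r_closed multiples_add)
  then show ?thesis
    using assms(3-) by (simp add: congruent_mod_iff)
qed

lemma congruent_pow:
  assumes "congruent_mod k R x y" "x \<in> carrier R" "y \<in> carrier R"
  shows "congruent_mod k R (x [^] (n::nat)) (y [^] n)"
  by (induction n) (simp_all add: assms congruent_refl congruent_mult)

lemma multiples_mult:
  assumes "x \<in> multiples R k" "y \<in> multiples R l"
  shows "x \<otimes> y \<in> multiples R (k * l)"
  using assms
  by (elim multiplesE)
    (simp add: add_pow_rdistr add_pow_ldistr nat_add_pow_mult multiplesI mult.commute)

lemma multiples_l_closed: "\<lbrakk>x \<in> multiples R k; y \<in> carrier R\<rbrakk> \<Longrightarrow> y \<otimes> x \<in> multiples R k"
  using ideal.I_l_closed [OF multiples_ideal] .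

text \<open>Here e stands for the error z^2 - w, so the left-hand side is the error after replacing
  z by z - e v. The factor \<open>\<one>\<close> is kept because it is later read as 2 u v.\<close>

lemma newton_step:
  assumes "z \<in> carrier R" "e \<in> carrier R" "v \<in> carrier R"
  shows "(z \<ominus> e \<otimes> v) \<otimes> (z \<ominus> e \<otimes> v) \<ominus> (z \<otimes> z \<ominus> e) =
    e \<otimes> \<one> \<ominus> (z \<oplus> z) \<otimes> v \<otimes> e \<oplus> e \<otimes> e \<otimes> (v \<otimes> v)"
  using assms by algebra

text \<open>With 2 u v = 1 the terms linear in e combine to e times a multiple of z - u, and z
  \<equiv> u modulo p provides the gain of a factor p.\<close>

lemma newton_cancel:
  assumes "z \<in> carrier R" "e \<in> carrier R" "v \<in> carrier R" "u \<in> carrier R"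
  shows "e \<otimes> ((u \<oplus> u) \<otimes> v) \<ominus> (z \<oplus> z) \<otimes> v \<otimes> e = e \<otimes> ((\<ominus> (v \<oplus> v)) \<otimes> (z \<ominus> u))"
  using assms by algebra

lemma coherent_mult: "\<lbrakk>coherent p R x; coherent p R y\<rbrakk> \<Longrightarrow> coherent p R (\<lambda>n. x n \<otimes> y n)"
  by (simp add: coherent_def congruent_mult)

end

locale padic_ring = cring R + padic_group R p for R (structure) and p :: nat
begin

text \<open>The inverse is the limit of the partial sums of the geometric series in w.\<close>

lemma unit_of_congruent_one:
  assumes w: "w \<in> multiples R p"
  shows "\<one> \<ominus> w \<in> Units R"
proof -
  have wc: "w \<in> carrier R" using w by (rule multiples_carrier)
  have wp: "w [^] n \<in> multiples R (p ^ n)" for n :: nat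
  proof (induction n)
    case 0
    then show ?case using multiplesI [of \<one> 1] by simp
  next
    case (Suc n)
    then show ?case using multiples_mult [OF Suc w] by (simp add: mult.commute)
  qed
  \<comment> \<open>The recursion produces the partial sums 1 + w + ... + w^(n - 1), starting with
    the empty sum.\<close>
  define s where "s = rec_nat \<zero> (\<lambda>_ x. \<one> \<oplus> w \<otimes> x)"
  have s0: "s 0 = \<zero>" and sS: "s (Suc n) = \<one> \<oplus> w \<otimes> s n" for n
    by (simp_all add: s_def)
  have sc: "s n \<in> carrier R" for n
    by (induction n) (simp_all add: s0 sS wc)
  have geo: "(\<one> \<ominus> w) \<otimes> s n = \<one> \<ominus> w [^] n" for n
  proof (induction n)
    case 0
    then show ?case using wc by (simp add: s0) (simp add: a_minus_def r_neg)
  next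
    case (Suc n)
    have "(\<one> \<ominus> w) \<otimes> s (Suc n) = (\<one> \<ominus> w) \<oplus> w \<otimes> ((\<one> \<ominus> w) \<otimes> s n)"
      unfolding sS using wc sc [of n] by algebra
    also have "\<dots> = \<one> \<ominus> w \<otimes> w [^] n"
      unfolding Suc using wc nat_pow_closed [OF wc, of n] by algebra
    finally show ?case using wc by (simp add: m_comm)
  qed
  have diff: "s (Suc n) \<ominus> s n = w [^] n" for n
  proof -
    have "s (Suc n) \<ominus> s n = \<one> \<ominus> (\<one> \<ominus> w) \<otimes> s n"
      unfolding sS using wc sc [of n] by algebra
    also have "\<dots> = w [^] n"
      unfolding geo using nat_pow_closed [OF wc, of n] by algebra
    finally show ?thesis .
  qed
  have "coherent p R s"
    unfolding coherent_def using sc wp by (simp add: congruent_mod_iff diff)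
  then obtain t where t: "t \<in> carrier R" "\<And>n. congruent_mod (p ^ n) R t (s n)"
    using complete by blast
  have "(\<one> \<ominus> w) \<otimes> t = \<one>"
  proof (rule eqI)
    fix n
    have "congruent_mod (p ^ n) R ((\<one> \<ominus> w) \<otimes> t) ((\<one> \<ominus> w) \<otimes> s n)"
      using t wc sc by (intro congruent_mult congruent_refl) simp_all
    moreover have "congruent_mod (p ^ n) R (\<one> \<ominus> w [^] n) (\<one> \<ominus> \<zero>)"
      using wp wc by (intro congruent_diff congruent_refl) (simp_all add: congruent_zero_iff)
    ultimately show "congruent_mod (p ^ n) R ((\<one> \<ominus> w) \<otimes> t) \<one>"
      unfolding geo using t wc by (auto intro: congruent_trans simp: a_minus_def)
  qed (use t wc in simp_all)
  then show ?thesis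
    using t(1) wc by (auto simp: Units_def m_comm)
qed

text \<open>Invertibility in a complete ring can be tested modulo p: u v differs from 1 by a
  multiple of p, so it is a unit by the geometric series, and a factor of a unit is a unit.\<close>

lemma unit_of_congruent_unit:
  assumes "congruent_mod p R (u \<otimes> v) \<one>" "u \<in> carrier R" "v \<in> carrier R"
  shows "u \<in> Units R"
proof -
  define w where "w = \<one> \<ominus> u \<otimes> v"
  have "w \<in> multiples R p"
    using congruent_sym [OF assms(1)] assms(2,3) by (simp add: congruent_mod_iff w_def)
  then have "\<one> \<ominus> w \<in> Units R" by (rule unit_of_congruent_one)
  moreover have "\<one> \<ominus> w = u \<otimes> v"
    unfolding w_def using assms(2,3) by algebra
  ultimately show ?thesis
    using assms(2,3) unit_factor [of u v] by metis
qed

text \<open>Newton's iteration for y^2 = w with the derivative frozen at its initial value 2 u. Each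
  step is then credited with only one factor p, but the single inverse v serves for all
  steps.\<close>

lemma square_root:
  assumes u: "u \<in> carrier R" and v: "v \<in> carrier R" "(u \<oplus> u) \<otimes> v = \<one>"
    and w: "w \<in> carrier R" "congruent_mod p R w (u \<otimes> u)"
  obtains y where "y \<in> carrier R" "y \<otimes> y = w" "congruent_mod p R y u"
proof -
  define y where "y = rec_nat u (\<lambda>_ x. x \<ominus> (x \<otimes> x \<ominus> w) \<otimes> v)"
  have y0: "y 0 = u" and yS: "y (Suc n) = y n \<ominus> (y n \<otimes> y n \<ominus> w) \<otimes> v" for n
    by (simp_all add: y_def)
  have yc: "y n \<in> carrier R" for n
    by (induction n) (simp_all add: y0 yS u v w)
  \<comment> \<open>The exponent starts at 1 because the initial error u^2 - w is already divisible
    by p. Staying congruent to u is what lets v act as an approximate inverse of 2 (y n).\<close>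
  have inv: "y n \<ominus> u \<in> multiples R p \<and> y n \<otimes> y n \<ominus> w \<in> multiples R (p ^ Suc n)" for n
  proof (induction n)
    case 0
    show ?case
      using congruent_sym [OF w(2)] u w(1) multiples_zero
      by (simp add: y0 congruent_mod_iff) (simp add: a_minus_def r_neg multiples_zero)
  next
    case (Suc n)
    define e where "e = y n \<otimes> y n \<ominus> w"
    have ec: "e \<in> carrier R" using yc w by (simp add: e_def)
    have ep: "e \<in> multiples R (p ^ Suc n)" using Suc by (simp add: e_def)
    then have ep1: "e \<in> multiples R p" by (rule multiples_mono) simp
    have wn: "w = y n \<otimes> y n \<ominus> e"
      unfolding e_def using yc [of n] w(1) by algebra
    have "y (Suc n) \<otimes> y (Suc n) \<ominus> w =
        (y n \<ominus> e \<otimes> v) \<otimes> (y n \<ominus> e \<otimes> v) \<ominus> (y n \<otimes> y n \<ominus> e)"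
      unfolding yS e_def [symmetric] wn [symmetric] ..
    also have "\<dots> = e \<otimes> \<one> \<ominus> (y n \<oplus> y n) \<otimes> v \<otimes> e \<oplus> e \<otimes> e \<otimes> (v \<otimes> v)"
      using ec yc v(1) by (simp only: newton_step)
    also have "\<dots> = e \<otimes> ((\<ominus> (v \<oplus> v)) \<otimes> (y n \<ominus> u)) \<oplus> e \<otimes> e \<otimes> (v \<otimes> v)"
      using newton_cancel [OF yc ec v(1) u] v(2) by simp
    finally have "y (Suc n) \<otimes> y (Suc n) \<ominus> w =
      e \<otimes> ((\<ominus> (v \<oplus> v)) \<otimes> (y n \<ominus> u)) \<oplus> (v \<otimes> v) \<otimes> (e \<otimes> e)"
      using ec v by (simp add: m_comm)
    moreover have "e \<otimes> ((\<ominus> (v \<oplus> v)) \<otimes> (y n \<ominus> u)) \<in> multiples R (p ^ Suc n * p)"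
      using Suc v by (intro multiples_mult ep multiples_l_closed) simp_all
    moreover have "(v \<otimes> v) \<otimes> (e \<otimes> e) \<in> multiples R (p ^ Suc n * p)"
      using v by (intro multiples_l_closed multiples_mult ep ep1) simp_all
    ultimately have "y (Suc n) \<otimes> y (Suc n) \<ominus> w \<in> multiples R (p ^ Suc (Suc n))"
      using multiples_add by (simp add: mult.commute)
    moreover have "y (Suc n) \<ominus> u = (y n \<ominus> u) \<ominus> v \<otimes> e"
      unfolding yS e_def [symmetric] using ec yc [of n] v(1) u by algebra
    then have "y (Suc n) \<ominus> u \<in> multiples R p"
      using Suc ep1 v by (simp add: multiples_diff multiples_l_closed)
    ultimately show ?case by simp
  qed
  have "coherent p R y"
  proof -
    have "y (Suc n) \<ominus> y n = \<ominus> (v \<otimes> (y n \<otimes> y n \<ominus> w))" for n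
      unfolding yS using yc [of n] v(1) w by algebra
    moreover have "y n \<otimes> y n \<ominus> w \<in> multiples R (p ^ n)" for n
      using inv [of n] by (auto intro: multiples_mono)
    ultimately have "y (Suc n) \<ominus> y n \<in> multiples R (p ^ n)" for n
      using v by (simp add: multiples_minus multiples_l_closed)
    then show ?thesis
      using yc by (simp add: coherent_def congruent_mod_iff)
  qed
  then obtain z where z: "z \<in> carrier R" "\<And>n. congruent_mod (p ^ n) R z (y n)"
    using complete by blast
  show thesis
  proof (rule that [OF z(1)])
    show "z \<otimes> z = w"
    proof (rule eqI)
      fix n
      have "congruent_mod (p ^ n) R (z \<otimes> z) (y n \<otimes> y n)"
        using z yc by (intro congruent_mult) simp_all
      moreover have "congruent_mod (p ^ n) R (y n \<otimes> y n) w"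
        using inv [of n] yc w by (auto simp: congruent_mod_iff intro: multiples_mono)
      ultimately show "congruent_mod (p ^ n) R (z \<otimes> z) w"
        by (rule congruent_trans) (simp_all add: z yc w)
    qed (use z w in simp_all)
    have "congruent_mod p R (y 1) u"
      using inv [of 1] yc u by (simp add: congruent_mod_iff)
    with z(2) [of 1] show "congruent_mod p R z u"
      by (simp add: congruent_trans [OF _ _ z(1) yc u])
  qed
qed

end

section \<open>Completions of rings without p-torsion\<close>

locale torsion_free_ring = cring R for R (structure) +
  fixes p :: nat
  assumes ring_torsion_free: "\<lbrakk>x \<in> carrier R; [p] \<cdot> x = \<zero>\<rbrakk> \<Longrightarrow> x = \<zero>"

sublocale torsion_free_ring < C: torsion_free_completion R p "ring_completion p R"
  by unfold_locales
    (auto simp: ring_completion_def FactRing_def intro: torsion_imp_multiples ring_torsion_free)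

context torsion_free_ring
begin

lemma thread_mult:
  assumes "\<And>n. x n \<in> carrier R" "\<And>n. y n \<in> carrier R"
  shows "thread_of p R x \<otimes>\<^bsub>ring_completion p R\<^esub> thread_of p R y = thread_of p R (\<lambda>n. x n \<otimes> y n)"
  using assms ideal.rcoset_mult_add [OF multiples_ideal]
  by (simp add: ring_completion_def thread_of_def FactRing_def)

lemma thread_one: "\<one>\<^bsub>ring_completion p R\<^esub> = thread_of p R (\<lambda>_. \<one>)"
  by (simp add: ring_completion_def to_completion_conv)

lemma completion_cring: "cring (ring_completion p R)"
proof (rule cringI)
  let ?C = "ring_completion p R"
  have *: "\<exists>x. coherent p R x \<and> (\<forall>n. x n \<in> carrier R) \<and> s = thread_of p R x" if "s \<in> carrier ?C" for s
    using that by (metis C.carrier_E)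
  show "abelian_group ?C"
    by (rule C.completion_abelian_group)
  show "comm_monoid ?C"
  proof (rule comm_monoidI)
    show "\<one>\<^bsub>?C\<^esub> \<in> carrier ?C"
      by (simp add: thread_one C.thr_closed coherent_const)
    fix s t assume "s \<in> carrier ?C" "t \<in> carrier ?C"
    then obtain x y where xy: "coherent p R x" "\<And>n. x n \<in> carrier R" "s = thread_of p R x"
      "coherent p R y" "\<And>n. y n \<in> carrier R" "t = thread_of p R y"
      using * by metis
    show "s \<otimes>\<^bsub>?C\<^esub> t \<in> carrier ?C"
      using xy by (simp add: thread_mult C.thr_closed coherent_mult)
    show "s \<otimes>\<^bsub>?C\<^esub> t = t \<otimes>\<^bsub>?C\<^esub> s"
      using xy by (simp add: thread_mult m_comm)
    show "\<one>\<^bsub>?C\<^esub> \<otimes>\<^bsub>?C\<^esub> s = s"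
      using xy by (simp add: thread_mult thread_one)
    fix u assume "u \<in> carrier ?C"
    then obtain z where z: "coherent p R z" "\<And>n. z n \<in> carrier R" "u = thread_of p R z"
      using * by metis
    show "s \<otimes>\<^bsub>?C\<^esub> t \<otimes>\<^bsub>?C\<^esub> u = s \<otimes>\<^bsub>?C\<^esub> (t \<otimes>\<^bsub>?C\<^esub> u)"
      using xy z by (simp add: thread_mult m_assoc)
  qed
  fix s t u assume "s \<in> carrier ?C" "t \<in> carrier ?C" "u \<in> carrier ?C"
  then obtain x y z where xyz: "\<And>n. x n \<in> carrier R" "s = thread_of p R x"
      "\<And>n. y n \<in> carrier R" "t = thread_of p R y" "\<And>n. z n \<in> carrier R" "u = thread_of p R z"
    using * by metis
  show "(s \<oplus>\<^bsub>?C\<^esub> t) \<otimes>\<^bsub>?C\<^esub> u = s \<otimes>\<^bsub>?C\<^esub> u \<oplus>\<^bsub>?C\<^esub> t \<otimes>\<^bsub>?C\<^esub> u"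
    using xyz by (simp add: thread_mult C.thr_add l_distr)
qed

lemma completion_padic_ring: "padic_ring (ring_completion p R) p"
  using completion_cring C.completion_padic_group by (rule padic_ring.intro)

lemma emb_ring_hom: "to_completion p R \<in> ring_hom R (ring_completion p R)"
proof (rule ring_hom_memI)
  show "to_completion p R x \<in> carrier (ring_completion p R)" if "x \<in> carrier R" for x
    using that by (rule C.emb_closed)
  show "to_completion p R (x \<otimes> y) =
      to_completion p R x \<otimes>\<^bsub>ring_completion p R\<^esub> to_completion p R y"
    if "x \<in> carrier R" "y \<in> carrier R" for x y
    using that by (simp add: to_completion_conv thread_mult)
  show "to_completion p R (x \<oplus> y) =
      to_completion p R x \<oplus>\<^bsub>ring_completion p R\<^esub> to_completion p R y"
    if "x \<in> carrier R" "y \<in> carrier R" for x y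
    using that by (rule C.emb_add)
  show "to_completion p R \<one> = \<one>\<^bsub>ring_completion p R\<^esub>"
    by (simp add: thread_one to_completion_conv)
qed

text \<open>Injectivity of the map to the completion gives separatedness, and surjectivity gives
  limits.\<close>

lemma padic_ring_of_complete:
  assumes "padically_complete p R"
  shows "padic_ring R p"
proof -
  have bij: "bij_betw (to_completion p R) (carrier R) (threads p R)"
    using assms by (simp add: padically_complete_def C.carrier_C)
  have "padic_group R p"
  proof
    fix x assume x: "x \<in> carrier R"
    show "x = \<zero>" if "[p] \<cdot> x = \<zero>"
      using x that by (rule ring_torsion_free)
    show "x = \<zero>" if "\<And>n. x \<in> multiples R (p ^ n)"
    proof -
      have "to_completion p R x = to_completion p R \<zero>"
        using x that by (simp add: to_completion_conv thread_of_eq_iff congruent_zero_iff)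
      then show ?thesis
        using bij x by (auto simp: bij_betw_def inj_on_def)
    qed
  next
    fix f assume f: "coherent p R f"
    then have "thread_of p R f \<in> to_completion p R ` carrier R"
      using bij thread_of_mem by (simp add: bij_betw_def)
    then obtain s where "s \<in> carrier R" "thread_of p R f = thread_of p R (\<lambda>_. s)"
      by (auto simp: to_completion_conv)
    then show "\<exists>s\<in>carrier R. \<forall>n. congruent_mod (p ^ n) R s (f n)"
      using coherent_carrier [OF f] thread_of_eq_iff [of "\<lambda>_. s" f p] by auto
  qed
  then show ?thesis
    by (rule padic_ring.intro [OF cring_axioms])
qed

end

section \<open>Extension of homomorphisms\<close>

lemma abelian_group_homI':
  assumes "abelian_group R" "abelian_group S"
    and "\<And>x. x \<in> carrier R \<Longrightarrow> h x \<in> carrier S"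
    and "\<And>x y. \<lbrakk>x \<in> carrier R; y \<in> carrier R\<rbrakk> \<Longrightarrow> h (x \<oplus>\<^bsub>R\<^esub> y) = h x \<oplus>\<^bsub>S\<^esub> h y"
  shows "abelian_group_hom R S h"
proof (rule abelian_group_homI [OF assms(1,2)])
  interpret R: abelian_group R by fact
  interpret S: abelian_group S by fact
  show "group_hom (add_monoid R) (add_monoid S) h"
    by (intro group_hom.intro group_hom_axioms.intro R.a_group S.a_group) (auto simp: hom_def assms)
qed

lemma ring_hom_abelian_group_hom:
  "\<lbrakk>h \<in> ring_hom R S; ring R; ring S\<rbrakk> \<Longrightarrow> abelian_group_hom R S h"
  by (rule abelian_group_homI') (auto simp: ring_hom_closed ring_hom_add ring.is_abelian_group)

context abelian_group_hom
begin

lemma hom_nat_pow: "x \<in> carrier G \<Longrightarrow> h ([(k::nat)] \<cdot> x) = [k] \<cdot>\<^bsub>H\<^esub> h x"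
  by (induction k) simp_all

lemma hom_diff: "\<lbrakk>x \<in> carrier G; y \<in> carrier G\<rbrakk> \<Longrightarrow> h (x \<ominus> y) = h x \<ominus>\<^bsub>H\<^esub> h y"
  by (simp add: a_minus_def)

lemma hom_multiples: "x \<in> multiples G k \<Longrightarrow> h x \<in> multiples H k"
  by (elim G.multiplesE) (simp add: hom_nat_pow H.multiplesI)

lemma hom_congruent:
  "\<lbrakk>congruent_mod k G x y; x \<in> carrier G; y \<in> carrier G\<rbrakk> \<Longrightarrow> congruent_mod k H (h x) (h y)"
  using hom_multiples [of "x \<ominus> y"] by (simp add: G.congruent_mod_iff H.congruent_mod_iff hom_diff)

end

locale dense_hom = \<iota>: abelian_group_hom R S \<iota> + S: padic_group S p
  for R (structure) and S (structure) and \<iota> and p +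
  assumes dense: "s \<in> carrier S \<Longrightarrow> \<exists>r \<in> carrier R. congruent_mod (p ^ n) S s (\<iota> r)"
begin

text \<open>Extension by continuity. Approximations of s in the dense image are mapped by g to a
  coherent sequence, whose limit is the value at s. The map \<open>\<iota>\<close> need not be
  injective: \<open>compat\<close> for all n forces g to vanish on its kernel.\<close>

lemma extend_hom:
  assumes "abelian_group_hom R T g" and T: "padic_group T p"
    and compat: "\<And>r n. \<lbrakk>r \<in> carrier R; \<iota> r \<in> multiples S (p ^ n)\<rbrakk> \<Longrightarrow> g r \<in> multiples T (p ^ n)"
  obtains G where "abelian_group_hom S T G" "\<And>r. r \<in> carrier R \<Longrightarrow> G (\<iota> r) = g r"
proof -
  interpret T: padic_group T p by fact
  interpret g: abelian_group_hom R T g by fact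
  have compat': "congruent_mod (p ^ n) T (g r) (g r')"
    if "r \<in> carrier R" "r' \<in> carrier R" "congruent_mod (p ^ n) S (\<iota> r) (\<iota> r')" for r r' n
    using compat [of "r \<ominus> r'" n] that
    by (simp add: \<iota>.H.congruent_mod_iff T.congruent_mod_iff g.hom_diff \<iota>.hom_diff)
  define a where "a s n = (SOME r. r \<in> carrier R \<and> congruent_mod (p ^ n) S s (\<iota> r))" for s n
  have a: "a s n \<in> carrier R" "congruent_mod (p ^ n) S s (\<iota> (a s n))" if "s \<in> carrier S" for s n
    using someI_ex [OF dense [OF that, unfolded Bex_def], of n] by (simp_all add: a_def)
  have "coherent p T (\<lambda>n. g (a s n))" if s: "s \<in> carrier S" for s
  proof -
    have "congruent_mod (p ^ n) S (\<iota> (a s (Suc n))) s" for n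
      by (rule \<iota>.H.congruent_sym [OF \<iota>.H.congruent_mono [OF a(2) [OF s, of "Suc n"]]])
        (use a [OF s] s in simp_all)
    then have "congruent_mod (p ^ n) S (\<iota> (a s (Suc n))) (\<iota> (a s n))" for n
      using a [OF s] s \<iota>.H.congruent_trans [of _ _ s] by simp
    then show ?thesis
      using a [OF s] by (simp add: coherent_def compat')
  qed
  then have "\<forall>s\<in>carrier S. \<exists>t. t \<in> carrier T \<and> (\<forall>n. congruent_mod (p ^ n) T t (g (a s n)))"
    using T.complete by blast
  then obtain G where G: "\<And>s. s \<in> carrier S \<Longrightarrow> G s \<in> carrier T"
      "\<And>s n. s \<in> carrier S \<Longrightarrow> congruent_mod (p ^ n) T (G s) (g (a s n))"
    using bchoice [of "carrier S"] by metis
  \<comment> \<open>The value at s is controlled modulo p^n by every approximation of s, not only by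
    the chosen one. Additivity and the extension property both follow from this freedom.\<close>
  have key: "congruent_mod (p ^ n) T (G s) (g r)"
    if "s \<in> carrier S" "r \<in> carrier R" "congruent_mod (p ^ n) S s (\<iota> r)" for s r n
  proof -
    have "congruent_mod (p ^ n) S (\<iota> (a s n)) (\<iota> r)"
      using that a [OF that(1), of n] \<iota>.H.congruent_trans [OF \<iota>.H.congruent_sym that(3)] by simp
    then have "congruent_mod (p ^ n) T (g (a s n)) (g r)"
      using a that by (intro compat') simp_all
    then show ?thesis
      using G(2) [OF that(1), of n] G(1) that a by (simp add: T.congruent_trans [of _ _ "g (a s n)"])
  qed
  have "G (s \<oplus>\<^bsub>S\<^esub> t) = G s \<oplus>\<^bsub>T\<^esub> G t" if "s \<in> carrier S" "t \<in> carrier S" for s t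
  proof (rule T.eqI)
    fix n
    have "congruent_mod (p ^ n) S (s \<oplus>\<^bsub>S\<^esub> t) (\<iota> (a s n \<oplus> a t n))"
      using that a by (simp add: \<iota>.H.congruent_add)
    then have "congruent_mod (p ^ n) T (G (s \<oplus>\<^bsub>S\<^esub> t)) (g (a s n \<oplus> a t n))"
      using that a by (intro key) simp_all
    moreover have "congruent_mod (p ^ n) T (g (a s n) \<oplus>\<^bsub>T\<^esub> g (a t n)) (G s \<oplus>\<^bsub>T\<^esub> G t)"
      using that a G by (intro T.congruent_add T.congruent_sym [OF G(2)]) simp_all
    ultimately show "congruent_mod (p ^ n) T (G (s \<oplus>\<^bsub>S\<^esub> t)) (G s \<oplus>\<^bsub>T\<^esub> G t)"
      using that a G(1) by (simp add: T.congruent_trans [of _ _ "g (a s n) \<oplus>\<^bsub>T\<^esub> g (a t n)"])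
  qed (use that G in auto)
  then have "abelian_group_hom S T G"
    using G(1) by (intro abelian_group_homI') (auto simp: \<iota>.H.abelian_group_axioms T.abelian_group_axioms)
  moreover have "G (\<iota> r) = g r" if "r \<in> carrier R" for r
    using that key [of "\<iota> r" r] by (intro T.eqI) (simp_all add: G \<iota>.H.congruent_refl)
  ultimately show thesis using that by blast
qed

end

locale dense_ring_hom = R: cring R + S: padic_ring S p
  for R (structure) and S (structure) and \<iota> and p +
  assumes \<iota>: "\<iota> \<in> ring_hom R S"
    and dense: "s \<in> carrier S \<Longrightarrow> \<exists>r \<in> carrier R. congruent_mod (p ^ n) S s (\<iota> r)"

sublocale dense_ring_hom \<subseteq> dense_hom R S \<iota> p
  using dense
  by (intro dense_hom.intro dense_hom_axioms.intro ring_hom_abelian_group_hom [OF \<iota>]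
      R.ring_axioms S.ring_axioms S.padic_group_axioms)

context dense_ring_hom
begin

text \<open>Both sides of the multiplication rule respect congruences modulo p^n, so the dense image
  suffices.\<close>

lemma extension_ring_hom:
  assumes T: "padic_ring T p" and G: "abelian_group_hom S T G"
    and mult: "\<And>r r'. \<lbrakk>r \<in> carrier R; r' \<in> carrier R\<rbrakk> \<Longrightarrow> G (\<iota> (r \<otimes> r')) = G (\<iota> r) \<otimes>\<^bsub>T\<^esub> G (\<iota> r')"
    and one: "G (\<iota> \<one>) = \<one>\<^bsub>T\<^esub>"
  shows "G \<in> ring_hom S T"
proof (rule ring_hom_memI)
  interpret T: padic_ring T p by fact
  interpret G: abelian_group_hom S T G by fact
  show "G (s \<otimes>\<^bsub>S\<^esub> t) = G s \<otimes>\<^bsub>T\<^esub> G t" if s: "s \<in> carrier S" and t: "t \<in> carrier S" for s t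
  proof (rule T.eqI)
    fix n
    obtain r r' where r: "r \<in> carrier R" "congruent_mod (p ^ n) S s (\<iota> r)"
      and r': "r' \<in> carrier R" "congruent_mod (p ^ n) S t (\<iota> r')"
      using dense s t by metis
    have "congruent_mod (p ^ n) S (s \<otimes>\<^bsub>S\<^esub> t) (\<iota> (r \<otimes> r'))"
      using r r' s t by (simp add: S.congruent_mult ring_hom_mult [OF \<iota>])
    then have "congruent_mod (p ^ n) T (G (s \<otimes>\<^bsub>S\<^esub> t)) (G (\<iota> r) \<otimes>\<^bsub>T\<^esub> G (\<iota> r'))"
      using r r' s t G.hom_congruent by (simp add: mult [symmetric])
    moreover have "congruent_mod (p ^ n) T (G (\<iota> r) \<otimes>\<^bsub>T\<^esub> G (\<iota> r')) (G s \<otimes>\<^bsub>T\<^esub> G t)"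
      using r r' s t by (intro T.congruent_mult T.congruent_sym [OF G.hom_congruent]) simp_all
    ultimately show "congruent_mod (p ^ n) T (G (s \<otimes>\<^bsub>S\<^esub> t)) (G s \<otimes>\<^bsub>T\<^esub> G t)"
      using r r' s t by (simp add: T.congruent_trans [of _ _ "G (\<iota> r) \<otimes>\<^bsub>T\<^esub> G (\<iota> r')"])
  qed (use s t in auto)
  show "G \<one>\<^bsub>S\<^esub> = \<one>\<^bsub>T\<^esub>"
    using one ring_hom_one [OF \<iota>] by simp
qed (use G in \<open>auto simp: abelian_group_hom.hom_closed abelian_group_hom.hom_add\<close>)

lemma extend_ring_hom:
  assumes T: "padic_ring T p" and g: "g \<in> ring_hom R T"
    and compat: "\<And>r n. \<lbrakk>r \<in> carrier R; \<iota> r \<in> multiples S (p ^ n)\<rbrakk> \<Longrightarrow> g r \<in> multiples T (p ^ n)"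
  obtains G where "G \<in> ring_hom S T" "\<And>r. r \<in> carrier R \<Longrightarrow> G (\<iota> r) = g r"
proof -
  interpret T: padic_ring T p by fact
  obtain G where G: "abelian_group_hom S T G" "\<And>r. r \<in> carrier R \<Longrightarrow> G (\<iota> r) = g r"
    by (rule extend_hom [OF ring_hom_abelian_group_hom [OF g R.ring_axioms T.ring_axioms]
        T.padic_group_axioms compat]) auto
  moreover have "G \<in> ring_hom S T"
    by (rule extension_ring_hom [OF T G(1)]) (simp_all add: G(2) ring_hom_mult [OF g] ring_hom_one [OF g])
  ultimately show thesis using that by blast
qed

text \<open>The same density argument for the Leibniz rule; it carries a vector field from O(X) to
  the completed functions on a level set.\<close>

lemma extension_derivation:
  assumes G: "abelian_group_hom S S G"
    and leibniz: "\<And>r r'. \<lbrakk>r \<in> carrier R; r' \<in> carrier R\<rbrakk> \<Longrightarrow>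
      G (\<iota> (r \<otimes> r')) = \<iota> r \<otimes>\<^bsub>S\<^esub> G (\<iota> r') \<oplus>\<^bsub>S\<^esub> \<iota> r' \<otimes>\<^bsub>S\<^esub> G (\<iota> r)"
    and s: "s \<in> carrier S" and t: "t \<in> carrier S"
  shows "G (s \<otimes>\<^bsub>S\<^esub> t) = s \<otimes>\<^bsub>S\<^esub> G t \<oplus>\<^bsub>S\<^esub> t \<otimes>\<^bsub>S\<^esub> G s"
proof (rule S.eqI)
  interpret G: abelian_group_hom S S G by fact
  fix n
  obtain r r' where r: "r \<in> carrier R" "congruent_mod (p ^ n) S s (\<iota> r)"
    and r': "r' \<in> carrier R" "congruent_mod (p ^ n) S t (\<iota> r')"
    using dense s t by metis
  have "congruent_mod (p ^ n) S (s \<otimes>\<^bsub>S\<^esub> t) (\<iota> (r \<otimes> r'))"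
    using r r' s t by (simp add: S.congruent_mult ring_hom_mult [OF \<iota>])
  then have "congruent_mod (p ^ n) S (G (s \<otimes>\<^bsub>S\<^esub> t))
      (\<iota> r \<otimes>\<^bsub>S\<^esub> G (\<iota> r') \<oplus>\<^bsub>S\<^esub> \<iota> r' \<otimes>\<^bsub>S\<^esub> G (\<iota> r))"
    using r r' s t G.hom_congruent by (simp add: leibniz [symmetric])
  moreover have "congruent_mod (p ^ n) S (\<iota> r \<otimes>\<^bsub>S\<^esub> G (\<iota> r') \<oplus>\<^bsub>S\<^esub> \<iota> r' \<otimes>\<^bsub>S\<^esub> G (\<iota> r))
      (s \<otimes>\<^bsub>S\<^esub> G t \<oplus>\<^bsub>S\<^esub> t \<otimes>\<^bsub>S\<^esub> G s)"
    using r r' s t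
    by (intro S.congruent_add S.congruent_mult S.congruent_sym [OF G.hom_congruent]
        S.congruent_sym [OF r(2)] S.congruent_sym [OF r'(2)]) simp_all
  ultimately show "congruent_mod (p ^ n) S (G (s \<otimes>\<^bsub>S\<^esub> t)) (s \<otimes>\<^bsub>S\<^esub> G t \<oplus>\<^bsub>S\<^esub> t \<otimes>\<^bsub>S\<^esub> G s)"
    using r r' s t
    by (simp add: S.congruent_trans [of _ _ "\<iota> r \<otimes>\<^bsub>S\<^esub> G (\<iota> r') \<oplus>\<^bsub>S\<^esub> \<iota> r' \<otimes>\<^bsub>S\<^esub> G (\<iota> r)"])
qed (use G s t in \<open>auto simp: abelian_group_hom.hom_closed\<close>)

end

lemma (in torsion_free_ring) emb_dense_ring_hom:
  "dense_ring_hom R (ring_completion p R) (to_completion p R) p"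
proof (intro dense_ring_hom.intro dense_ring_hom_axioms.intro)
  show "\<exists>r\<in>carrier R. congruent_mod (p ^ n) (ring_completion p R) s (to_completion p R r)"
    if "s \<in> carrier (ring_completion p R)" for s n
    using that by (metis C.emb_dense)
qed (fact cring_axioms completion_padic_ring emb_ring_hom)+


section \<open>Rings of a type, polynomials and localizations\<close>

lemma type_ring_simps [simp]:
  "carrier (type_ring S) = S" "mult (type_ring S) = (*)" "one (type_ring S) = 1"
  "zero (type_ring S) = 0" "add (type_ring S) = (+)"
  by (simp_all add: type_ring_def)

lemma type_ring_nat_pow [simp]: "x [^]\<^bsub>type_ring S\<^esub> (n::nat) = x ^ n"
  by (induction n) (simp_all add: mult.commute)

lemma type_ring_add_pow [simp]: "[(n::nat)] \<cdot>\<^bsub>type_ring S\<^esub> x = of_nat n * x"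
  by (induction n) (simp_all add: add_pow_def nat_pow_def algebra_simps)

lemma cring_type_ring:
  fixes S :: "'b::comm_ring_1 set"
  assumes "0 \<in> S" "1 \<in> S" "\<And>x. x \<in> S \<Longrightarrow> - x \<in> S"
    and "\<And>x y. \<lbrakk>x \<in> S; y \<in> S\<rbrakk> \<Longrightarrow> x + y \<in> S" "\<And>x y. \<lbrakk>x \<in> S; y \<in> S\<rbrakk> \<Longrightarrow> x * y \<in> S"
  shows "cring (type_ring S)"
proof (rule cringI)
  show "abelian_group (type_ring S)"
    using assms by (intro abelian_groupI) (auto simp: ac_simps intro!: bexI [of _ "- x" for x])
  show "comm_monoid (type_ring S)"
    using assms by (intro comm_monoidI) (auto simp: ac_simps)
qed (simp add: algebra_simps)

lemma type_ring_minus: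
  assumes "cring (type_ring S)" "x \<in> S" "- x \<in> S"
  shows "\<ominus>\<^bsub>type_ring S\<^esub> x = - x"
proof -
  interpret cring "type_ring S" by fact
  show ?thesis using minus_equality [of "- x" x] assms(2,3) by simp
qed

lemma type_ring_multiples: "multiples (type_ring S) k = (\<lambda>z. of_nat k * z) ` S"
  by (simp add: multiples_def)

lemma type_ring_congruent:
  "congruent_mod k (type_ring S) x y \<longleftrightarrow> (\<exists>z\<in>S. x = y + of_nat k * z)"
  by (auto simp: congruent_mod_def type_ring_multiples)

lemma cring_type_ring_UNIV: "cring (type_ring (UNIV :: 'b::comm_ring_1 set))"
  by (rule cring_type_ring) auto

text \<open>The universal property of a polynomial ring, for a target given as a record: Horner's
  rule, written with \<open>fold_coeffs\<close>, defines the map.\<close>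

lemma extend_hom_poly:
  fixes S (structure) and \<kappa> :: "'b::comm_ring_1 \<Rightarrow> 's"
  assumes "cring S" and \<kappa>: "\<kappa> \<in> ring_hom (type_ring UNIV) S" and u: "u \<in> carrier S"
  obtains \<psi> where "\<psi> \<in> ring_hom (type_ring UNIV) S" "\<And>c. \<psi> [:c:] = \<kappa> c" "\<psi> [:0, 1:] = u"
proof -
  interpret S: cring S by fact
  define \<psi> where "\<psi> f = fold_coeffs (\<lambda>c s. \<kappa> c \<oplus> u \<otimes> s) f \<zero>" for f
  have \<kappa>_closed [simp]: "\<kappa> c \<in> carrier S" for c
    using ring_hom_closed [OF \<kappa>] by simp
  have \<kappa>_add: "\<kappa> (c + d) = \<kappa> c \<oplus> \<kappa> d" and \<kappa>_mult: "\<kappa> (c * d) = \<kappa> c \<otimes> \<kappa> d" for c d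
    using ring_hom_add [OF \<kappa>] ring_hom_mult [OF \<kappa>] by simp_all
  have \<kappa>_0: "\<kappa> 0 = \<zero>"
    using ring_hom_zero [OF \<kappa> cring.axioms(1) [OF cring_type_ring_UNIV] S.ring_axioms] by simp
  have \<kappa>_1: "\<kappa> 1 = \<one>"
    using ring_hom_one [OF \<kappa>] by simp
  have \<psi>_0: "\<psi> 0 = \<zero>" by (simp add: \<psi>_def)
  \<comment> \<open>\<open>fold_coeffs\<close> treats \<open>pCons 0 0\<close> as having no
    coefficients at all, so that case is separate and needs \<kappa> 0 = 0.\<close>
  have \<psi>_pCons: "\<psi> (pCons c f) = \<kappa> c \<oplus> u \<otimes> \<psi> f" for c f
    by (cases "f = 0"; cases "c = 0") (simp_all add: \<psi>_def \<kappa>_0 u)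
  have closed [simp]: "\<psi> f \<in> carrier S" for f
    by (induction f) (simp_all add: \<psi>_0 \<psi>_pCons u)
  have add: "\<psi> (f + g) = \<psi> f \<oplus> \<psi> g" for f g
  proof (induction f g rule: poly_induct2)
    case 0
    then show ?case by (simp add: \<psi>_0)
  next
    case (pCons c f d g)
    have "\<psi> (pCons c f + pCons d g) = (\<kappa> c \<oplus> \<kappa> d) \<oplus> u \<otimes> (\<psi> f \<oplus> \<psi> g)"
      by (simp add: \<psi>_pCons pCons \<kappa>_add)
    also have "\<dots> = (\<kappa> c \<oplus> u \<otimes> \<psi> f) \<oplus> (\<kappa> d \<oplus> u \<otimes> \<psi> g)"
      using u \<kappa>_closed [of c] \<kappa>_closed [of d] closed [of f] closed [of g] by algebra
    finally show ?case by (simp add: \<psi>_pCons)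
  qed
  have smult: "\<psi> (Polynomial.smult c f) = \<kappa> c \<otimes> \<psi> f" for c f
  proof (induction f)
    case 0
    then show ?case by (simp add: \<psi>_0)
  next
    case (pCons d f)
    have "\<psi> (Polynomial.smult c (pCons d f)) = \<kappa> c \<otimes> \<kappa> d \<oplus> u \<otimes> (\<kappa> c \<otimes> \<psi> f)"
      by (simp add: \<psi>_pCons pCons \<kappa>_mult)
    also have "\<dots> = \<kappa> c \<otimes> (\<kappa> d \<oplus> u \<otimes> \<psi> f)"
      using u \<kappa>_closed [of c] \<kappa>_closed [of d] closed [of f] by algebra
    finally show ?case by (simp add: \<psi>_pCons)
  qed
  have mult: "\<psi> (f * g) = \<psi> f \<otimes> \<psi> g" for f g
  proof (induction f)
    case 0
    then show ?case by (simp add: \<psi>_0)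
  next
    case (pCons c f)
    have "\<psi> (pCons c f * g) = \<kappa> c \<otimes> \<psi> g \<oplus> u \<otimes> (\<psi> f \<otimes> \<psi> g)"
      using u by (simp add: add smult \<psi>_pCons pCons \<kappa>_0)
    also have "\<dots> = (\<kappa> c \<oplus> u \<otimes> \<psi> f) \<otimes> \<psi> g"
      using u \<kappa>_closed [of c] closed [of f] closed [of g] by algebra
    finally show ?case by (simp add: \<psi>_pCons)
  qed
  show thesis
  proof
    show "\<psi> \<in> ring_hom (type_ring UNIV) S"
      by (rule ring_hom_memI) (simp_all add: add mult one_pCons \<psi>_pCons \<psi>_0 \<kappa>_1 u)
    show "\<psi> [:c:] = \<kappa> c" for c by (simp add: \<psi>_pCons \<psi>_0 u)
    show "\<psi> [:0, 1:] = u" by (simp add: \<psi>_pCons \<psi>_0 \<kappa>_0 \<kappa>_1 u)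
  qed
qed

lemma hom_poly_eqI:
  fixes S (structure) and \<psi> \<psi>' :: "'b::comm_ring_1 poly \<Rightarrow> 's"
  assumes "cring S" and \<psi>: "\<psi> \<in> ring_hom (type_ring UNIV) S" "\<psi>' \<in> ring_hom (type_ring UNIV) S"
    and eq: "\<And>c. \<psi> [:c:] = \<psi>' [:c:]" "\<psi> [:0, 1:] = \<psi>' [:0, 1:]"
  shows "\<psi> f = \<psi>' f"
proof (induction f)
  case 0
  show ?case using eq(1) [of 0] by simp
next
  case (pCons c f)
  have *: "pCons c f = [:c:] + [:0, 1:] * f" by simp
  show ?case
    unfolding * using ring_hom_add [OF \<psi>(1)] ring_hom_mult [OF \<psi>(1)]
      ring_hom_add [OF \<psi>(2)] ring_hom_mult [OF \<psi>(2)] eq pCons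
    by (simp del: mult_pCons_left mult_pCons_right add_pCons)
qed

lemma const_poly_hom: "(\<lambda>c. [:c:]) \<in> ring_hom (type_ring UNIV) (type_ring UNIV)"
  by (rule ring_hom_memI) (simp_all add: one_pCons)

lemma carrier_localization_at: "carrier (localization_at f) = {Fract g (f ^ n) | g n. True}"
  by (simp add: localization_at_def)

lemma localization_at_closed:
  fixes f :: "'b::idom"
  assumes f: "f \<noteq> 0"
  defines "B \<equiv> {Fract g (f ^ n) | g n. True}"
  shows "Fract g 1 \<in> B" and "0 \<in> B" "1 \<in> B" "\<And>x. x \<in> B \<Longrightarrow> - x \<in> B"
    and "\<And>x y. \<lbrakk>x \<in> B; y \<in> B\<rbrakk> \<Longrightarrow> x + y \<in> B" "\<And>x y. \<lbrakk>x \<in> B; y \<in> B\<rbrakk> \<Longrightarrow> x * y \<in> B"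
proof -
  show 1: "Fract g 1 \<in> B" for g
    unfolding B_def mem_Collect_eq by (rule exI [of _ g], rule exI [of _ 0]) simp
  show "0 \<in> B" "1 \<in> B"
    using 1 [of 0] 1 [of 1] by (simp_all add: Zero_fract_def One_fract_def)
  show "- x \<in> B" if "x \<in> B" for x
  proof -
    from that obtain g n where "x = Fract g (f ^ n)" by (auto simp: B_def)
    then have "- x = Fract (- g) (f ^ n)" by simp
    then show ?thesis unfolding B_def by blast
  qed
  have mem: "Fract g (f ^ n) \<in> B" for g n
    unfolding B_def by blast
  show "x + y \<in> B" "x * y \<in> B" if "x \<in> B" "y \<in> B" for x y
  proof -
    from that obtain g n h m where "x = Fract g (f ^ n)" "y = Fract h (f ^ m)"
      by (auto simp: B_def)
    then show "x + y \<in> B" "x * y \<in> B"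
      using mem [of "g * f ^ m + h * f ^ n" "n + m"] mem [of "g * h" "n + m"] f
      by (simp_all add: power_add)
  qed
qed

lemma cring_localization_at:
  assumes "f \<noteq> 0"
  shows "cring (localization_at f)"
  unfolding localization_at_def by (rule cring_type_ring) (rule localization_at_closed [OF assms]; assumption)+

text \<open>The universal property of B[1/f]. All denominators are powers of f, so invertibility of
  the single element \<psi> f suffices to define all values.\<close>

lemma extend_hom_localization:
  fixes f :: "'b::idom" and S (structure)
  assumes "cring S" and \<psi>: "\<psi> \<in> ring_hom (type_ring UNIV) S" and f: "f \<noteq> 0" "\<psi> f \<in> Units S"
  obtains \<Psi> where "\<Psi> \<in> ring_hom (localization_at f) S" "\<And>g. \<Psi> (Fract g 1) = \<psi> g"
proof -
  interpret S: cring S by fact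
  have closed [simp]: "\<psi> g \<in> carrier S" for g
    using ring_hom_closed [OF \<psi>] by simp
  have add: "\<psi> (c + d) = \<psi> c \<oplus> \<psi> d" and mult: "\<psi> (c * d) = \<psi> c \<otimes> \<psi> d" for c d
    using ring_hom_add [OF \<psi>] ring_hom_mult [OF \<psi>] by simp_all
  have one: "\<psi> 1 = \<one>" using ring_hom_one [OF \<psi>] by simp
  have pow: "\<psi> (f ^ n) \<in> Units S" for n
    by (induction n) (simp_all add: mult one f)
  define \<Psi> where "\<Psi> x = (SOME y. \<exists>g n. x = Fract g (f ^ n) \<and> y = \<psi> g \<otimes> inv (\<psi> (f ^ n)))" for x
  have cancel: "y = z" if "y \<otimes> \<psi> (f ^ n) = z \<otimes> \<psi> (f ^ n)" "y \<in> carrier S" "z \<in> carrier S" for y z n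
    using that pow S.Units_closed S.m_comm S.Units_l_cancel by metis
  have eq: "\<Psi> (Fract g (f ^ n)) = \<psi> g \<otimes> inv (\<psi> (f ^ n))" for g n
  proof -
    have "\<exists>y. \<exists>h m. Fract g (f ^ n) = Fract h (f ^ m) \<and> y = \<psi> h \<otimes> inv (\<psi> (f ^ m))"
      by blast
    then have "\<exists>h m. Fract g (f ^ n) = Fract h (f ^ m) \<and> \<Psi> (Fract g (f ^ n)) = \<psi> h \<otimes> inv (\<psi> (f ^ m))"
      unfolding \<Psi>_def by (rule someI_ex)
    then obtain h m where hm: "Fract g (f ^ n) = Fract h (f ^ m)"
      "\<Psi> (Fract g (f ^ n)) = \<psi> h \<otimes> inv (\<psi> (f ^ m))" by blast
    then have "g * f ^ m = h * f ^ n" using f by (simp add: eq_fract)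
    then have *: "\<psi> g \<otimes> \<psi> (f ^ m) = \<psi> h \<otimes> \<psi> (f ^ n)" by (simp add: mult [symmetric])
    have "(\<psi> g \<otimes> inv (\<psi> (f ^ n))) \<otimes> \<psi> (f ^ (m + n)) =
        (\<psi> g \<otimes> \<psi> (f ^ m)) \<otimes> (inv (\<psi> (f ^ n)) \<otimes> \<psi> (f ^ n))"
      using pow by (simp add: power_add mult S.m_ac)
    also have "\<dots> = (\<psi> h \<otimes> \<psi> (f ^ n)) \<otimes> (inv (\<psi> (f ^ m)) \<otimes> \<psi> (f ^ m))"
      unfolding * using pow by simp
    also have "\<dots> = (\<psi> h \<otimes> \<psi> (f ^ n)) \<otimes> (\<psi> (f ^ m) \<otimes> inv (\<psi> (f ^ m)))"
      using pow by simp
    also have "\<dots> = (\<psi> h \<otimes> inv (\<psi> (f ^ m))) \<otimes> \<psi> (f ^ (m + n))"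
      unfolding power_add mult using pow by (simp add: S.m_ac del: S.Units_r_inv)
    finally show ?thesis
      unfolding hm(2) by (rule cancel [symmetric]) (simp_all add: pow)
  qed
  \<comment> \<open>Multiplying by the unit \<psi> (f^n) characterizes the value, so the
    homomorphism laws can be checked with denominators cleared.\<close>
  have val: "\<Psi> (Fract g (f ^ n)) \<otimes> \<psi> (f ^ n) = \<psi> g" for g n
    using pow by (simp add: eq S.m_assoc)
  have \<Psi>_closed: "\<Psi> (Fract g (f ^ n)) \<in> carrier S" for g n
    using pow by (simp add: eq)
  show thesis
  proof
    show "\<Psi> (Fract g 1) = \<psi> g" for g
      using eq [of g 0] by (simp add: one)
    show "\<Psi> \<in> ring_hom (localization_at f) S"
    proof (rule ring_hom_memI)
      show "\<Psi> x \<in> carrier S" if "x \<in> carrier (localization_at f)" for x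
        using that \<Psi>_closed by (auto simp: carrier_localization_at)
      show "\<Psi> \<one>\<^bsub>localization_at f\<^esub> = \<one>"
        using \<open>\<And>g. \<Psi> (Fract g 1) = \<psi> g\<close> [of 1] by (simp add: localization_at_def One_fract_def one)
      fix x y assume "x \<in> carrier (localization_at f)" "y \<in> carrier (localization_at f)"
      then obtain g n h m where x: "x = Fract g (f ^ n)" and y: "y = Fract h (f ^ m)"
        by (auto simp: carrier_localization_at)
      have "x * y = Fract (g * h) (f ^ (n + m))"
        by (simp add: x y power_add)
      then have "\<Psi> (x * y) \<otimes> \<psi> (f ^ (n + m)) = \<psi> (g * h)"
        by (simp only: val)
      also have "\<dots> = (\<Psi> x \<otimes> \<psi> (f ^ n)) \<otimes> (\<Psi> y \<otimes> \<psi> (f ^ m))"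
        by (simp add: x y val mult)
      also have "\<dots> = (\<Psi> x \<otimes> \<Psi> y) \<otimes> \<psi> (f ^ (n + m))"
        by (simp add: power_add mult S.m_ac x y \<Psi>_closed)
      finally show "\<Psi> (x \<otimes>\<^bsub>localization_at f\<^esub> y) = \<Psi> x \<otimes> \<Psi> y"
        unfolding localization_at_def type_ring_simps
        by (rule cancel) (simp_all add: \<Psi>_closed x y power_add [symmetric])
      have "x + y = Fract (g * f ^ m + h * f ^ n) (f ^ (n + m))"
        using f by (simp add: x y power_add)
      then have "\<Psi> (x + y) \<otimes> \<psi> (f ^ (n + m)) = \<psi> (g * f ^ m + h * f ^ n)"
        by (simp only: val)
      also have "\<dots> = (\<Psi> x \<otimes> \<psi> (f ^ n)) \<otimes> \<psi> (f ^ m) \<oplus> (\<Psi> y \<otimes> \<psi> (f ^ m)) \<otimes> \<psi> (f ^ n)"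
        by (simp add: x y val mult add)
      also have "\<dots> = (\<Psi> x \<oplus> \<Psi> y) \<otimes> \<psi> (f ^ (n + m))"
        by (simp add: power_add mult S.m_ac S.l_distr S.r_distr x y \<Psi>_closed)
      finally show "\<Psi> (x \<oplus>\<^bsub>localization_at f\<^esub> y) = \<Psi> x \<oplus> \<Psi> y"
        unfolding localization_at_def type_ring_simps
        by (rule cancel) (use f in \<open>simp_all add: \<Psi>_closed x y power_add [symmetric]\<close>)
    qed
  qed
qed

section \<open>Derivations\<close>

definition derivation :: "('b::comm_ring_1 \<Rightarrow> 'b) \<Rightarrow> bool" where
  "derivation d \<longleftrightarrow> (\<forall>x y. d (x + y) = d x + d y) \<and> (\<forall>x y. d (x * y) = x * d y + y * d x)"

lemma derivationI:
  assumes "\<And>x y. d (x + y) = d x + d y" "\<And>x y. d (x * y) = x * d y + y * d x"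
  shows "derivation d"
  using assms by (simp add: derivation_def)

lemma derivation_add: "derivation d \<Longrightarrow> d (x + y) = d x + d y"
  and derivation_mult: "derivation d \<Longrightarrow> d (x * y) = x * d y + y * d x"
  by (simp_all add: derivation_def)

lemma derivation_0: "derivation d \<Longrightarrow> d 0 = 0"
  using derivation_add [of d 0 0] by simp

lemma derivation_1: "derivation d \<Longrightarrow> d 1 = 0"
  using derivation_mult [of d 1 1] by simp

lemma derivation_minus: "derivation d \<Longrightarrow> d (- x) = - d x"
  using derivation_add [of d x "- x"] by (simp add: derivation_0 add_eq_0_iff)

lemma derivation_diff: "derivation d \<Longrightarrow> d (x - y) = d x - d y"
  using derivation_add [of d x "- y"] by (simp add: derivation_minus)

lemma derivation_power: "derivation d \<Longrightarrow> d (x ^ n) = of_nat n * x ^ (n - 1) * d x"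
proof (induction n)
  case 0
  then show ?case by (simp add: derivation_1)
next
  case (Suc n)
  then show ?case by (cases n) (simp_all add: derivation_mult algebra_simps)
qed

lemma derivation_sum: "derivation d \<Longrightarrow> d (sum f I) = (\<Sum>i\<in>I. d (f i))"
  by (induction I rule: infinite_finite_induct) (simp_all add: derivation_0 derivation_add)

lemma derivation_pderiv: "derivation (pderiv :: 'b::idom poly \<Rightarrow> 'b poly)"
  by (rule derivationI) (simp_all add: pderiv_add pderiv_mult)

lemma derivation_map_poly:
  assumes d: "derivation d"
  shows "derivation (map_poly d)"
proof -
  have d0: "d 0 = 0" using d by (rule derivation_0)
  have add: "map_poly d (f + g) = map_poly d f + map_poly d g" for f g
    by (rule poly_eqI) (simp add: coeff_map_poly d0 derivation_add [OF d])
  have smult: "map_poly d (Polynomial.smult c g) = Polynomial.smult c (map_poly d g) + Polynomial.smult (d c) g" for c g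
    by (rule poly_eqI) (simp add: coeff_map_poly d0 derivation_mult [OF d] mult.commute)
  have "map_poly d (f * g) = f * map_poly d g + g * map_poly d f" for f g
  proof (induction f)
    case 0
    then show ?case by simp
  next
    case (pCons c f)
    then show ?case
      by (simp add: map_poly_pCons d0 add smult algebra_simps)
  qed
  with add show ?thesis by (intro derivationI)
qed

lemma derivation_lincomb:
  assumes "derivation d" "derivation d'"
  shows "derivation (\<lambda>x. u * d x + v * d' x)"
  using assms by (intro derivationI) (simp_all add: derivation_add derivation_mult algebra_simps)

definition fract_derivation :: "('b::idom \<Rightarrow> 'b) \<Rightarrow> 'b fract \<Rightarrow> 'b fract" where
  "fract_derivation d x =
     (SOME y. \<exists>g h. h \<noteq> 0 \<and> x = Fract g h \<and> y = Fract (h * d g - g * d h) (h * h))"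

text \<open>Independence of the representative: applying d to the cross-multiplied equation g h' =
  g' h relates the two quotient-rule expressions.\<close>

lemma fract_derivation_Fract:
  assumes d: "derivation d" and h: "h \<noteq> 0"
  shows "fract_derivation d (Fract g h) = Fract (h * d g - g * d h) (h * h)"
proof -
  have "\<exists>y. \<exists>g' h'. h' \<noteq> 0 \<and> Fract g h = Fract g' h' \<and> y = Fract (h' * d g' - g' * d h') (h' * h')"
    using h by blast
  then have "\<exists>g' h'. h' \<noteq> 0 \<and> Fract g h = Fract g' h' \<and>
      fract_derivation d (Fract g h) = Fract (h' * d g' - g' * d h') (h' * h')"
    unfolding fract_derivation_def by (rule someI_ex)
  then obtain g' h' where h': "h' \<noteq> 0" and "Fract g h = Fract g' h'"
    and y: "fract_derivation d (Fract g h) = Fract (h' * d g' - g' * d h') (h' * h')"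
    by blast
  then have *: "g * h' = g' * h"
    using h by (simp add: eq_fract)
  have **: "g * d h' + h' * d g = g' * d h + h * d g'"
    using arg_cong [OF *, of d] by (simp add: derivation_mult [OF d])
  have "(h' * d g' - g' * d h') * (h * h) = h' * h * (h * d g') - d h' * h * (g' * h)"
    by (simp add: algebra_simps)
  also have "\<dots> = h' * h * (h * d g' - g * d h')"
    unfolding * [symmetric] by (simp add: algebra_simps)
  also have "h * d g' - g * d h' = h' * d g - g' * d h"
    using ** by (simp add: algebra_simps)
  also have "h' * h * (h' * d g - g' * d h) = h' * h' * (h * d g) - d h * h' * (g' * h)"
    by (simp add: algebra_simps)
  also have "\<dots> = (h * d g - g * d h) * (h' * h')"
    unfolding * [symmetric] by (simp add: algebra_simps)
  finally show ?thesis
    using h h' by (simp add: y eq_fract)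
qed

lemma derivation_fract_derivation:
  assumes d: "derivation d"
  shows "derivation (fract_derivation d)"
proof (rule derivationI)
  fix x y :: "'a fract"
  obtain g h where x: "x = Fract g h" "h \<noteq> 0" by (rule Fract_cases)
  obtain g' h' where y: "y = Fract g' h'" "h' \<noteq> 0" by (rule Fract_cases)
  show "fract_derivation d (x + y) = fract_derivation d x + fract_derivation d y"
    using x(2) y(2) unfolding x y
    by (simp add: fract_derivation_Fract [OF d] derivation_add [OF d] derivation_mult [OF d] eq_fract algebra_simps)
  show "fract_derivation d (x * y) = x * fract_derivation d y + y * fract_derivation d x"
    using x(2) y(2) unfolding x y
    by (simp add: fract_derivation_Fract [OF d] derivation_mult [OF d] eq_fract algebra_simps)
qed

lemma fract_derivation_one:
  "derivation d \<Longrightarrow> fract_derivation d (Fract g 1) = Fract (d g) 1"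
  by (simp add: fract_derivation_Fract derivation_1)

lemma fract_derivation_localization:
  assumes d: "derivation d" and f: "f \<noteq> 0" and x: "x \<in> carrier (localization_at f)"
  shows "fract_derivation d x \<in> carrier (localization_at f)"
proof -
  obtain g n where "x = Fract g (f ^ n)" using x by (auto simp: carrier_localization_at)
  then have "fract_derivation d x = Fract (f ^ n * d g - g * d (f ^ n)) (f ^ (n + n))"
    using f by (simp add: fract_derivation_Fract [OF d] power_add)
  then show ?thesis unfolding carrier_localization_at by blast
qed


section \<open>Frobenius congruences\<close>

text \<open>The correction term has to lie in the subring. The case in view is O(X) inside a field
  of fractions in which p is invertible, so that a congruence modulo p in the ambient ring would say
  nothing.\<close>

lemma freshmans_dream_subring:
  fixes x y :: "'b::comm_ring_1"
  assumes "Factorial_Ring.prime p" and B: "cring (type_ring B)" and xy: "x \<in> B" "y \<in> B"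
  shows "\<exists>z\<in>B. (x + y) ^ p = x ^ p + y ^ p + of_nat p * z"
proof -
  interpret B: cring "type_ring B" by fact
  have pow: "u ^ n \<in> B" if "u \<in> B" for u n
    using B.nat_pow_closed [of u n] that by simp
  have nat: "of_nat n * u \<in> B" if "u \<in> B" for u n
    using B.add.nat_pow_closed [of u n] that by simp
  have mult: "u * v \<in> B" if "u \<in> B" "v \<in> B" for u v
    using B.m_closed [of u v] that by simp
  have sum: "(\<And>i. i \<in> I \<Longrightarrow> f i \<in> B) \<Longrightarrow> sum f I \<in> B" for f :: "nat \<Rightarrow> 'b" and I
    using B.a_closed B.zero_closed by (induction I rule: infinite_finite_induct) simp_all
  have p: "p > 0" using assms(1) by (simp add: prime_gt_0_nat)
  define z where "z = (\<Sum>k\<in>{0<..<p}. of_nat ((p choose k) div p) * (x ^ k * y ^ (p - k)))"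
  have "(x + y) ^ p = (\<Sum>k\<le>p. of_nat (p choose k) * x ^ k * y ^ (p - k))"
    by (rule binomial_ring)
  also have "{..p} = insert 0 (insert p {0<..<p})" using p by auto
  also have "(\<Sum>k\<in>insert 0 (insert p {0<..<p}). of_nat (p choose k) * x ^ k * y ^ (p - k)) =
      y ^ p + (x ^ p + (\<Sum>k\<in>{0<..<p}. of_nat (p choose k) * x ^ k * y ^ (p - k)))"
    using p by simp
  also have "(\<Sum>k\<in>{0<..<p}. of_nat (p choose k) * x ^ k * y ^ (p - k)) = of_nat p * z"
    unfolding z_def sum_distrib_left
  proof (rule sum.cong [OF refl])
    fix k assume "k \<in> {0<..<p}"
    then have "p dvd p choose k"
      using assms(1) by (intro dvd_choose_prime) auto
    then have "(of_nat (p choose k) :: 'b) = of_nat p * of_nat ((p choose k) div p)"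
      by (simp flip: of_nat_mult)
    then show "of_nat (p choose k) * x ^ k * y ^ (p - k) =
        of_nat p * (of_nat ((p choose k) div p) * (x ^ k * y ^ (p - k)))"
      by (simp add: mult.assoc)
  qed
  finally have "(x + y) ^ p = x ^ p + y ^ p + of_nat p * z"
    by (simp add: algebra_simps)
  moreover have "z \<in> B"
    unfolding z_def using xy by (intro sum nat mult pow)
  ultimately show ?thesis by blast
qed


section \<open>Evaluation homomorphisms\<close>

abbreviation type_hom :: "('b::comm_ring_1 \<Rightarrow> 'c::comm_ring_1) \<Rightarrow> bool" where
  "type_hom \<kappa> \<equiv> \<kappa> \<in> ring_hom (type_ring UNIV) (type_ring UNIV)"

lemma type_hom_add: "type_hom \<kappa> \<Longrightarrow> \<kappa> (x + y) = \<kappa> x + \<kappa> y"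
  and type_hom_mult: "type_hom \<kappa> \<Longrightarrow> \<kappa> (x * y) = \<kappa> x * \<kappa> y"
  and type_hom_one: "type_hom \<kappa> \<Longrightarrow> \<kappa> 1 = 1"
  using ring_hom_add [of \<kappa> "type_ring UNIV" "type_ring UNIV" x y]
    ring_hom_mult [of \<kappa> "type_ring UNIV" "type_ring UNIV" x y]
    ring_hom_one [of \<kappa> "type_ring UNIV" "type_ring UNIV"]
  by simp_all

lemma type_hom_zero: "type_hom \<kappa> \<Longrightarrow> \<kappa> 0 = 0"
  using type_hom_add [of \<kappa> 0 0] by simp

lemma type_hom_minus: "type_hom \<kappa> \<Longrightarrow> \<kappa> (- x) = - \<kappa> x"
  using type_hom_add [of \<kappa> x "- x"] by (simp add: type_hom_zero add_eq_0_iff)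

lemma type_hom_diff: "type_hom \<kappa> \<Longrightarrow> \<kappa> (x - y) = \<kappa> x - \<kappa> y"
  using type_hom_add [of \<kappa> x "- y"] by (simp add: type_hom_minus)

lemma type_hom_power: "type_hom \<kappa> \<Longrightarrow> \<kappa> (x ^ n) = \<kappa> x ^ n"
  by (induction n) (simp_all add: type_hom_one type_hom_mult)

lemma type_hom_of_nat: "type_hom \<kappa> \<Longrightarrow> \<kappa> (of_nat n) = of_nat n"
  by (induction n) (simp_all add: type_hom_zero type_hom_one type_hom_add)

lemmas type_hom_simps = type_hom_add type_hom_mult type_hom_one type_hom_zero type_hom_minus
  type_hom_diff type_hom_power

lemma type_homI:
  "\<lbrakk>\<And>x y. \<kappa> (x + y) = \<kappa> x + \<kappa> y; \<And>x y. \<kappa> (x * y) = \<kappa> x * \<kappa> y; \<kappa> 1 = 1\<rbrakk> \<Longrightarrow> type_hom \<kappa>"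
  by (rule ring_hom_memI) simp_all

text \<open>Evaluation is identified with the map given by the universal property, which brings the
  homomorphism laws with it.\<close>

lemma type_hom_eval:
  fixes \<kappa> :: "'b::comm_ring_1 \<Rightarrow> 'c::comm_ring_1"
  assumes \<kappa>: "type_hom \<kappa>"
  shows "type_hom (\<lambda>f. poly (map_poly \<kappa> f) u)"
proof -
  obtain \<psi> where \<psi>: "type_hom \<psi>" "\<And>c. \<psi> [:c:] = \<kappa> c" "\<psi> [:0, 1:] = u"
    by (rule extend_hom_poly [OF cring_type_ring_UNIV \<kappa>, of u]) auto
  have "\<psi> f = poly (map_poly \<kappa> f) u" for f
  proof (induction f)
    case 0
    then show ?case using \<psi>(1) by (simp add: type_hom_zero)
  next
    case (pCons c f)
    have "\<psi> (pCons c f) = \<psi> ([:c:] + [:0, 1:] * f)" by simp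
    also have "\<dots> = \<kappa> c + u * \<psi> f"
      using \<psi> by (simp only: type_hom_add type_hom_mult)
    finally show ?case
      using pCons by (simp add: map_poly_pCons type_hom_zero [OF \<kappa>])
  qed
  then have "\<psi> = (\<lambda>f. poly (map_poly \<kappa> f) u)" by blast
  then show ?thesis using \<psi>(1) by simp
qed

lemma type_hom_eval2:
  assumes "type_hom \<kappa>"
  shows "type_hom (\<lambda>f. eval2 \<kappa> f u v)"
  unfolding eval2_def by (intro type_hom_eval assms)

lemma eval2_generators:
  assumes "type_hom \<kappa>"
  shows "eval2 \<kappa> [:[:b:]:] u v = \<kappa> b" "eval2 \<kappa> z1 u v = u" "eval2 \<kappa> z2 u v = v"
  using type_hom_zero [OF assms] type_hom_one [OF assms]
  by (simp_all add: eval2_def z1_def z2_def map_poly_pCons)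

lemma hom_poly2_eqI:
  fixes S (structure) and \<psi> \<psi>' :: "'b::idom poly poly \<Rightarrow> 's"
  assumes S: "cring S" and \<psi>: "\<psi> \<in> ring_hom (type_ring UNIV) S" "\<psi>' \<in> ring_hom (type_ring UNIV) S"
    and eq: "\<And>c. \<psi> [:[:c:]:] = \<psi>' [:[:c:]:]" "\<psi> z1 = \<psi>' z1" "\<psi> z2 = \<psi>' z2"
  shows "\<psi> f = \<psi>' f"
proof (rule hom_poly_eqI [OF S \<psi>])
  show "\<psi> [:g:] = \<psi>' [:g:]" for g
    using hom_poly_eqI [OF S ring_hom_trans [OF const_poly_hom \<psi>(1)] ring_hom_trans [OF const_poly_hom \<psi>(2)], of g]
      eq by (simp add: z1_def)
  show "\<psi> [:0, 1:] = \<psi>' [:0, 1:]" using eq by (simp add: z2_def)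
qed

lemma type_hom_cst: "type_hom cst"
  by (rule type_homI) (simp_all add: cst_def one_pCons)

lemmas cst_simps = type_hom_simps [OF type_hom_cst]

lemma eval2_hom:
  assumes \<kappa>: "type_hom \<kappa>" and \<theta>: "type_hom \<theta>"
  shows "\<theta> (eval2 \<kappa> f u v) = eval2 (\<theta> \<circ> \<kappa>) f (\<theta> u) (\<theta> v)"
proof -
  have \<theta>\<kappa>: "type_hom (\<theta> \<circ> \<kappa>)" using \<kappa> \<theta> by (rule ring_hom_trans)
  have "(\<theta> \<circ> (\<lambda>f. eval2 \<kappa> f u v)) f = eval2 (\<theta> \<circ> \<kappa>) f (\<theta> u) (\<theta> v)"
    by (rule hom_poly2_eqI [OF cring_type_ring_UNIV ring_hom_trans [OF type_hom_eval2 [OF \<kappa>] \<theta>]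
          type_hom_eval2 [OF \<theta>\<kappa>]])
      (simp_all only: eval2_generators [OF \<kappa>] eval2_generators [OF \<theta>\<kappa>] o_apply)
  then show ?thesis by simp
qed

lemma extend_hom_poly3:
  fixes S (structure) and \<kappa> :: "'b::idom \<Rightarrow> 's"
  assumes S: "cring S" and \<kappa>: "\<kappa> \<in> ring_hom (type_ring UNIV) S"
    and u: "u1 \<in> carrier S" "u2 \<in> carrier S" "u3 \<in> carrier S"
  obtains \<psi> where "\<psi> \<in> ring_hom (type_ring UNIV) S" "\<And>c. \<psi> (cst c) = \<kappa> c"
    "\<psi> x1 = u1" "\<psi> x2 = u2" "\<psi> x3 = u3"
proof -
  obtain \<psi>1 where 1: "\<psi>1 \<in> ring_hom (type_ring UNIV) S" "\<And>c. \<psi>1 [:c:] = \<kappa> c" "\<psi>1 [:0, 1:] = u1"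
    by (rule extend_hom_poly [OF S \<kappa> u(1)]) blast
  obtain \<psi>2 where 2: "\<psi>2 \<in> ring_hom (type_ring UNIV) S" "\<And>c. \<psi>2 [:c:] = \<psi>1 c" "\<psi>2 [:0, 1:] = u2"
    by (rule extend_hom_poly [OF S 1(1) u(2)]) blast
  obtain \<psi>3 where 3: "\<psi>3 \<in> ring_hom (type_ring UNIV) S" "\<And>c. \<psi>3 [:c:] = \<psi>2 c" "\<psi>3 [:0, 1:] = u3"
    by (rule extend_hom_poly [OF S 2(1) u(3)]) blast
  show thesis
    by (rule that [OF 3(1)]) (simp_all add: cst_def x1_def x2_def x3_def 1 2 3)
qed

section \<open>The level sets\<close>

abbreviation fr :: "'b::idom \<Rightarrow> 'b fract" where "fr f \<equiv> Fract f 1"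

lemma type_hom_fr: "type_hom (\<lambda>f. fr f)"
  by (rule type_homI) (simp_all add: One_fract_def)

lemmas fr_simps = type_hom_simps [OF type_hom_fr]

lemma fr_eq_0_iff: "fr f = 0 \<longleftrightarrow> f = 0"
  by (simp add: Zero_fract_def eq_fract)

lemma type_hom_map_poly:
  assumes \<kappa>: "type_hom \<kappa>"
  shows "type_hom (map_poly \<kappa>)"
proof -
  obtain \<psi> where \<psi>: "type_hom \<psi>" "\<And>c. \<psi> [:c:] = [:\<kappa> c:]" "\<psi> [:0, 1:] = [:0, 1:]"
    by (rule extend_hom_poly [OF cring_type_ring_UNIV ring_hom_trans [OF \<kappa> const_poly_hom], of "[:0, 1:]"]) auto
  have "\<psi> f = map_poly \<kappa> f" for f
  proof (induction f)
    case 0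
    then show ?case using \<psi>(1) by (simp add: type_hom_zero)
  next
    case (pCons c f)
    have "\<psi> (pCons c f) = \<psi> ([:c:] + [:0, 1:] * f)" by simp
    also have "\<dots> = [:\<kappa> c:] + [:0, 1:] * \<psi> f"
      using \<psi> by (simp only: type_hom_add type_hom_mult)
    finally show ?case
      using pCons by (simp add: map_poly_pCons type_hom_zero [OF \<kappa>])
  qed
  then have "\<psi> = map_poly \<kappa>" by blast
  then show ?thesis using \<psi>(1) by simp
qed

lemma derivation_eval:
  assumes d: "derivation d" and \<kappa>: "\<kappa> 0 = 0" and "\<And>c. d (\<kappa> c) = 0" "d u = 0"
  shows "d (poly (map_poly \<kappa> f) u) = 0"
  by (induction f) (simp_all add: assms map_poly_pCons derivation_0 [OF d] derivation_add [OF d] derivation_mult [OF d])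

lemma derivation_eval2:
  assumes d: "derivation d" and \<kappa>: "type_hom \<kappa>" and "\<And>c. d (\<kappa> c) = 0" "d u = 0" "d v = 0"
  shows "d (eval2 \<kappa> f u v) = 0"
  unfolding eval2_def
  by (intro derivation_eval [OF d] assms(3-)) (simp_all add: type_hom_zero [OF \<kappa>])

text \<open>A quarter of the cross product of the gradients of H1 and H2, so that both are constant
  along it; these are the equations of the Euler top. The derivatives are those in x1, x2 and x3 in
  this order, since x1 is the innermost variable. The factor 1 brings the sum into the shape of
  \<open>derivation_lincomb\<close>.\<close>

definition vector_field :: "(nat \<Rightarrow> 'a::idom) \<Rightarrow> 'a poly poly poly \<Rightarrow> 'a poly poly poly" where
  "vector_field a f =
     1 * (cst (a 2 - a 3) * x2 * x3 * map_poly (map_poly pderiv) f +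
     cst (a 3 - a 1) * x3 * x1 * map_poly pderiv f) +
     cst (a 1 - a 2) * x1 * x2 * pderiv f"

lemma derivation_vector_field: "derivation (vector_field a)"
  unfolding vector_field_def
  by (intro derivation_lincomb derivation_map_poly derivation_pderiv)

lemma vector_field_cst: "vector_field a (cst b) = 0"
  and vector_field_x1: "vector_field a x1 = cst (a 2 - a 3) * x2 * x3"
  and vector_field_x2: "vector_field a x2 = cst (a 3 - a 1) * x3 * x1"
  and vector_field_x3: "vector_field a x3 = cst (a 1 - a 2) * x1 * x2"
  by (simp_all add: vector_field_def cst_def x1_def x2_def x3_def map_poly_pCons pderiv_pCons
      derivation_1 [OF derivation_map_poly [OF derivation_pderiv]]
      derivation_1 [OF derivation_map_poly [OF derivation_map_poly [OF derivation_pderiv]]]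
      flip: one_pCons)

lemma vector_field_H1: "vector_field a (H1 a) = 0"
  by (simp add: H1_def derivation_add [OF derivation_vector_field] derivation_mult [OF derivation_vector_field]
      derivation_power [OF derivation_vector_field] vector_field_cst vector_field_x1 vector_field_x2
      vector_field_x3 cst_simps algebra_simps)

lemma vector_field_H2: "vector_field a H2 = 0"
  by (simp add: H2_def derivation_add [OF derivation_vector_field]
      derivation_power [OF derivation_vector_field] vector_field_x1 vector_field_x2
      vector_field_x3 cst_simps algebra_simps)

abbreviation at_H :: "(nat \<Rightarrow> 'a::idom) \<Rightarrow> 'a poly poly \<Rightarrow> 'a poly poly poly" where
  "at_H a f \<equiv> eval2 cst f (H1 a) H2"

lemma type_hom_at_H: "type_hom (at_H a)"
  by (rule type_hom_eval2 [OF type_hom_cst])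

lemmas at_H_simps = type_hom_simps [OF type_hom_at_H] eval2_generators [OF type_hom_cst]

lemma vector_field_at_H: "vector_field a (at_H a f) = 0"
  by (rule derivation_eval2 [OF derivation_vector_field type_hom_cst])
    (rule vector_field_cst vector_field_H1 vector_field_H2)+

text \<open>After the substitution the first factor of F becomes (a1 - a2) x1^2 and the second (a1 -
  a2) x2^2. Thus x3 and (a1 - a2) x1 x2 are coordinates x and y with y^2 = F(x).\<close>

lemma Fpoly_at_H:
  "poly (map_poly (at_H a) (Fpoly a)) x3 = (cst (a 1 - a 2) * x1 * x2) ^ 2"
proof -
  let ?\<Phi> = "\<lambda>f. poly (map_poly (at_H a) f) x3"
  have \<Phi>: "type_hom ?\<Phi>" by (rule type_hom_eval [OF type_hom_at_H])
  have const: "?\<Phi> [:g:] = at_H a g" for g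
    by (simp add: map_poly_pCons at_H_simps)
  have X: "?\<Phi> [:0, 1:] = x3"
    by (simp add: map_poly_pCons at_H_simps)
  have "?\<Phi> (Fpoly a) = (cst (a 2 - a 3) * x3 ^ 2 + (H1 a - cst (a 2) * H2)) *
      (cst (a 3 - a 1) * x3 ^ 2 + (- H1 a + cst (a 1) * H2))"
    unfolding Fpoly_def Let_def
    by (simp only: type_hom_simps [OF \<Phi>] const X at_H_simps)
  also have "\<dots> = (cst (a 1 - a 2) * x1 * x2) ^ 2"
    by (simp add: H1_def H2_def cst_simps algebra_simps power2_eq_square)
  finally show ?thesis .
qed

lemma degree_Fpoly: "degree (Fpoly a) \<le> 4"
proof -
  have "degree ([:c:] * [:0, 1:] ^ 2 + [:d:]) \<le> 2" for c d :: "'a poly poly"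
    by (rule degree_le) (auto simp: coeff_pCons power2_eq_square split: nat.splits)
  then show ?thesis
    unfolding Fpoly_def Let_def
    by (intro order.trans [OF degree_mult_le]) (smt (verit) add_mono numeral_Bit0)
qed

lemma poly_eq_sum_atMost:
  fixes f :: "'b::comm_ring_1 poly"
  assumes "degree f \<le> n"
  shows "poly f u = (\<Sum>j\<le>n. Polynomial.coeff f j * u ^ j)"
  unfolding poly_altdef
  by (intro sum.mono_neutral_left) (use assms in \<open>auto simp: coeff_eq_0\<close>)

text \<open>Raising y^2 = F(x3) to the power (p - 1)/2 expands y^(p - 1) in powers of x3 with
  coefficients in A[H1, H2]; the bound on the exponents is 4 times (p - 1)/2.\<close>

lemma hasse_sum:
  assumes "odd p"
  shows "(\<Sum>j\<le>2 * (p - 1). at_H a (Polynomial.coeff (Fpoly a ^ ((p - 1) div 2)) j) * x3 ^ j) =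
    (cst (a 1 - a 2) * x1 * x2) ^ (p - 1)"
proof -
  let ?m = "(p - 1) div 2"
  have m: "p - 1 = 2 * ?m" using assms by simp
  have "degree (Fpoly a ^ ?m) \<le> 4 * ?m"
    using degree_power_le [of "Fpoly a" ?m] mult_right_mono [OF degree_Fpoly [of a], of ?m] by linarith
  then have "degree (Fpoly a ^ ?m) \<le> 2 * (p - 1)" using m by linarith
  then have "degree (map_poly (at_H a) (Fpoly a ^ ?m)) \<le> 2 * (p - 1)"
    by (intro degree_le) (auto simp: coeff_map_poly at_H_simps coeff_eq_0)
  then have "poly (map_poly (at_H a) (Fpoly a ^ ?m)) x3 =
    (\<Sum>j\<le>2 * (p - 1). at_H a (Polynomial.coeff (Fpoly a ^ ?m) j) * x3 ^ j)"
    by (simp add: poly_eq_sum_atMost coeff_map_poly at_H_simps)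
  moreover have "poly (map_poly (at_H a) (Fpoly a ^ ?m)) x3 = (cst (a 1 - a 2) * x1 * x2) ^ (p - 1)"
    unfolding type_hom_power [OF type_hom_eval [OF type_hom_at_H]] Fpoly_at_H
    by (subst m) (simp add: power_mult)
  ultimately show ?thesis by simp
qed

text \<open>The hypotheses on the base ring in elementwise form: p is neither zero nor a unit, and
  every element not divisible by p is a unit. The two statements on units are derived from
  completeness and the maximality of (p) in \<open>local_of_complete\<close>.\<close>

locale level_sets =
  fixes p :: nat and a :: "nat \<Rightarrow> 'a::idom"
  assumes prime_p: "Factorial_Ring.prime p" and odd_p: "odd p"
    and p_nonzero: "of_nat p \<noteq> (0::'a)" and p_nonunit: "\<not> of_nat p dvd (1::'a)"
    and local: "\<not> of_nat p dvd (x::'a) \<Longrightarrow> x dvd 1"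
    and distinct: "(a 1 - a 2) * (a 2 - a 3) * (a 3 - a 1) dvd 1"
begin

lemma differences_dvd_1: "a 1 - a 2 dvd 1" "a 2 - a 3 dvd 1" "a 3 - a 1 dvd 1"
  using distinct by (auto dest: dvd_mult_left dvd_mult_right)

lemma differences_nonzero: "a 1 - a 2 \<noteq> 0" "a 2 - a 3 \<noteq> 0" "a 3 - a 1 \<noteq> 0"
  using distinct by auto

text \<open>By Bezout, p dividing n in the ring would make p a unit. This supplies the denominators
  j + 1 of the antiderivative and the inverse of 2.\<close>

lemma nat_dvd_1:
  assumes "coprime n p"
  shows "(of_nat n :: 'a) dvd 1"
proof (rule local)
  show "\<not> of_nat p dvd (of_nat n :: 'a)"
  proof
    assume *: "of_nat p dvd (of_nat n :: 'a)"
    obtain u v :: int where "int n * u + int p * v = 1"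
      using assms bezout_int [of "int n" "int p"] by (auto simp: mult.commute)
    then have "(of_int (int n * u + int p * v) :: 'a) = of_int 1" by (rule arg_cong)
    then have "of_nat n * of_int u + of_nat p * of_int v = (1 :: 'a)" by simp
    then have "of_nat p dvd (1 :: 'a)"
      using dvd_add [OF dvd_mult2 [OF *] dvd_triv_left] by metis
    then show False using p_nonunit by simp
  qed
qed

lemma prime_elem_p: "prime_elem (of_nat p :: 'a)"
proof (rule prime_elemI)
  fix x y :: 'a
  assume *: "of_nat p dvd x * y"
  show "of_nat p dvd x \<or> of_nat p dvd y"
  proof (rule disjCI)
    assume "\<not> of_nat p dvd y"
    then obtain z where z: "1 = y * z" using local [of y] by (auto simp: dvd_def)
    have "of_nat p dvd (x * y) * z" using * by (rule dvd_mult2)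
    also have "(x * y) * z = x" by (simp add: mult.assoc flip: z)
    finally show "of_nat p dvd x" .
  qed
qed (use p_nonzero p_nonunit in auto)

text \<open>At the point (1, 0, 0), where H1 = a1 and H2 = 1, the second factor of F reduces to (a3
  - a1) x^2. The coefficient of x^(p - 1) in F^((p - 1)/2) is then the lowest one, ((a3 - a1) (a1 -
  a2))^((p - 1)/2), and it does not vanish.\<close>

lemma hasse_nonzero: "at_H a (hasse p a) \<noteq> 0"
proof -
  let ?\<theta> = "\<lambda>f. poly (poly (poly f 0) 0) 1 :: 'a"
  have \<theta>: "type_hom ?\<theta>" by (rule type_homI) simp_all
  have \<theta>_cst: "?\<theta> \<circ> cst = id" by (simp add: fun_eq_iff cst_def)
  have H: "?\<theta> (H1 a) = a 1" "?\<theta> H2 = 1"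
    by (simp_all add: H1_def H2_def cst_def x1_def x2_def x3_def)
  let ?ev = "\<lambda>g. eval2 id g (a 1) (1::'a)"
  have id: "type_hom (id :: 'a \<Rightarrow> 'a)" by (rule type_homI) simp_all
  have ev: "type_hom ?ev" by (rule type_hom_eval2 [OF id])
  let ?M = "map_poly ?ev" and ?m = "(p - 1) div 2"
  have M: "type_hom ?M" by (rule type_hom_map_poly [OF ev])
  have const: "?M [:g:] = [:?ev g:]" for g
    by (simp add: map_poly_pCons type_hom_zero [OF ev] del: One_nat_def)
  have X: "?M [:0, 1:] = [:0, 1:]"
    by (simp add: map_poly_pCons type_hom_zero [OF ev] type_hom_one [OF ev] del: One_nat_def)
  have "?M (Fpoly a) = ([:a 2 - a 3:] * [:0, 1:] ^ 2 + [:a 1 - a 2:]) * ([:a 3 - a 1:] * [:0, 1:] ^ 2)"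
    unfolding Fpoly_def Let_def
    by (simp only: type_hom_simps [OF M] const X type_hom_simps [OF ev] eval2_generators [OF id])
      (simp add: algebra_simps)
  also have "\<dots> = Polynomial.monom (a 3 - a 1) 2 * [:a 1 - a 2, 0, a 2 - a 3:]"
    by (simp add: monom_altdef power2_eq_square)
  finally have M_F: "?M (Fpoly a) = Polynomial.monom (a 3 - a 1) 2 * [:a 1 - a 2, 0, a 2 - a 3:]" .
  have "?M (Fpoly a ^ ?m) = Polynomial.monom ((a 3 - a 1) ^ ?m) (2 * ?m) * [:a 1 - a 2, 0, a 2 - a 3:] ^ ?m"
    by (simp only: type_hom_power [OF M] M_F power_mult_distrib monom_power)
  moreover have "Polynomial.coeff (?M (Fpoly a ^ ?m)) (2 * ?m) = ?ev (hasse p a)"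
    using odd_p by (simp add: coeff_map_poly type_hom_zero [OF ev] hasse_def del: One_nat_def)
  ultimately have "?ev (hasse p a) = (a 3 - a 1) ^ ?m * (a 1 - a 2) ^ ?m"
    by (simp add: coeff_monom_mult coeff_0_power)
  moreover have "?\<theta> (at_H a (hasse p a)) = ?ev (hasse p a)"
    using eval2_hom [OF type_hom_cst \<theta>] by (simp add: \<theta>_cst H)
  ultimately have "?\<theta> (at_H a (hasse p a)) \<noteq> 0"
    using differences_nonzero by simp
  then show ?thesis by (metis poly_0)
qed

lemma Npoly_nonzero: "at_H a (Npoly a) \<noteq> 0"
proof -
  have N: "at_H a (Npoly a) =
      (H1 a - cst (a 1) * H2) * ((H1 a - cst (a 2) * H2) * (H1 a - cst (a 3) * H2))"
  proof -
    have "Npoly a = (z1 - [:[:a 1:]:] * z2) * ((z1 - [:[:a 2:]:] * z2) * (z1 - [:[:a 3:]:] * z2))"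
      by (simp add: Npoly_def numeral_3_eq_3 numeral_2_eq_2 mult.assoc)
    then show ?thesis by (simp only: at_H_simps)
  qed
  \<comment> \<open>The values are listed from x3 to x1: the test points are (0, 1, 0) for the first
    factor and (1, 0, 0) for the other two.\<close>
  have "poly (poly (poly (H1 a - cst (a 1) * H2) 0) 1) 0 = a 2 - a 1"
    "poly (poly (poly (H1 a - cst (a 2) * H2) 0) 0) 1 = a 1 - a 2"
    "poly (poly (poly (H1 a - cst (a 3) * H2) 0) 0) 1 = a 1 - a 3"
    by (simp_all add: H1_def H2_def cst_def x1_def x2_def x3_def)
  then show ?thesis
    unfolding N using differences_nonzero by (metis eq_iff_diff_eq_0 mult_eq_0_iff poly_0)
qed

lemma Qpoly_nonzero: "Qpoly p a \<noteq> 0"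
  using hasse_nonzero Npoly_nonzero by (simp add: Qpoly_def x1_def x2_def)

end

section \<open>Saturation of the level ideals with respect to p\<close>

lemma monic_quadratic_division:
  fixes k :: "'b::comm_ring_1"
  shows "\<exists>q r0 r1. f = q * [:k, 0, 1:] + [:r0, r1:]"
proof (induction f)
  case 0
  show ?case by (rule exI [of _ 0], rule exI [of _ 0], rule exI [of _ 0]) simp
next
  case (pCons c f)
  then obtain q r0 r1 where "f = q * [:k, 0, 1:] + [:r0, r1:]" by blast
  then have "pCons c f = pCons r1 q * [:k, 0, 1:] + [:c - r1 * k, r0:]"
    by (simp add: algebra_simps)
  then show ?case by blast
qed

lemma monic_quadratic_unique:
  fixes k :: "'b::idom"
  assumes "q * [:k, 0, 1:] = [:r0, r1:]"
  shows "r0 = 0" "r1 = 0"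
proof -
  have "q = 0"
  proof (rule ccontr)
    assume "q \<noteq> 0"
    then have "degree (q * [:k, 0, 1:]) = degree q + 2" by (simp add: degree_mult_eq del: mult_pCons_right)
    moreover have "degree [:r0, r1:] \<le> 1" by simp
    ultimately show False using assms by simp
  qed
  then show "r0 = 0" "r1 = 0" using assms by simp_all
qed

text \<open>The two generators are monic in different variables.\<close>

lemma torsion_free_monic_quadratics:
  fixes f :: "'b::idom poly" and k l :: 'b
  assumes "prime_elem \<pi>" "\<not> \<pi> dvd l" "[:\<pi>:] * f = u * [:k, 0, 1:] + v * [:l:]"
  shows "\<exists>u v. f = u * [:k, 0, 1:] + v * [:l:]"
proof -
  obtain q f0 f1 where f: "f = q * [:k, 0, 1:] + [:f0, f1:]"
    using monic_quadratic_division by blast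
  obtain s v0 v1 where v: "v = s * [:k, 0, 1:] + [:v0, v1:]"
    using monic_quadratic_division by blast
  \<comment> \<open>Comparing remainders modulo the quadratic turns the relation into \<pi> f0 = v0
    l and \<pi> f1 = v1 l in the coefficient ring; as \<pi> is prime and does not divide l, it
    divides v0 and v1.\<close>
  have "(u + s * [:l:] - [:\<pi>:] * q) * [:k, 0, 1:] = [:\<pi>:] * [:f0, f1:] - [:v0, v1:] * [:l:]"
    using assms(3) unfolding f v by Groebner_Basis.algebra
  also have "\<dots> = [:\<pi> * f0 - v0 * l, \<pi> * f1 - v1 * l:]"
    by (simp add: mult.commute)
  finally have "\<pi> * f0 = v0 * l" "\<pi> * f1 = v1 * l"
    using monic_quadratic_unique by fastforce+
  moreover from this have "\<pi> dvd v0" "\<pi> dvd v1"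
    using assms(1,2) by (metis dvd_triv_left prime_elem_dvd_mult_iff)+
  then obtain w0 w1 where "v0 = \<pi> * w0" "v1 = \<pi> * w1" by (auto elim!: dvdE)
  ultimately have "f0 = w0 * l" "f1 = w1 * l"
    using assms(1) by auto
  then have "f = q * [:k, 0, 1:] + [:w0, w1:] * [:l:]"
    by (simp add: f mult.commute)
  then show ?thesis by blast
qed

text \<open>With w the inverse of a3 - a2, linear combinations of the generators eliminate x2^2 and
  x3^2 in turn. The ideal is thus generated by x3^2 + \<open>K\<close> with \<open>K\<close> in
  A[x1] and by \<open>L\<close>, which is monic of degree 2 in x2 and hence not divisible by p. This
  is the situation of \<open>torsion_free_monic_quadratics\<close>.\<close>

lemma (in level_sets) level_torsion_free:
  fixes c1 c2 :: 'a
  defines "h1 \<equiv> H1 a - cst c1" and "h2 \<equiv> H2 - cst c2"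
  assumes "of_nat p * f = u * h1 + v * h2"
  shows "\<exists>u v. f = u * h1 + v * h2"
proof -
  obtain w where w: "(a 3 - a 2) * w = 1"
    using differences_dvd_1(2) by (metis dvdE minus_diff_eq minus_dvd_iff)
  define K :: "'a poly poly" where "K = [:[:w * (c2 * a 2 - c1), 0, w * (a 1 - a 2):]:]"
  define L :: "'a poly poly" where "L = [:[:- w * (c2 * a 3 - c1), 0, - w * (a 1 - a 3):], 0, 1:]"
  have w1: "cst w * cst (a 3) = 1 + cst w * cst (a 2)"
  proof -
    have "cst ((a 3 - a 2) * w) = 1" by (simp add: w cst_simps)
    then show ?thesis by (simp add: cst_simps algebra_simps)
  qed
  have K: "[:K, 0, 1:] = cst w * (h1 - cst (a 2) * h2)"
  proof -
    have "[:K, 0, 1:] = x3 ^ 2 + cst (w * (a 1 - a 2)) * x1 ^ 2 + cst (w * (c2 * a 2 - c1))"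
      by (simp add: K_def x3_def x1_def cst_def power2_eq_square)
    also have "\<dots> = cst w * (h1 - cst (a 2) * h2)"
      using w1 unfolding h1_def h2_def H1_def H2_def cst_simps by Groebner_Basis.algebra
    finally show ?thesis .
  qed
  have L: "[:L:] = - cst w * (h1 - cst (a 3) * h2)"
  proof -
    have "[:L:] = x2 ^ 2 + cst (- w * (a 1 - a 3)) * x1 ^ 2 + cst (- w * (c2 * a 3 - c1))"
      by (simp add: L_def x2_def x1_def cst_def power2_eq_square)
    also have "\<dots> = - cst w * (h1 - cst (a 3) * h2)"
      using w1 unfolding h1_def h2_def H1_def H2_def cst_simps by Groebner_Basis.algebra
    finally show ?thesis .
  qed
  have h2: "h2 = [:K, 0, 1:] + [:L:]"
    unfolding K L using w1 by Groebner_Basis.algebra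
  have h1: "h1 = (cst (a 3) - cst (a 2)) * [:K, 0, 1:] + cst (a 2) * h2"
    unfolding K using w1 by Groebner_Basis.algebra
  have prime: "prime_elem (of_nat p :: 'a poly poly)"
    using prime_elem_p by (simp add: of_nat_poly lift_prime_elem_poly)
  have ndvd: "\<not> of_nat p dvd L"
  proof
    assume "of_nat p dvd L"
    then have "of_nat p dvd Polynomial.coeff (Polynomial.coeff L 2) 0"
      by (simp add: of_nat_poly const_poly_dvd_iff)
    then show False using p_nonunit by (simp add: L_def numeral_2_eq_2)
  qed
  have "[:of_nat p:] * f =
      (u * (cst (a 3) - cst (a 2)) + (u * cst (a 2) + v)) * [:K, 0, 1:] + (u * cst (a 2) + v) * [:L:]"
    using assms(3) h1 h2 unfolding of_nat_poly by Groebner_Basis.algebra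
  from torsion_free_monic_quadratics [OF prime ndvd this]
  obtain u' v' where "f = u' * [:K, 0, 1:] + v' * [:L:]" by blast
  then have "f = (u' * cst w - v' * cst w) * h1 + (v' * cst w * cst (a 3) - u' * cst w * cst (a 2)) * h2"
    unfolding K L by (simp add: algebra_simps)
  then show ?thesis by blast
qed

section \<open>The Frobenius lift\<close>

lemma poly3_induct [case_names cst x1 x2 x3 add mult]:
  fixes f :: "'b::idom poly poly poly"
  assumes "\<And>c. P (cst c)" "P x1" "P x2" "P x3"
    and add: "\<And>f g. \<lbrakk>P f; P g\<rbrakk> \<Longrightarrow> P (f + g)" and mult: "\<And>f g. \<lbrakk>P f; P g\<rbrakk> \<Longrightarrow> P (f * g)"
  shows "P f"
proof -
  have 1: "P [:[:g:]:]" for g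
  proof (induction g)
    case 0
    show ?case using assms(1) [of 0] by (simp add: cst_def)
  next
    case (pCons c g)
    have "[:[:pCons c g:]:] = cst c + x1 * [:[:g:]:]" by (simp add: cst_def x1_def)
    then show ?case using pCons assms by metis
  qed
  have 2: "P [:g:]" for g
  proof (induction g)
    case 0
    show ?case using 1 [of 0] by simp
  next
    case (pCons c g)
    have "[:pCons c g:] = [:[:c:]:] + x2 * [:g:]" by (simp add: x2_def)
    then show ?case using pCons assms 1 by metis
  qed
  show ?thesis
  proof (induction f)
    case 0
    show ?case using 2 [of 0] by simp
  next
    case (pCons c f)
    have "pCons c f = [:c:] + x3 * f" by (simp add: x3_def)
    then show ?case using pCons assms 2 by metis
  qed
qed

text \<open>These rules merge fractions, whereas \<open>fr_simps\<close> distributes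
  \<open>fr\<close> over sums and products; from here on the latter direction is preferred.\<close>

declare add_fract [simp del] mult_fract [simp del] minus_fract [simp del] diff_fract [simp del]

context level_sets
begin

definition B :: "'a poly poly poly fract set" where
  "B = {Fract g (Qpoly p a ^ n) | g n. True}"

lemma OX_eq: "OX p a = type_ring B"
  by (simp add: OX_def localization_at_def B_def)

lemma carrier_OX: "carrier (OX p a) = B"
  by (simp add: OX_eq)

lemmas B_closed [simp, intro] = localization_at_closed [OF Qpoly_nonzero, folded B_def]

lemma B_power [simp, intro]: "x \<in> B \<Longrightarrow> x ^ n \<in> B"
  by (induction n) simp_all

lemma B_of_nat [simp, intro]: "of_nat n \<in> B"
  using B_closed(1) [of "of_nat n"] by (simp add: of_nat_fract)

lemma B_diff [simp, intro]: "\<lbrakk>x \<in> B; y \<in> B\<rbrakk> \<Longrightarrow> x - y \<in> B"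
  using B_closed(5) [of x "- y"] B_closed(4) [of y] by simp

lemma B_sum [intro]: "(\<And>i. i \<in> I \<Longrightarrow> f i \<in> B) \<Longrightarrow> sum f I \<in> B"
  by (induction I rule: infinite_finite_induct) simp_all

text \<open>Every divisor f of Q is invertible on X, with the cofactor over Q as inverse; this
  covers x1, x2, their product, the Hasse invariant and Q itself.\<close>

lemma B_divisor:
  assumes "f * g = Qpoly p a"
  shows "Fract g (Qpoly p a) \<in> B" "fr f * Fract g (Qpoly p a) = 1"
proof -
  have "Fract g (Qpoly p a ^ 1) \<in> B" unfolding B_def by blast
  then show "Fract g (Qpoly p a) \<in> B" by simp
  show "fr f * Fract g (Qpoly p a) = 1"
    using assms Qpoly_nonzero by (simp add: One_fract_def eq_fract mult_fract)
qed

lemma cring_OX: "cring (OX p a)"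
  unfolding OX_def by (rule cring_localization_at [OF Qpoly_nonzero])

lemma of_nat_p_fract: "of_nat p \<noteq> (0 :: 'a poly poly poly fract)"
  using p_nonzero by (simp add: of_nat_fract fr_eq_0_iff of_nat_poly)

sublocale X: torsion_free_ring "OX p a" p
proof (intro torsion_free_ring.intro torsion_free_ring_axioms.intro cring_OX)
  fix x assume "[p] \<cdot>\<^bsub>OX p a\<^esub> x = \<zero>\<^bsub>OX p a\<^esub>"
  then show "x = \<zero>\<^bsub>OX p a\<^esub>"
    using of_nat_p_fract by (simp add: OX_eq)
qed

abbreviation emb_X :: "'a poly poly poly fract \<Rightarrow> nat \<Rightarrow> 'a poly poly poly fract set" where
  "emb_X \<equiv> to_completion p (OX p a)"

sublocale X: dense_ring_hom "OX p a" "OX_hat p a" emb_X p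
  using X.emb_dense_ring_hom by (simp add: OX_hat_def)

lemma emb_X_closed: "x \<in> B \<Longrightarrow> emb_X x \<in> carrier (OX_hat p a)"
  using ring_hom_closed [OF X.\<iota>] by (simp add: carrier_OX)

lemma emb_X_add: "\<lbrakk>x \<in> B; y \<in> B\<rbrakk> \<Longrightarrow> emb_X (x + y) = emb_X x \<oplus>\<^bsub>OX_hat p a\<^esub> emb_X y"
  and emb_X_mult: "\<lbrakk>x \<in> B; y \<in> B\<rbrakk> \<Longrightarrow> emb_X (x * y) = emb_X x \<otimes>\<^bsub>OX_hat p a\<^esub> emb_X y"
  and emb_X_one: "emb_X 1 = \<one>\<^bsub>OX_hat p a\<^esub>"
  and emb_X_zero: "emb_X 0 = \<zero>\<^bsub>OX_hat p a\<^esub>"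
  using ring_hom_add [OF X.\<iota>, of x y] ring_hom_mult [OF X.\<iota>, of x y] ring_hom_one [OF X.\<iota>]
    ring_hom_zero [OF X.\<iota> X.ring_axioms X.S.ring_axioms]
  by (simp_all add: OX_eq)

lemma emb_X_power: "x \<in> B \<Longrightarrow> emb_X (x ^ n) = emb_X x [^]\<^bsub>OX_hat p a\<^esub> n"
  by (induction n) (simp_all add: emb_X_one emb_X_mult emb_X_closed X.S.m_comm)

lemma emb_X_nat_multiple:
  "x \<in> B \<Longrightarrow> emb_X (of_nat k * x) = [k] \<cdot>\<^bsub>OX_hat p a\<^esub> emb_X x"
proof (induction k)
  case 0
  then show ?case by (simp add: emb_X_zero)
next
  case (Suc k)
  have "of_nat (Suc k) * x = of_nat k * x + x" by (simp add: algebra_simps)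
  then show ?case using Suc by (simp only: emb_X_add B_closed B_of_nat) simp
qed

lemma emb_X_congruent:
  "\<lbrakk>y \<in> B; z \<in> B; x = y + of_nat k * z\<rbrakk> \<Longrightarrow> congruent_mod k (OX_hat p a) (emb_X x) (emb_X y)"
  by (simp add: emb_X_add emb_X_nat_multiple emb_X_closed X.S.congruent_multiple)

text \<open>The inverse of the Hasse invariant of (H1, H2), written over Q so that it visibly lies
  in \<open>B\<close>.\<close>

definition eta :: "'a poly poly poly fract" where
  "eta = Fract (x1 * x2 * at_H a (Npoly a)) (Qpoly p a)"

lemma eta: "eta \<in> B" "fr (at_H a (hasse p a)) * eta = 1"
  unfolding eta_def using B_divisor [of "at_H a (hasse p a)" "x1 * x2 * at_H a (Npoly a)"]
  by (simp_all add: Qpoly_def mult.commute)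

text \<open>The derivative of x3 along the vector field, so that \<omega> = dx3 /
  \<open>tangent\<close>; its square is the value of F at x3.\<close>

definition tangent :: "'a poly poly poly" where
  "tangent = cst (a 1 - a 2) * x1 * x2"

definition nat_inverse :: "nat \<Rightarrow> 'a" where
  "nat_inverse n = (SOME w. of_nat n * w = 1)"

lemma nat_inverse: "coprime n p \<Longrightarrow> of_nat n * nat_inverse n = 1"
  unfolding nat_inverse_def by (rule someI_ex) (metis nat_dvd_1 dvdE)

lemma fr_half: "2 * fr (cst (nat_inverse 2)) = 1"
proof -
  have "coprime 2 p" using odd_p by simp
  from nat_inverse [OF this] have "fr (cst (of_nat 2 * nat_inverse 2)) = 1"
    by (simp only: cst_simps fr_simps)
  then have "of_nat 2 * fr (cst (nat_inverse 2)) = 1"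
    by (simp only: cst_simps fr_simps type_hom_of_nat [OF type_hom_cst] type_hom_of_nat [OF type_hom_fr])
  then show ?thesis by simp
qed

abbreviation "hasse_coeff j \<equiv> at_H a (Polynomial.coeff (Fpoly a ^ ((p - 1) div 2)) j)"

text \<open>An antiderivative of the terms of degree other than \<open>p - 1\<close>; the exponents stay below
  \<open>2 * p - 1\<close>, so no other denominator is divisible by \<open>p\<close>.\<close>

definition delta_x3 :: "'a poly poly poly fract" where
  "delta_x3 = eta * (\<Sum>j\<in>{..2 * (p - 1)} - {p - 1}.
     fr (hasse_coeff j * cst (nat_inverse (Suc j)) * x3 ^ Suc j))"

definition frob_x3 :: "'a poly poly poly fract" where
  "frob_x3 = fr x3 ^ p + of_nat p * delta_x3"

lemma delta_x3_B: "delta_x3 \<in> B"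
  unfolding delta_x3_def by (intro B_closed(6) eta B_sum B_closed(1))

lemma frob_x3_B: "frob_x3 \<in> B"
  unfolding frob_x3_def using delta_x3_B by simp

abbreviation "D \<equiv> fract_derivation (vector_field a)"

lemma derivation_D: "derivation D"
  by (rule derivation_fract_derivation [OF derivation_vector_field])

lemma D_fr: "D (fr f) = fr (vector_field a f)"
  by (rule fract_derivation_one [OF derivation_vector_field])

lemma D_B: "x \<in> B \<Longrightarrow> D x \<in> B"
  using fract_derivation_localization [OF derivation_vector_field Qpoly_nonzero, of x a]
  by (simp add: carrier_localization_at B_def)

text \<open>The Hasse invariant of (H1, H2) is constant along \<open>D\<close>, hence so is its
  inverse.\<close>

lemma D_eta: "D eta = 0"
proof -
  have "fr (at_H a (hasse p a)) * D eta = 0"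
    using arg_cong [OF eta(2), of D]
    by (simp add: derivation_mult [OF derivation_D] derivation_1 [OF derivation_D] D_fr vector_field_at_H fr_simps)
  then have "(fr (at_H a (hasse p a)) * eta) * D eta = 0"
    by (simp only: mult.commute [of _ eta] mult.assoc mult_zero_right)
  then show ?thesis by (simp only: eta(2) mult_1_left)
qed

lemma D_fr_of_nat: "D (of_nat n) = 0"
  by (induction n) (simp_all add: derivation_0 [OF derivation_D] derivation_1 [OF derivation_D] derivation_add [OF derivation_D])

text \<open>Write t for \<open>tangent\<close> and h for the Hasse invariant of (H1, H2). By
  \<open>hasse_sum\<close>, \<open>D delta_x3\<close> equals t^p / h - x3^(p - 1) t: the term of
  degree p - 1 left out of the antiderivative has coefficient h, which \<open>eta\<close> normalizes
  to 1. After multiplication by p it cancels against \<open>D\<close> of x3^p, which is p x3^(p - 1)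
  t.\<close>

lemma D_frob_x3: "D frob_x3 = of_nat p * (eta * fr tangent ^ p)"
proof -
  let ?I = "{..2 * (p - 1)} - {p - 1}"
  have p: "p \<ge> 2" using prime_p by (rule prime_ge_2_nat)
  have "vector_field a (hasse_coeff j * cst (nat_inverse (Suc j)) * x3 ^ Suc j) =
      hasse_coeff j * x3 ^ j * tangent" if "j \<in> ?I" for j
  proof -
    have "coprime (Suc j) p"
    proof (rule ccontr)
      assume "\<not> coprime (Suc j) p"
      then have "p dvd Suc j" using prime_p by (metis coprime_commute prime_imp_coprime)
      then obtain k where "Suc j = p * k" by (elim dvdE)
      moreover from this have "k \<noteq> 0" by (cases k) auto
      moreover have "k \<noteq> 1" using that \<open>Suc j = p * k\<close> by auto
      ultimately have "Suc j \<ge> p * 2" by simp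
      then show False using that p by auto
    qed
    then have w: "of_nat (Suc j) * nat_inverse (Suc j) = 1" by (rule nat_inverse)
    have "vector_field a (hasse_coeff j * cst (nat_inverse (Suc j)) * x3 ^ Suc j) =
        hasse_coeff j * (of_nat (Suc j) * cst (nat_inverse (Suc j))) * (x3 ^ j * tangent)"
      by (simp add: derivation_mult [OF derivation_vector_field] derivation_power [OF derivation_vector_field]
          vector_field_at_H vector_field_cst vector_field_x3 tangent_def del: power_Suc of_nat_Suc)
    also have "of_nat (Suc j) * cst (nat_inverse (Suc j)) = cst (of_nat (Suc j) * nat_inverse (Suc j))"
      by (simp only: cst_simps type_hom_of_nat [OF type_hom_cst])
    finally show ?thesis by (simp only: w cst_simps mult_1_right mult.assoc)
  qed
  then have "D delta_x3 = eta * (\<Sum>j\<in>?I. fr (hasse_coeff j * x3 ^ j * tangent))"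
    unfolding delta_x3_def derivation_mult [OF derivation_D] derivation_sum [OF derivation_D] D_eta D_fr
    by simp
  also have "(\<Sum>j\<in>?I. fr (hasse_coeff j * x3 ^ j * tangent)) =
      fr (\<Sum>j\<in>?I. hasse_coeff j * x3 ^ j) * fr tangent"
    by (induction rule: infinite_finite_induct [of _ ?I]) (simp_all add: fr_simps algebra_simps)
  also have "(\<Sum>j\<in>?I. hasse_coeff j * x3 ^ j) = tangent ^ (p - 1) - at_H a (hasse p a) * x3 ^ (p - 1)"
    using hasse_sum [OF odd_p, of a]
    by (simp add: sum_diff1 hasse_def tangent_def)
  finally have "D delta_x3 = (eta * fr tangent ^ (p - 1) - (fr (at_H a (hasse p a)) * eta) * fr x3 ^ (p - 1)) * fr tangent"
    by (simp add: fr_simps algebra_simps)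
  then have D1: "D delta_x3 = eta * fr tangent ^ p - fr x3 ^ (p - 1) * fr tangent"
    using p by (simp only: eta(2) left_diff_distrib mult_1_left mult.assoc)
      (use p in \<open>simp add: power_minus_mult del: One_nat_def\<close>)
  have D2: "D (fr x3 ^ p) = of_nat p * (fr x3 ^ (p - 1) * fr tangent)"
    by (simp add: derivation_power [OF derivation_D] D_fr vector_field_x3 tangent_def)
  show ?thesis
    unfolding frob_x3_def derivation_add [OF derivation_D] derivation_mult [OF derivation_D] D_fr_of_nat D1 D2
    by (simp add: right_diff_distrib)
qed

lemma frobenius_sum3:
  assumes "x \<in> B" "y \<in> B" "z \<in> B"
  shows "\<exists>w\<in>B. (x + y + z) ^ p = x ^ p + y ^ p + z ^ p + of_nat p * w"
proof -
  have B: "cring (type_ring B)" using cring_OX by (simp add: OX_eq)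
  from freshmans_dream_subring [OF prime_p B B_closed(5) [OF assms(1,2)] assms(3)]
  obtain u where u: "u \<in> B" "(x + y + z) ^ p = (x + y) ^ p + z ^ p + of_nat p * u" ..
  from freshmans_dream_subring [OF prime_p B assms(1,2)]
  obtain v where v: "v \<in> B" "(x + y) ^ p = x ^ p + y ^ p + of_nat p * v" ..
  have "u + v \<in> B" using u(1) v(1) by (rule B_closed(5))
  show ?thesis
    by (rule bexI [OF _ \<open>u + v \<in> B\<close>]) (simp only: u(2) v(2), simp add: algebra_simps)
qed

end

section \<open>Construction of the Frobenius lift from its value on x3\<close>

locale level_sets_frobenius = level_sets +
  fixes \<sigma> \<delta> :: "'a \<Rightarrow> 'a"
  assumes \<sigma>: "type_hom \<sigma>" and \<sigma>_eq: "\<sigma> b = b ^ p + of_nat p * \<delta> b"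
begin

text \<open>Here w1 and w2 are the intended squares of \<phi> x1 and \<phi> x2. The conditions on
  \<phi> H1 and \<phi> H2 are linear in them with determinant \<sigma> a1 - \<sigma> a2, a unit.
  Modulo p they are solved by x1^(2 p) and x2^(2 p), so that the solution differs from these by p e1
  and p e2.\<close>

lemma frob_squares:
  obtains w1 w2 e1 e2 where "w1 \<in> B" "w2 \<in> B" "e1 \<in> B" "e2 \<in> B"
    "w1 = fr x1 ^ p * fr x1 ^ p + of_nat p * e1" "w2 = fr x2 ^ p * fr x2 ^ p + of_nat p * e2"
    "fr (cst (\<sigma> (a 1))) * w1 + fr (cst (\<sigma> (a 2))) * w2 + fr (cst (\<sigma> (a 3))) * (frob_x3 * frob_x3) = fr (H1 a) ^ p"
    "w1 + w2 + frob_x3 * frob_x3 = fr H2 ^ p"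
proof -
  let ?b = "\<lambda>i. fr (cst (\<sigma> (a i)))" and ?d = "\<lambda>i. fr (cst (\<delta> (a i)))"
  let ?X1 = "fr x1 ^ p * fr x1 ^ p" and ?X2 = "fr x2 ^ p * fr x2 ^ p" and ?X3 = "fr x3 ^ p * fr x3 ^ p"
  have b: "?b i = fr (cst (a i)) ^ p + of_nat p * ?d i" for i
    by (simp add: \<sigma>_eq cst_simps fr_simps type_hom_of_nat [OF type_hom_cst] type_hom_of_nat [OF type_hom_fr])
  \<comment> \<open>The homomorphism \<sigma> carries the inverse of a1 - a2 to an inverse of the
    determinant.\<close>
  obtain v where v: "(\<sigma> (a 1) - \<sigma> (a 2)) * v = 1"
  proof -
    obtain v where "(a 1 - a 2) * v = 1" using differences_dvd_1(1) by (metis dvdE)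
    then have "\<sigma> ((a 1 - a 2) * v) = \<sigma> 1" by simp
    then show ?thesis using that [of "\<sigma> v"] by (simp add: type_hom_simps [OF \<sigma>])
  qed
  define V where "V = fr (cst v)"
  have V: "(?b 1 - ?b 2) * V = 1"
  proof -
    have "fr (cst ((\<sigma> (a 1) - \<sigma> (a 2)) * v)) = 1" by (simp only: v cst_simps fr_simps)
    then show ?thesis by (simp only: V_def cst_simps fr_simps)
  qed
  have VB: "V \<in> B" by (simp add: V_def)
  obtain z1 where z1: "z1 \<in> B" "fr (H1 a) ^ p = fr (cst (a 1)) ^ p * ?X1 + fr (cst (a 2)) ^ p * ?X2 + fr (cst (a 3)) ^ p * ?X3 + of_nat p * z1"
    using frobenius_sum3 [of "fr (cst (a 1) * x1 ^ 2)" "fr (cst (a 2) * x2 ^ 2)" "fr (cst (a 3) * x3 ^ 2)"]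
    by (auto simp: H1_def fr_simps power2_eq_square power_mult_distrib mult.assoc)
  obtain z2 where z2: "z2 \<in> B" "fr H2 ^ p = ?X1 + ?X2 + ?X3 + of_nat p * z2"
    using frobenius_sum3 [of "fr (x1 ^ 2)" "fr (x2 ^ 2)" "fr (x3 ^ 2)"]
    by (auto simp: H2_def fr_simps power2_eq_square power_mult_distrib)
  define z3 where "z3 = fr x3 ^ p * delta_x3 + delta_x3 * fr x3 ^ p + of_nat p * delta_x3 * delta_x3"
  have z3: "z3 \<in> B" "frob_x3 * frob_x3 = ?X3 + of_nat p * z3"
    unfolding z3_def frob_x3_def
    by (intro B_closed B_power B_of_nat delta_x3_B) (simp add: algebra_simps)
  \<comment> \<open>Subtracting \<sigma> a2 times the second equation from the first eliminates w2;
    dividing by p and then by \<sigma> a1 - \<sigma> a2 gives e1.\<close>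
  define e1 where "e1 = V * (z1 - (?d 1 * ?X1 + ?d 2 * ?X2 + ?d 3 * ?X3) - ?b 2 * z2 - (?b 3 - ?b 2) * z3)"
  define w1 where "w1 = ?X1 + of_nat p * e1"
  define e2 where "e2 = z2 - z3 - e1"
  define w2 where "w2 = ?X2 + of_nat p * e2"
  have e1: "e1 \<in> B" unfolding e1_def using VB z1 z2 z3 by (intro B_closed B_diff) auto
  have e2: "e2 \<in> B" unfolding e2_def using e1 z2 z3 by (intro B_diff)
  have sum2: "w1 + w2 + frob_x3 * frob_x3 = fr H2 ^ p"
    unfolding w1_def w2_def e2_def z3(2) z2(2) by (simp add: algebra_simps)
  have "(?b 1 - ?b 2) * w1 = (?b 1 - ?b 2) * ?X1 + of_nat p * (((?b 1 - ?b 2) * V) *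
      (z1 - (?d 1 * ?X1 + ?d 2 * ?X2 + ?d 3 * ?X3) - ?b 2 * z2 - (?b 3 - ?b 2) * z3))"
    unfolding w1_def e1_def by (simp only: ring_distribs ac_simps)
  also have "\<dots> = fr (H1 a) ^ p - ?b 2 * fr H2 ^ p - (?b 3 - ?b 2) * (frob_x3 * frob_x3)"
    unfolding V unfolding z1(2) z2(2) z3(2) b by (simp add: algebra_simps)
  finally have "(?b 1 - ?b 2) * w1 = fr (H1 a) ^ p - ?b 2 * fr H2 ^ p - (?b 3 - ?b 2) * (frob_x3 * frob_x3)" .
  then have "?b 1 * w1 + ?b 2 * w2 + ?b 3 * (frob_x3 * frob_x3) = fr (H1 a) ^ p"
    unfolding sum2 [symmetric] by (simp only: ring_distribs) (simp add: algebra_simps)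
  then show thesis
    using that [of w1 w2 e1 e2] sum2 e1 e2 by (simp add: w1_def w2_def)
qed

end

context level_sets_frobenius
begin

lemma \<sigma>_hom: "(\<lambda>b. emb_X (fr (cst (\<sigma> b)))) \<in> ring_hom (type_ring UNIV) (OX_hat p a)"
  using \<sigma>
  by (intro ring_hom_memI)
    (simp_all add: emb_X_closed type_hom_simps cst_simps fr_simps emb_X_add emb_X_mult emb_X_one)

lemma frob_coordinates:
  obtains y1 y2 where "y1 \<in> carrier (OX_hat p a)" "y2 \<in> carrier (OX_hat p a)"
    "congruent_mod p (OX_hat p a) y1 (emb_X (fr x1 ^ p))"
    "congruent_mod p (OX_hat p a) y2 (emb_X (fr x2 ^ p))"
    "emb_X (fr (cst (\<sigma> (a 1)))) \<otimes>\<^bsub>OX_hat p a\<^esub> (y1 \<otimes>\<^bsub>OX_hat p a\<^esub> y1) \<oplus>\<^bsub>OX_hat p a\<^esub>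
     emb_X (fr (cst (\<sigma> (a 2)))) \<otimes>\<^bsub>OX_hat p a\<^esub> (y2 \<otimes>\<^bsub>OX_hat p a\<^esub> y2) \<oplus>\<^bsub>OX_hat p a\<^esub>
     emb_X (fr (cst (\<sigma> (a 3)))) \<otimes>\<^bsub>OX_hat p a\<^esub> (emb_X frob_x3 \<otimes>\<^bsub>OX_hat p a\<^esub> emb_X frob_x3) =
     emb_X (fr (H1 a) ^ p)"
    "y1 \<otimes>\<^bsub>OX_hat p a\<^esub> y1 \<oplus>\<^bsub>OX_hat p a\<^esub> y2 \<otimes>\<^bsub>OX_hat p a\<^esub> y2 \<oplus>\<^bsub>OX_hat p a\<^esub>
     emb_X frob_x3 \<otimes>\<^bsub>OX_hat p a\<^esub> emb_X frob_x3 = emb_X (fr H2 ^ p)"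
proof -
  obtain w1 w2 e1 e2 where w: "w1 \<in> B" "w2 \<in> B" "e1 \<in> B" "e2 \<in> B"
    "w1 = fr x1 ^ p * fr x1 ^ p + of_nat p * e1" "w2 = fr x2 ^ p * fr x2 ^ p + of_nat p * e2"
    "fr (cst (\<sigma> (a 1))) * w1 + fr (cst (\<sigma> (a 2))) * w2 + fr (cst (\<sigma> (a 3))) * (frob_x3 * frob_x3) = fr (H1 a) ^ p"
    "w1 + w2 + frob_x3 * frob_x3 = fr H2 ^ p"
    by (rule frob_squares)
  have sqrt: "\<exists>y\<in>carrier (OX_hat p a). y \<otimes>\<^bsub>OX_hat p a\<^esub> y = emb_X w \<and> congruent_mod p (OX_hat p a) y (emb_X (fr x ^ p))"
    if x: "x * g = Qpoly p a" and e: "e \<in> B" and wB: "w \<in> B" and w: "w = fr x ^ p * fr x ^ p + of_nat p * e" for x g e w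
  proof -
    let ?g = "Fract g (Qpoly p a)"
    \<comment> \<open>The inverse of 2 x^p, required by Hensel's lemma at the approximate root
      x^p.\<close>
    let ?v = "fr (cst (nat_inverse 2)) * ?g ^ p"
    have g: "?g \<in> B" "fr x * ?g = 1" using B_divisor [OF x] by simp_all
    have "(fr x ^ p + fr x ^ p) * ?v = (2 * fr (cst (nat_inverse 2))) * (fr x * ?g) ^ p"
      by (simp add: power_mult_distrib algebra_simps)
    also have "\<dots> = 1" unfolding fr_half g by simp
    finally have "emb_X ((fr x ^ p + fr x ^ p) * ?v) = \<one>\<^bsub>OX_hat p a\<^esub>" by (simp add: emb_X_one)
    then have v: "(emb_X (fr x ^ p) \<oplus>\<^bsub>OX_hat p a\<^esub> emb_X (fr x ^ p)) \<otimes>\<^bsub>OX_hat p a\<^esub> emb_X ?v = \<one>\<^bsub>OX_hat p a\<^esub>"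
      using g(1) by (simp only: emb_X_mult [of "fr x ^ p + fr x ^ p" ?v] emb_X_add [of "fr x ^ p" "fr x ^ p"]
          B_closed B_power)
    have "congruent_mod p (OX_hat p a) (emb_X w) (emb_X (fr x ^ p * fr x ^ p))"
      using e w by (intro emb_X_congruent [of _ e]) simp_all
    then have "congruent_mod p (OX_hat p a) (emb_X w) (emb_X (fr x ^ p) \<otimes>\<^bsub>OX_hat p a\<^esub> emb_X (fr x ^ p))"
      by (simp add: emb_X_mult)
    then show ?thesis
      using X.S.square_root [OF _ _ v, of "emb_X w"] wB g(1) by (metis emb_X_closed B_closed(1,6) B_power)
  qed
  have Q: "x1 * (x2 * at_H a (Npoly a) * at_H a (hasse p a)) = Qpoly p a"
    "x2 * (x1 * at_H a (Npoly a) * at_H a (hasse p a)) = Qpoly p a"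
    by (simp_all add: Qpoly_def algebra_simps)
  obtain y1 where y1: "y1 \<in> carrier (OX_hat p a)" "y1 \<otimes>\<^bsub>OX_hat p a\<^esub> y1 = emb_X w1"
      "congruent_mod p (OX_hat p a) y1 (emb_X (fr x1 ^ p))"
    using sqrt [OF Q(1) w(3) w(1) w(5)] by blast
  obtain y2 where y2: "y2 \<in> carrier (OX_hat p a)" "y2 \<otimes>\<^bsub>OX_hat p a\<^esub> y2 = emb_X w2"
      "congruent_mod p (OX_hat p a) y2 (emb_X (fr x2 ^ p))"
    using sqrt [OF Q(2) w(4) w(2) w(6)] by blast
  show thesis
    by (rule that [OF y1(1) y2(1) y1(3) y2(3)])
      (simp_all add: y1(2) y2(2) w(1,2) frob_x3_B w(7,8) [symmetric] emb_X_add emb_X_mult)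
qed

text \<open>The lift is determined on A[x1, x2, x3] by its values on the coordinates, then extended
  to O(X) by localization and to the completion by continuity. The p-th power congruence holds on
  generators and is preserved modulo p by sums and products, so it holds on all polynomials; this
  also makes \<psi> Q a unit, as the localization requires.\<close>

lemma exists_frobenius_lift:
  obtains \<phi> where "\<phi> \<in> ring_hom (OX_hat p a) (OX_hat p a)"
    "\<And>s. s \<in> carrier (OX_hat p a) \<Longrightarrow> congruent_mod p (OX_hat p a) (\<phi> s) (s [^]\<^bsub>OX_hat p a\<^esub> p)"
    "\<And>b. \<phi> (emb_X (fr (cst b))) = emb_X (fr (cst (\<sigma> b)))"
    "\<phi> (emb_X (fr x3)) = emb_X frob_x3"
    "\<phi> (emb_X (fr (H1 a))) = emb_X (fr (H1 a) ^ p)" "\<phi> (emb_X (fr H2)) = emb_X (fr H2 ^ p)"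
proof -
  let ?S = "OX_hat p a"
  obtain y1 y2 where y: "y1 \<in> carrier (OX_hat p a)" "y2 \<in> carrier (OX_hat p a)"
    and cong: "congruent_mod p (OX_hat p a) y1 (emb_X (fr x1 ^ p))"
      "congruent_mod p (OX_hat p a) y2 (emb_X (fr x2 ^ p))"
    and H: "emb_X (fr (cst (\<sigma> (a 1)))) \<otimes>\<^bsub>OX_hat p a\<^esub> (y1 \<otimes>\<^bsub>OX_hat p a\<^esub> y1) \<oplus>\<^bsub>OX_hat p a\<^esub>
     emb_X (fr (cst (\<sigma> (a 2)))) \<otimes>\<^bsub>OX_hat p a\<^esub> (y2 \<otimes>\<^bsub>OX_hat p a\<^esub> y2) \<oplus>\<^bsub>OX_hat p a\<^esub>
     emb_X (fr (cst (\<sigma> (a 3)))) \<otimes>\<^bsub>OX_hat p a\<^esub> (emb_X frob_x3 \<otimes>\<^bsub>OX_hat p a\<^esub> emb_X frob_x3) =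
     emb_X (fr (H1 a) ^ p)"
    "y1 \<otimes>\<^bsub>OX_hat p a\<^esub> y1 \<oplus>\<^bsub>OX_hat p a\<^esub> y2 \<otimes>\<^bsub>OX_hat p a\<^esub> y2 \<oplus>\<^bsub>OX_hat p a\<^esub>
     emb_X frob_x3 \<otimes>\<^bsub>OX_hat p a\<^esub> emb_X frob_x3 = emb_X (fr H2 ^ p)"
    by (rule frob_coordinates)
  have y3: "emb_X frob_x3 \<in> carrier ?S" by (simp add: emb_X_closed frob_x3_B)
  obtain \<psi> where \<psi>: "\<psi> \<in> ring_hom (type_ring UNIV) ?S"
    and \<psi>_gens: "\<And>c. \<psi> (cst c) = emb_X (fr (cst (\<sigma> c)))" "\<psi> x1 = y1" "\<psi> x2 = y2" "\<psi> x3 = emb_X frob_x3"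
    by (rule extend_hom_poly3 [OF X.S.cring_axioms \<sigma>_hom y y3]) blast
  have \<psi>_closed [simp]: "\<psi> f \<in> carrier ?S" for f
    using ring_hom_closed [OF \<psi>] by simp
  have \<psi>_add: "\<psi> (f + g) = \<psi> f \<oplus>\<^bsub>?S\<^esub> \<psi> g" and \<psi>_mult: "\<psi> (f * g) = \<psi> f \<otimes>\<^bsub>?S\<^esub> \<psi> g" for f g
    using ring_hom_add [OF \<psi>] ring_hom_mult [OF \<psi>] by simp_all
  have \<psi>_one: "\<psi> 1 = \<one>\<^bsub>?S\<^esub>" using ring_hom_one [OF \<psi>] by simp
  have emb_pow: "emb_X (fr f ^ n) \<in> carrier ?S" for f n by (simp add: emb_X_closed)
  have \<psi>_frob: "congruent_mod p ?S (\<psi> f) (emb_X (fr f ^ p))" for f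
  proof (induction f rule: poly3_induct)
    case (cst c)
    have "fr (cst (\<sigma> c)) = fr (cst c) ^ p + of_nat p * fr (cst (\<delta> c))"
      by (simp add: \<sigma>_eq cst_simps fr_simps type_hom_of_nat [OF type_hom_cst] type_hom_of_nat [OF type_hom_fr])
    then show ?case
      unfolding \<psi>_gens by (intro emb_X_congruent [of _ "fr (cst (\<delta> c))"]) simp_all
  next
    case x3
    show ?case unfolding \<psi>_gens
      by (rule emb_X_congruent [OF _ delta_x3_B]) (simp_all add: frob_x3_def)
  next
    case (add f g)
    have B: "cring (type_ring B)" using cring_OX by (simp add: OX_eq)
    obtain z where z: "z \<in> B" "(fr f + fr g) ^ p = fr f ^ p + fr g ^ p + of_nat p * z"
      using freshmans_dream_subring [OF prime_p B, of "fr f" "fr g"] by auto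
    then have "congruent_mod p ?S (emb_X (fr (f + g) ^ p)) (emb_X (fr f ^ p + fr g ^ p))"
      by (intro emb_X_congruent [OF _ z(1)]) (simp_all add: fr_simps)
    then have "congruent_mod p ?S (emb_X (fr f ^ p + fr g ^ p)) (emb_X (fr (f + g) ^ p))"
      by (rule X.S.congruent_sym) (simp_all add: emb_X_closed)
    moreover have "congruent_mod p ?S (\<psi> (f + g)) (emb_X (fr f ^ p + fr g ^ p))"
      using add by (simp add: \<psi>_add emb_X_add X.S.congruent_add emb_pow)
    ultimately show ?case
      by (simp add: X.S.congruent_trans [of _ _ "emb_X (fr f ^ p + fr g ^ p)"] emb_X_closed)
  next
    case (mult f g)
    then show ?case
      by (simp add: \<psi>_mult fr_simps power_mult_distrib emb_X_mult X.S.congruent_mult emb_pow)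
  qed (simp_all add: \<psi>_gens cong)
  have unit: "\<psi> (Qpoly p a) \<in> Units ?S"
  proof (rule X.S.unit_of_congruent_unit)
    let ?g = "Fract 1 (Qpoly p a)"
    have g: "?g \<in> B" "fr (Qpoly p a) * ?g = 1" using B_divisor [of "Qpoly p a" 1] by simp_all
    have "emb_X (fr (Qpoly p a) ^ p) \<otimes>\<^bsub>?S\<^esub> emb_X (?g ^ p) = emb_X ((fr (Qpoly p a) * ?g) ^ p)"
      using g(1) by (simp add: emb_X_mult power_mult_distrib)
    then have "emb_X (fr (Qpoly p a) ^ p) \<otimes>\<^bsub>?S\<^esub> emb_X (?g ^ p) = \<one>\<^bsub>?S\<^esub>"
      by (simp add: g emb_X_one)
    moreover have "congruent_mod p ?S (\<psi> (Qpoly p a) \<otimes>\<^bsub>?S\<^esub> emb_X (?g ^ p))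
        (emb_X (fr (Qpoly p a) ^ p) \<otimes>\<^bsub>?S\<^esub> emb_X (?g ^ p))"
      using g by (intro X.S.congruent_mult \<psi>_frob X.S.congruent_refl) (simp_all add: emb_X_closed)
    ultimately show "congruent_mod p ?S (\<psi> (Qpoly p a) \<otimes>\<^bsub>?S\<^esub> emb_X (?g ^ p)) \<one>\<^bsub>?S\<^esub>" by simp
    show "emb_X (?g ^ p) \<in> carrier ?S" using g by (simp add: emb_X_closed)
  qed simp
  obtain \<Psi> where \<Psi>: "\<Psi> \<in> ring_hom (OX p a) ?S" "\<And>g. \<Psi> (fr g) = \<psi> g"
    unfolding OX_def
    by (rule extend_hom_localization [OF X.S.cring_axioms \<psi> Qpoly_nonzero unit]) blast
  have \<Psi>_closed: "\<Psi> b \<in> carrier ?S" if "b \<in> B" for b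
    using ring_hom_closed [OF \<Psi>(1)] that by (simp add: carrier_OX)
  have \<Psi>_mult: "\<Psi> (b * b') = \<Psi> b \<otimes>\<^bsub>?S\<^esub> \<Psi> b'" if "b \<in> B" "b' \<in> B" for b b'
    using ring_hom_mult [OF \<Psi>(1), of b b'] that by (simp add: OX_eq)
  have \<Psi>_frob: "congruent_mod p ?S (\<Psi> b) (emb_X (b ^ p))" if b: "b \<in> B" for b
  proof -
    obtain f n where f: "b = Fract f (Qpoly p a ^ n)" using b by (auto simp: B_def)
    define q where "q = Qpoly p a ^ n"
    have bq: "b * fr q = fr f"
      using Qpoly_nonzero by (simp add: f q_def mult_fract eq_fract)
    have uq: "\<psi> q \<in> Units ?S"
      unfolding q_def by (induction n) (simp_all add: \<psi>_one \<psi>_mult unit)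
    \<comment> \<open>The congruence is proved after multiplication by \<psi> q, where it concerns
      polynomials only, and the unit \<psi> q is cancelled afterwards.\<close>
    have "congruent_mod p ?S (\<Psi> b \<otimes>\<^bsub>?S\<^esub> \<psi> q) (emb_X (b ^ p) \<otimes>\<^bsub>?S\<^esub> emb_X (fr q ^ p))"
    proof -
      have "\<Psi> b \<otimes>\<^bsub>?S\<^esub> \<psi> q = \<psi> f"
        using \<Psi>_mult [OF b, of "fr q"] by (simp add: bq \<Psi>(2))
      moreover have "emb_X (b ^ p) \<otimes>\<^bsub>?S\<^esub> emb_X (fr q ^ p) = emb_X (fr f ^ p)"
        using b by (simp add: emb_X_mult [symmetric] power_mult_distrib [symmetric] bq)
      ultimately show ?thesis using \<psi>_frob by simp
    qed
    moreover have "congruent_mod p ?S (emb_X (b ^ p) \<otimes>\<^bsub>?S\<^esub> emb_X (fr q ^ p)) (emb_X (b ^ p) \<otimes>\<^bsub>?S\<^esub> \<psi> q)"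
      using b by (intro X.S.congruent_mult X.S.congruent_refl X.S.congruent_sym [OF \<psi>_frob]) (simp_all add: emb_X_closed)
    ultimately have "congruent_mod p ?S (\<Psi> b \<otimes>\<^bsub>?S\<^esub> \<psi> q) (emb_X (b ^ p) \<otimes>\<^bsub>?S\<^esub> \<psi> q)"
      by (rule X.S.congruent_trans) (simp_all add: b emb_X_closed \<Psi>_closed)
    then have "congruent_mod p ?S (\<Psi> b \<otimes>\<^bsub>?S\<^esub> \<psi> q \<otimes>\<^bsub>?S\<^esub> inv\<^bsub>?S\<^esub> \<psi> q) (emb_X (b ^ p) \<otimes>\<^bsub>?S\<^esub> \<psi> q \<otimes>\<^bsub>?S\<^esub> inv\<^bsub>?S\<^esub> \<psi> q)"
      by (rule X.S.congruent_mult [OF _ X.S.congruent_refl]) (simp_all add: b uq emb_X_closed \<Psi>_closed)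
    then show ?thesis
      using b uq by (simp add: X.S.m_assoc emb_X_closed \<Psi>_closed)
  qed
  \<comment> \<open>The embedding of O(X) into its completion reflects divisibility by p^n, so that
    every homomorphism on O(X) satisfies the continuity condition.\<close>
  obtain \<phi> where \<phi>: "\<phi> \<in> ring_hom ?S ?S" "\<And>r. r \<in> B \<Longrightarrow> \<phi> (emb_X r) = \<Psi> r"
  proof (rule X.extend_ring_hom [OF X.S.padic_ring_axioms \<Psi>(1)])
    fix r n assume r: "r \<in> carrier (OX p a)" "emb_X r \<in> multiples ?S (p ^ n)"
    then have "r \<in> multiples (OX p a) (p ^ n)"
      using X.C.emb_multiple_iff by (simp add: OX_hat_def)
    then show "\<Psi> r \<in> multiples ?S (p ^ n)"
      by (rule abelian_group_hom.hom_multiples [OF ring_hom_abelian_group_hom [OF \<Psi>(1) X.ring_axioms X.S.ring_axioms]])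
  qed (simp add: carrier_OX)
  have \<phi>_fr: "\<phi> (emb_X (fr f)) = \<psi> f" for f
    by (simp add: \<phi>(2) \<Psi>(2))
  interpret \<phi>: abelian_group_hom ?S ?S \<phi>
    by (rule ring_hom_abelian_group_hom [OF \<phi>(1) X.S.ring_axioms X.S.ring_axioms])
  show thesis
  proof
    show "\<phi> \<in> ring_hom ?S ?S" by fact
    fix s assume s: "s \<in> carrier ?S"
    obtain r where r: "r \<in> B" "congruent_mod p ?S s (emb_X r)"
      using X.dense [OF s, of 1] by (auto simp: carrier_OX)
    have "congruent_mod p ?S (\<phi> s) (\<Psi> r)"
      using \<phi>.hom_congruent [OF r(2) s] r(1) by (simp add: \<phi>(2) emb_X_closed)
    moreover have "congruent_mod p ?S (\<Psi> r) (emb_X r [^]\<^bsub>?S\<^esub> p)"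
      using \<Psi>_frob [OF r(1)] r(1) by (simp add: emb_X_power)
    moreover have "congruent_mod p ?S (emb_X r [^]\<^bsub>?S\<^esub> p) (s [^]\<^bsub>?S\<^esub> p)"
      using X.S.congruent_pow [OF X.S.congruent_sym [OF r(2)]] r(1) s by (simp add: emb_X_closed)
    moreover have "\<phi> s \<in> carrier ?S" "\<Psi> r \<in> carrier ?S" "emb_X r \<in> carrier ?S"
      using s r by (simp_all add: \<Psi>_closed emb_X_closed)
    ultimately show "congruent_mod p ?S (\<phi> s) (s [^]\<^bsub>?S\<^esub> p)"
      using s by (meson X.S.congruent_trans X.S.nat_pow_closed)
  next
    show "\<phi> (emb_X (fr (cst b))) = emb_X (fr (cst (\<sigma> b)))" for b
      by (simp add: \<phi>_fr \<psi>_gens)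
    show "\<phi> (emb_X (fr x3)) = emb_X frob_x3"
      by (simp add: \<phi>_fr \<psi>_gens)
    show "\<phi> (emb_X (fr (H1 a))) = emb_X (fr (H1 a) ^ p)"
      unfolding H(1) [symmetric] \<phi>_fr
      by (simp add: H1_def \<psi>_add \<psi>_mult \<psi>_gens power2_eq_square)
    show "\<phi> (emb_X (fr H2)) = emb_X (fr H2 ^ p)"
      unfolding H(2) [symmetric] \<phi>_fr
      by (simp add: H2_def \<psi>_add \<psi>_mult \<psi>_gens power2_eq_square)
  qed
qed

end

section \<open>Quotients of modules and Kaehler differentials\<close>

text \<open>If h maps N' into N, all members of a coset of N' have images in one coset of N, and the
  union that defines \<open>coset_map\<close> collapses to it.\<close>

lemma (in abelian_group) coset_map_eq:
  assumes M: "abelian_group M" and h: "abelian_group_hom G M h"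
    and N': "abelian_subgroup N' G" and N: "abelian_subgroup N M" and hN: "h ` N' \<subseteq> N" and x: "x \<in> carrier G"
  shows "coset_map M N h (N' +> x) = N +>\<^bsub>M\<^esub> h x"
proof -
  interpret h: abelian_group_hom G M h by fact
  interpret N': abelian_subgroup N' G by fact
  interpret N: abelian_subgroup N M by fact
  have "N +>\<^bsub>M\<^esub> h y = N +>\<^bsub>M\<^esub> h x" if y: "y \<in> N' +> x" for y
  proof -
    have yc: "y \<in> carrier G" using y N'.a_elemrcos_carrier [OF x] by simp
    have "y \<ominus> x \<in> N'" using y N'.a_rcos_module [OF x yc] by (simp add: a_minus_def)
    then have "h y \<ominus>\<^bsub>M\<^esub> h x \<in> N" using hN x yc by (auto simp: h.hom_diff [symmetric])
    then show ?thesis using x yc N.coset_eq_iff by simp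
  qed
  moreover have "x \<in> N' +> x" using x by (rule N'.a_rcos_self)
  ultimately show ?thesis unfolding coset_map_def by blast
qed

lemma (in abelian_group) completion_map_thread:
  assumes h: "abelian_group_hom G M h" and M: "abelian_group M" and x: "\<And>n. x n \<in> carrier G"
  shows "completion_map p M h (thread_of p G x) = thread_of p M (\<lambda>n. h (x n))"
proof -
  interpret h: abelian_group_hom G M h by fact
  show ?thesis
    unfolding completion_map_def thread_of_def
    using coset_map_eq [OF M h multiples_abelian_subgroup h.H.multiples_abelian_subgroup _ x] h.hom_multiples
    by blast
qed

section \<open>Submodules and quotient modules\<close>

context module
begin

lemma submodule_abelian_subgroup: "submodule N R M \<Longrightarrow> abelian_subgroup N M"
  by (rule abelian_subgroupI3)
    (simp_all add: submodule_def additive_subgroup_def M.abelian_group_axioms)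

lemma submodule_generated_subset:
  "\<lbrakk>submodule S R M; A \<subseteq> S\<rbrakk> \<Longrightarrow> submodule_generated R M A \<subseteq> S"
  by (auto simp: submodule_generated_def)

lemma submodule_generated_superset: "A \<subseteq> submodule_generated R M A"
  by (auto simp: submodule_generated_def)

lemma submodule_generated_submodule:
  assumes "A \<subseteq> carrier M"
  shows "submodule (submodule_generated R M A) R M"
proof (rule submoduleI)
  have zero: "\<zero>\<^bsub>M\<^esub> \<in> S" if "submodule S R M" for S
    using additive_subgroup.zero_closed [of S M] that by (simp add: submodule_def additive_subgroup_def)
  show "submodule_generated R M A \<subseteq> carrier M"
    using submodule_generated_subset [OF carrier_is_submodule assms] .
  show "\<zero>\<^bsub>M\<^esub> \<in> submodule_generated R M A"
    using zero by (auto simp: submodule_generated_def)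
  fix x assume x: "x \<in> submodule_generated R M A"
  show "\<ominus>\<^bsub>M\<^esub> x \<in> submodule_generated R M A"
    using x submoduleE(3) by (auto simp: submodule_generated_def)
  show "r \<odot>\<^bsub>M\<^esub> x \<in> submodule_generated R M A" if "r \<in> carrier R" for r
    using x that submoduleE(4) by (auto simp: submodule_generated_def)
  show "x \<oplus>\<^bsub>M\<^esub> y \<in> submodule_generated R M A" if "y \<in> submodule_generated R M A" for y
    using x that submoduleE(5) by (auto simp: submodule_generated_def)
qed

lemma smult_hom: "r \<in> carrier R \<Longrightarrow> abelian_group_hom M M (\<lambda>x. r \<odot>\<^bsub>M\<^esub> x)"
  by (rule abelian_group_homI') (simp_all add: M.abelian_group_axioms smult_r_distr)

context
  fixes N assumes N: "submodule N R M"
begin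

interpretation N: abelian_subgroup N M by (rule submodule_abelian_subgroup [OF N])

abbreviation (input) "Q \<equiv> quotient_module M N"

lemma quotient_carrier: "carrier Q = {N +>\<^bsub>M\<^esub> x | x. x \<in> carrier M}"
  by (auto simp: quotient_module_def A_RCOSETS_def RCOSETS_def a_r_coset_def)

lemma quotient_class_closed: "x \<in> carrier M \<Longrightarrow> N +>\<^bsub>M\<^esub> x \<in> carrier Q"
  by (auto simp: quotient_carrier)

lemma quotient_add:
  "\<lbrakk>x \<in> carrier M; y \<in> carrier M\<rbrakk> \<Longrightarrow> (N +>\<^bsub>M\<^esub> x) \<oplus>\<^bsub>Q\<^esub> (N +>\<^bsub>M\<^esub> y) = N +>\<^bsub>M\<^esub> (x \<oplus>\<^bsub>M\<^esub> y)"
  by (simp add: quotient_module_def N.a_rcos_sum)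

lemma quotient_zero: "\<zero>\<^bsub>Q\<^esub> = N +>\<^bsub>M\<^esub> \<zero>\<^bsub>M\<^esub>"
  using M.a_coset_add_zero [OF N.a_subset] by (simp add: quotient_module_def)

lemma quotient_smult:
  assumes "r \<in> carrier R" "x \<in> carrier M"
  shows "r \<odot>\<^bsub>Q\<^esub> (N +>\<^bsub>M\<^esub> x) = N +>\<^bsub>M\<^esub> (r \<odot>\<^bsub>M\<^esub> x)"
  using M.coset_map_eq [OF M.abelian_group_axioms smult_hom [OF assms(1)] N.abelian_subgroup_axioms
      N.abelian_subgroup_axioms _ assms(2)] submoduleE(4) [OF N assms(1)]
  by (auto simp: quotient_module_def)

lemma quotient_class_eq_iff:
  "\<lbrakk>x \<in> carrier M; y \<in> carrier M\<rbrakk> \<Longrightarrow> N +>\<^bsub>M\<^esub> x = N +>\<^bsub>M\<^esub> y \<longleftrightarrow> x \<ominus>\<^bsub>M\<^esub> y \<in> N"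
  by (rule N.coset_eq_iff)

lemma quotient_abelian_group: "abelian_group Q"
proof (rule abelian_groupI)
  fix U assume "U \<in> carrier Q"
  then obtain x where x: "x \<in> carrier M" "U = N +>\<^bsub>M\<^esub> x" by (auto simp: quotient_carrier)
  show "\<zero>\<^bsub>Q\<^esub> \<oplus>\<^bsub>Q\<^esub> U = U"
    using x by (simp add: quotient_zero quotient_add)
  show "\<exists>V\<in>carrier Q. V \<oplus>\<^bsub>Q\<^esub> U = \<zero>\<^bsub>Q\<^esub>"
    using x by (intro bexI [of _ "N +>\<^bsub>M\<^esub> (\<ominus>\<^bsub>M\<^esub> x)"])
      (simp_all add: quotient_zero quotient_add quotient_class_closed M.l_neg)
  fix V assume "V \<in> carrier Q"
  then obtain y where y: "y \<in> carrier M" "V = N +>\<^bsub>M\<^esub> y" by (auto simp: quotient_carrier)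
  show "U \<oplus>\<^bsub>Q\<^esub> V \<in> carrier Q"
    using x y by (simp add: quotient_add quotient_class_closed)
  show "U \<oplus>\<^bsub>Q\<^esub> V = V \<oplus>\<^bsub>Q\<^esub> U"
    using x y by (simp add: quotient_add M.a_comm)
  fix V' assume "V' \<in> carrier Q"
  then obtain z where z: "z \<in> carrier M" "V' = N +>\<^bsub>M\<^esub> z" by (auto simp: quotient_carrier)
  show "U \<oplus>\<^bsub>Q\<^esub> V \<oplus>\<^bsub>Q\<^esub> V' = U \<oplus>\<^bsub>Q\<^esub> (V \<oplus>\<^bsub>Q\<^esub> V')"
    using x y z by (simp add: quotient_add M.a_assoc)
next
  show "\<zero>\<^bsub>Q\<^esub> \<in> carrier Q"
    by (simp add: quotient_zero quotient_class_closed)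
qed

lemma quotient_module: "module R Q"
proof (rule moduleI [OF R.cring_axioms quotient_abelian_group])
  fix r U assume r: "r \<in> carrier R" and "U \<in> carrier Q"
  then obtain x where x: "x \<in> carrier M" "U = N +>\<^bsub>M\<^esub> x" by (auto simp: quotient_carrier)
  show "r \<odot>\<^bsub>Q\<^esub> U \<in> carrier Q"
    using r x by (simp add: quotient_smult quotient_class_closed)
  fix s assume s: "s \<in> carrier R"
  show "(r \<oplus> s) \<odot>\<^bsub>Q\<^esub> U = r \<odot>\<^bsub>Q\<^esub> U \<oplus>\<^bsub>Q\<^esub> s \<odot>\<^bsub>Q\<^esub> U"
    using r s x by (simp add: quotient_smult quotient_add smult_l_distr)
  show "(r \<otimes> s) \<odot>\<^bsub>Q\<^esub> U = r \<odot>\<^bsub>Q\<^esub> (s \<odot>\<^bsub>Q\<^esub> U)"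
    using r s x by (simp add: quotient_smult smult_assoc1)
next
  fix r U V assume r: "r \<in> carrier R" and "U \<in> carrier Q" "V \<in> carrier Q"
  then obtain x y where "x \<in> carrier M" "U = N +>\<^bsub>M\<^esub> x" "y \<in> carrier M" "V = N +>\<^bsub>M\<^esub> y"
    by (auto simp: quotient_carrier)
  then show "r \<odot>\<^bsub>Q\<^esub> (U \<oplus>\<^bsub>Q\<^esub> V) = r \<odot>\<^bsub>Q\<^esub> U \<oplus>\<^bsub>Q\<^esub> r \<odot>\<^bsub>Q\<^esub> V"
    using r by (simp add: quotient_smult quotient_add smult_r_distr)
next
  fix U assume "U \<in> carrier Q"
  then show "\<one> \<odot>\<^bsub>Q\<^esub> U = U"
    by (auto simp: quotient_carrier quotient_smult)
qed

lemma quotient_induced_hom: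
  assumes h: "abelian_group_hom M H h" and hN: "\<And>x. x \<in> N \<Longrightarrow> h x = \<zero>\<^bsub>H\<^esub>"
  obtains g where "abelian_group_hom Q H g" "\<And>x. x \<in> carrier M \<Longrightarrow> g (N +>\<^bsub>M\<^esub> x) = h x"
proof -
  interpret h: abelian_group_hom M H h by fact
  define g where "g U = h (SOME x. x \<in> carrier M \<and> U = N +>\<^bsub>M\<^esub> x)" for U
  have g: "g (N +>\<^bsub>M\<^esub> x) = h x" if x: "x \<in> carrier M" for x
  proof -
    define y where "y = (SOME y. y \<in> carrier M \<and> N +>\<^bsub>M\<^esub> x = N +>\<^bsub>M\<^esub> y)"
    have y: "y \<in> carrier M" "N +>\<^bsub>M\<^esub> x = N +>\<^bsub>M\<^esub> y"
      using someI [of "\<lambda>y. y \<in> carrier M \<and> N +>\<^bsub>M\<^esub> x = N +>\<^bsub>M\<^esub> y" x] x by (simp_all add: y_def)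
    then have "h (x \<ominus>\<^bsub>M\<^esub> y) = \<zero>\<^bsub>H\<^esub>" using x by (simp add: quotient_class_eq_iff hN)
    then have "h x = h y" using x y(1) by (simp add: h.hom_diff h.H.diff_zero_imp_eq)
    then show ?thesis by (simp add: g_def y_def)
  qed
  have "abelian_group_hom Q H g"
  proof (rule abelian_group_homI' [OF quotient_abelian_group h.H.abelian_group_axioms])
    fix U assume "U \<in> carrier Q"
    then obtain x where x: "x \<in> carrier M" "U = N +>\<^bsub>M\<^esub> x" by (auto simp: quotient_carrier)
    then show "g U \<in> carrier H" by (simp add: g)
    fix V assume "V \<in> carrier Q"
    then obtain y where "y \<in> carrier M" "V = N +>\<^bsub>M\<^esub> y" by (auto simp: quotient_carrier)
    with x show "g (U \<oplus>\<^bsub>Q\<^esub> V) = g U \<oplus>\<^bsub>H\<^esub> g V"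
      by (simp add: quotient_add g)
  qed
  with g show thesis using that by blast
qed

end

end

section \<open>Free modules and semilinear forms\<close>

context cring
begin

lemma free_module_carrier_iff:
  "f \<in> carrier (free_module R I) \<longleftrightarrow>
    (\<forall>i\<in>I. f i \<in> carrier R) \<and> (\<forall>i. i \<notin> I \<longrightarrow> f i = \<zero>) \<and> finite {i. f i \<noteq> \<zero>}"
  by (simp add: free_module_def)

lemma free_module_app: "f \<in> carrier (free_module R I) \<Longrightarrow> f i \<in> carrier R"
  by (cases "i \<in> I") (auto simp: free_module_carrier_iff)

lemma free_module_simps:
  "f \<oplus>\<^bsub>free_module R I\<^esub> g = (\<lambda>i. f i \<oplus> g i)" "\<zero>\<^bsub>free_module R I\<^esub> = (\<lambda>i. \<zero>)"
  "r \<odot>\<^bsub>free_module R I\<^esub> f = (\<lambda>i. r \<otimes> f i)"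
  by (simp_all add: free_module_def)

lemma free_module_module: "module R (free_module R I)"
proof (rule moduleI [OF cring_axioms])
  let ?F = "free_module R I"
  have add: "f \<oplus>\<^bsub>?F\<^esub> g \<in> carrier ?F" if f: "f \<in> carrier ?F" and g: "g \<in> carrier ?F" for f g
  proof -
    have "{i. f i \<oplus> g i \<noteq> \<zero>} \<subseteq> {i. f i \<noteq> \<zero>} \<union> {i. g i \<noteq> \<zero>}" by auto
    then show ?thesis
      using f g unfolding free_module_carrier_iff free_module_simps by (auto intro: finite_subset)
  qed
  have smult: "r \<odot>\<^bsub>?F\<^esub> f \<in> carrier ?F" if r: "r \<in> carrier R" and f: "f \<in> carrier ?F" for r f
  proof -
    have "{i. r \<otimes> f i \<noteq> \<zero>} \<subseteq> {i. f i \<noteq> \<zero>}" using r by auto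
    then show ?thesis
      using r f unfolding free_module_carrier_iff free_module_simps by (auto intro: finite_subset)
  qed
  show "abelian_group ?F"
  proof (rule abelian_groupI)
    show "\<zero>\<^bsub>?F\<^esub> \<in> carrier ?F" by (simp add: free_module_carrier_iff free_module_simps)
    fix f assume f: "f \<in> carrier ?F"
    note fc = free_module_app [OF f]
    show "\<zero>\<^bsub>?F\<^esub> \<oplus>\<^bsub>?F\<^esub> f = f" by (simp add: free_module_simps fc)
    show "\<exists>g\<in>carrier ?F. g \<oplus>\<^bsub>?F\<^esub> f = \<zero>\<^bsub>?F\<^esub>"
    proof (rule bexI [of _ "(\<ominus> \<one>) \<odot>\<^bsub>?F\<^esub> f"])
      show "(\<ominus> \<one>) \<odot>\<^bsub>?F\<^esub> f \<oplus>\<^bsub>?F\<^esub> f = \<zero>\<^bsub>?F\<^esub>"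
        by (simp add: free_module_simps fc l_minus l_neg)
    qed (simp add: smult f)
    fix g assume g: "g \<in> carrier ?F"
    show "f \<oplus>\<^bsub>?F\<^esub> g \<in> carrier ?F" using f g by (rule add)
    show "f \<oplus>\<^bsub>?F\<^esub> g = g \<oplus>\<^bsub>?F\<^esub> f"
      using free_module_app [OF g] fc by (simp add: free_module_simps a_comm)
    fix h assume h: "h \<in> carrier ?F"
    show "f \<oplus>\<^bsub>?F\<^esub> g \<oplus>\<^bsub>?F\<^esub> h = f \<oplus>\<^bsub>?F\<^esub> (g \<oplus>\<^bsub>?F\<^esub> h)"
      using free_module_app [OF g] free_module_app [OF h] fc by (simp add: free_module_simps a_assoc)
  qed
qed (auto simp: free_module_simps free_module_app l_distr r_distr m_assoc free_module_carrier_iff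
    intro: rev_finite_subset)

lemma basis_symbol_closed: "i \<in> I \<Longrightarrow> basis_symbol R i \<in> carrier (free_module R I)"
  by (auto simp: free_module_carrier_iff basis_symbol_def intro: rev_finite_subset [of "{i}"])

lemma free_module_induct [consumes 1, case_names zero add smult basis]:
  assumes f: "f \<in> carrier (free_module R I)"
    and zero: "P \<zero>\<^bsub>free_module R I\<^esub>"
    and add: "\<And>f g. \<lbrakk>f \<in> carrier (free_module R I); g \<in> carrier (free_module R I); P f; P g\<rbrakk> \<Longrightarrow> P (f \<oplus>\<^bsub>free_module R I\<^esub> g)"
    and smult: "\<And>r f. \<lbrakk>r \<in> carrier R; f \<in> carrier (free_module R I); P f\<rbrakk> \<Longrightarrow> P (r \<odot>\<^bsub>free_module R I\<^esub> f)"
    and basis: "\<And>i. i \<in> I \<Longrightarrow> P (basis_symbol R i)"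
  shows "P f"
proof -
  interpret F: module R "free_module R I" by (rule free_module_module)
  \<comment> \<open>The induction runs over a finite set containing the support, so that removing
    one coordinate of f needs no exact control of the support.\<close>
  have main: "\<lbrakk>finite A; f \<in> carrier (free_module R I); {i. f i \<noteq> \<zero>} \<subseteq> A\<rbrakk> \<Longrightarrow> P f" for A f
  proof (induction A arbitrary: f rule: finite_induct)
    case empty
    then have "f = \<zero>\<^bsub>free_module R I\<^esub>" by (auto simp: free_module_simps)
    then show ?case using zero by simp
  next
    case (insert i A)
    show ?case
    proof (cases "f i = \<zero>")
      case True
      then have "{j. f j \<noteq> \<zero>} \<subseteq> A" using insert.prems(2) by auto
      with insert show ?thesis by simp
    next
      case False
      note fc = free_module_app [OF insert.prems(1)]
      have i: "i \<in> I" using False insert.prems(1) by (auto simp: free_module_carrier_iff)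
      let ?g = "f(i := \<zero>)"
      have "{j. ?g j \<noteq> \<zero>} \<subseteq> {j. f j \<noteq> \<zero>}" by auto
      then have g: "?g \<in> carrier (free_module R I)"
        using insert.prems(1) unfolding free_module_carrier_iff by (auto intro: finite_subset)
      have f_eq: "f = ?g \<oplus>\<^bsub>free_module R I\<^esub> (f i \<odot>\<^bsub>free_module R I\<^esub> basis_symbol R i)"
        using fc by (auto simp: free_module_simps basis_symbol_def)
      have "P ?g"
        using insert.prems(2) by (intro insert.IH g) auto
      moreover have "P (f i \<odot>\<^bsub>free_module R I\<^esub> basis_symbol R i)"
        by (intro smult fc basis_symbol_closed basis i)
      ultimately have "P (?g \<oplus>\<^bsub>free_module R I\<^esub> (f i \<odot>\<^bsub>free_module R I\<^esub> basis_symbol R i))"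
        by (rule add [OF g F.smult_closed [OF fc basis_symbol_closed [OF i]]])
      then show ?thesis
        by (rule ssubst [where P = P, OF f_eq])
    qed
  qed
  have "finite {i. f i \<noteq> \<zero>}" using f by (simp add: free_module_carrier_iff)
  then show ?thesis using f by (rule main) simp
qed

lemma free_module_support: "\<lbrakk>f \<in> carrier (free_module R I); f i \<noteq> \<zero>\<rbrakk> \<Longrightarrow> i \<in> I"
  by (auto simp: free_module_carrier_iff)

text \<open>The \<phi>-semilinear map on the free module that sends the symbol of g to w g. With
  \<phi> the identity and w a derivation it gives linear forms on differentials; with w the
  indicator of a fibre of \<phi> it gives the coordinates of \<open>free_pullback\<close>.\<close>

definition semilinear_form :: "('a \<Rightarrow> 'a) \<Rightarrow> ('a \<Rightarrow> 'a) \<Rightarrow> ('a \<Rightarrow> 'a) \<Rightarrow> 'a" where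
  "semilinear_form \<phi> w f = (\<Oplus>g\<in>{g \<in> carrier R. f g \<noteq> \<zero>}. \<phi> (f g) \<otimes> w g)"

context
  fixes \<phi> w assumes \<phi>: "\<phi> \<in> ring_hom R R" and w: "w \<in> carrier R \<rightarrow> carrier R"
begin

text \<open>Supports can shrink under addition and scaling, hence the sums are compared over a
  common finite set containing them.\<close>

lemma semilinear_form_superset:
  assumes f: "f \<in> carrier (free_module R (carrier R))"
    and A: "finite A" "{g. f g \<noteq> \<zero>} \<subseteq> A" "A \<subseteq> carrier R"
  shows "semilinear_form \<phi> w f = (\<Oplus>g\<in>A. \<phi> (f g) \<otimes> w g)"
  unfolding semilinear_form_def
proof (rule add.finprod_mono_neutral_cong_left [OF A(1)])
  note fc = free_module_app [OF f]
  show "\<phi> (f g) \<otimes> w g = \<zero>" if "g \<in> A - {g \<in> carrier R. f g \<noteq> \<zero>}" for g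
  proof -
    have "f g = \<zero>" using that A by auto
    then show ?thesis
      using that A(3) funcset_mem [OF w, of g] ring_hom_zero [OF \<phi> ring_axioms ring_axioms] by auto
  qed
  show "(\<lambda>g. \<phi> (f g) \<otimes> w g) \<in> A \<rightarrow> carrier R"
    using fc A(3) funcset_mem [OF w] ring_hom_closed [OF \<phi>] by auto
qed (use A in auto)

lemma semilinear_form_closed:
  assumes f: "f \<in> carrier (free_module R (carrier R))"
  shows "semilinear_form \<phi> w f \<in> carrier R"
  unfolding semilinear_form_def
  using free_module_app [OF f] funcset_mem [OF w] ring_hom_closed [OF \<phi>] by (intro finsum_closed) auto

lemma semilinear_form_add:
  assumes f: "f \<in> carrier (free_module R (carrier R))" and f': "f' \<in> carrier (free_module R (carrier R))"
  shows "semilinear_form \<phi> w (f \<oplus>\<^bsub>free_module R (carrier R)\<^esub> f') =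
    semilinear_form \<phi> w f \<oplus> semilinear_form \<phi> w f'"
proof -
  interpret F: module R "free_module R (carrier R)" by (rule free_module_module)
  note fc = free_module_app [OF f] free_module_app [OF f'] free_module_support [OF f]
    free_module_support [OF f']
  let ?A = "{g. f g \<noteq> \<zero>} \<union> {g. f' g \<noteq> \<zero>}"
  have A: "finite ?A" "?A \<subseteq> carrier R" using f f' by (auto simp: free_module_carrier_iff)
  have closed: "(\<lambda>g. \<phi> (f g) \<otimes> w g) \<in> ?A \<rightarrow> carrier R" "(\<lambda>g. \<phi> (f' g) \<otimes> w g) \<in> ?A \<rightarrow> carrier R"
    using fc funcset_mem [OF w] ring_hom_closed [OF \<phi>] by auto
  have "semilinear_form \<phi> w (f \<oplus>\<^bsub>free_module R (carrier R)\<^esub> f') =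
      (\<Oplus>g\<in>?A. \<phi> (f g \<oplus> f' g) \<otimes> w g)"
    using F.M.a_closed [OF f f'] A
    by (subst semilinear_form_superset [OF _ A(1)]) (auto simp: free_module_simps)
  also have "\<dots> = (\<Oplus>g\<in>?A. \<phi> (f g) \<otimes> w g \<oplus> \<phi> (f' g) \<otimes> w g)"
    using fc funcset_mem [OF w] ring_hom_closed [OF \<phi>]
    by (intro finsum_cong') (auto simp: ring_hom_add [OF \<phi>] l_distr)
  also have "\<dots> = semilinear_form \<phi> w f \<oplus> semilinear_form \<phi> w f'"
    using f f' A closed by (simp add: finsum_addf semilinear_form_superset [OF _ A(1)])
  finally show ?thesis .
qed

lemma semilinear_form_smult:
  assumes r: "r \<in> carrier R" and f: "f \<in> carrier (free_module R (carrier R))"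
  shows "semilinear_form \<phi> w (r \<odot>\<^bsub>free_module R (carrier R)\<^esub> f) = \<phi> r \<otimes> semilinear_form \<phi> w f"
proof -
  interpret F: module R "free_module R (carrier R)" by (rule free_module_module)
  note fc = free_module_app [OF f] free_module_support [OF f]
  let ?A = "{g. f g \<noteq> \<zero>}"
  have A: "finite ?A" "?A \<subseteq> carrier R" using f by (auto simp: free_module_carrier_iff)
  have closed: "(\<lambda>g. \<phi> (f g) \<otimes> w g) \<in> ?A \<rightarrow> carrier R" "\<phi> r \<in> carrier R"
    using fc funcset_mem [OF w] r ring_hom_closed [OF \<phi>] by auto
  have "semilinear_form \<phi> w (r \<odot>\<^bsub>free_module R (carrier R)\<^esub> f) = (\<Oplus>g\<in>?A. \<phi> (r \<otimes> f g) \<otimes> w g)"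
    using F.smult_closed [OF r f] r A
    by (subst semilinear_form_superset [OF _ A(1)]) (auto simp: free_module_simps)
  also have "\<dots> = (\<Oplus>g\<in>?A. \<phi> r \<otimes> (\<phi> (f g) \<otimes> w g))"
    using fc funcset_mem [OF w] r ring_hom_closed [OF \<phi>]
    by (intro finsum_cong') (auto simp: ring_hom_mult [OF \<phi>] m_assoc Pi_def)
  also have "\<dots> = \<phi> r \<otimes> semilinear_form \<phi> w f"
    using f A closed by (simp add: finsum_rdistr semilinear_form_superset [OF _ A(1)])
  finally show ?thesis .
qed

lemma semilinear_form_basis:
  assumes g: "g \<in> carrier R"
  shows "semilinear_form \<phi> w (basis_symbol R g) = w g"
proof -
  have "semilinear_form \<phi> w (basis_symbol R g) = (\<Oplus>h\<in>{g}. \<phi> (basis_symbol R g h) \<otimes> w h)"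
    using g by (intro semilinear_form_superset basis_symbol_closed) (auto simp: basis_symbol_def)
  also have "\<dots> = w g"
    using g funcset_mem [OF w] ring_hom_one [OF \<phi>] by (auto simp: basis_symbol_def Pi_def)
  finally show ?thesis .
qed

end

end

section \<open>Universal property of Kaehler differentials\<close>

locale kaehler_module = cring R for R (structure) +
  fixes K assumes K_subset: "K \<subseteq> carrier R"
begin

abbreviation "F \<equiv> free_module R (carrier R)"
abbreviation "N \<equiv> kaehler_submodule R K"
abbreviation "\<Omega> \<equiv> kaehler R K"
abbreviation "bas \<equiv> basis_symbol R"

sublocale F: module R "free_module R (carrier R)"
  by (rule free_module_module)

lemma bas_closed: "g \<in> carrier R \<Longrightarrow> bas g \<in> carrier F"
  by (rule basis_symbol_closed)

lemma relations_closed: "kaehler_relations R K \<subseteq> carrier F"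
  using K_subset by (auto simp: kaehler_relations_def Let_def bas_closed)

lemma N_submodule: "submodule N R F"
  unfolding kaehler_submodule_def by (rule F.submodule_generated_submodule [OF relations_closed])

sublocale N: abelian_subgroup "kaehler_submodule R K" "free_module R (carrier R)"
  by (rule F.submodule_abelian_subgroup [OF N_submodule])

sublocale Omega: module R "kaehler R K"
  unfolding kaehler_def by (rule F.quotient_module [OF N_submodule])

lemma relation_mem: "x \<in> kaehler_relations R K \<Longrightarrow> x \<in> N"
  unfolding kaehler_submodule_def using F.submodule_generated_superset by blast

lemma relation_add:
  "\<lbrakk>r \<in> carrier R; s \<in> carrier R\<rbrakk> \<Longrightarrow> bas (r \<oplus> s) \<ominus>\<^bsub>F\<^esub> (bas r \<oplus>\<^bsub>F\<^esub> bas s) \<in> N"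
  by (rule relation_mem) (auto simp: kaehler_relations_def Let_def)

lemma relation_mult:
  "\<lbrakk>r \<in> carrier R; s \<in> carrier R\<rbrakk> \<Longrightarrow>
    bas (r \<otimes> s) \<ominus>\<^bsub>F\<^esub> (r \<odot>\<^bsub>F\<^esub> bas s \<oplus>\<^bsub>F\<^esub> s \<odot>\<^bsub>F\<^esub> bas r) \<in> N"
  by (rule relation_mem) (auto simp: kaehler_relations_def Let_def)

lemma relation_const: "k \<in> K \<Longrightarrow> bas k \<in> N"
  by (rule relation_mem) (auto simp: kaehler_relations_def Let_def)

text \<open>The preimage of V under T is a submodule containing the defining relations. Since V is
  only a subgroup whose preimage is stable under scalars, the lemma covers both linear forms and the
  semilinear pullback.\<close>

lemma hom_kills_relations:
  assumes T: "abelian_group_hom F H T" and V: "abelian_subgroup V H"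
    and smult: "\<And>r f. \<lbrakk>r \<in> carrier R; f \<in> carrier F; T f \<in> V\<rbrakk> \<Longrightarrow> T (r \<odot>\<^bsub>F\<^esub> f) \<in> V"
    and add: "\<And>r s. \<lbrakk>r \<in> carrier R; s \<in> carrier R\<rbrakk> \<Longrightarrow>
      T (bas (r \<oplus> s)) \<ominus>\<^bsub>H\<^esub> (T (bas r) \<oplus>\<^bsub>H\<^esub> T (bas s)) \<in> V"
    and mult: "\<And>r s. \<lbrakk>r \<in> carrier R; s \<in> carrier R\<rbrakk> \<Longrightarrow>
      T (bas (r \<otimes> s)) \<ominus>\<^bsub>H\<^esub> (T (r \<odot>\<^bsub>F\<^esub> bas s) \<oplus>\<^bsub>H\<^esub> T (s \<odot>\<^bsub>F\<^esub> bas r)) \<in> V"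
    and const: "\<And>k. k \<in> K \<Longrightarrow> T (bas k) \<in> V"
    and x: "x \<in> N"
  shows "T x \<in> V"
proof -
  interpret T: abelian_group_hom F H T by fact
  interpret V: abelian_subgroup V H by fact
  have "submodule {f \<in> carrier F. T f \<in> V} R F"
    by (rule F.submoduleI) (auto simp: smult)
  moreover have "kaehler_relations R K \<subseteq> {f \<in> carrier F. T f \<in> V}"
    using relations_closed add mult const
    by (auto simp: kaehler_relations_def Let_def T.hom_diff bas_closed)
  ultimately have "N \<subseteq> {f \<in> carrier F. T f \<in> V}"
    unfolding kaehler_submodule_def by (rule F.submodule_generated_subset)
  then show ?thesis using x by blast
qed

text \<open>The differential before completion; \<open>differential\<close> is its image in the
  completed module.\<close>

definition dd :: "'a \<Rightarrow> ('a \<Rightarrow> 'a) set" where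
  "dd g = N +>\<^bsub>F\<^esub> bas g"

lemma dd_closed: "g \<in> carrier R \<Longrightarrow> dd g \<in> carrier \<Omega>"
  unfolding dd_def kaehler_def by (rule F.quotient_class_closed [OF N_submodule bas_closed])

lemma dd_add: "\<lbrakk>r \<in> carrier R; s \<in> carrier R\<rbrakk> \<Longrightarrow> dd (r \<oplus> s) = dd r \<oplus>\<^bsub>\<Omega>\<^esub> dd s"
  unfolding dd_def kaehler_def
  by (simp add: F.quotient_add [OF N_submodule] F.quotient_class_eq_iff [OF N_submodule] bas_closed relation_add)

lemma dd_mult: "\<lbrakk>r \<in> carrier R; s \<in> carrier R\<rbrakk> \<Longrightarrow>
    dd (r \<otimes> s) = r \<odot>\<^bsub>\<Omega>\<^esub> dd s \<oplus>\<^bsub>\<Omega>\<^esub> s \<odot>\<^bsub>\<Omega>\<^esub> dd r"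
  unfolding dd_def kaehler_def
  by (simp add: F.quotient_add [OF N_submodule] F.quotient_smult [OF N_submodule]
      F.quotient_class_eq_iff [OF N_submodule] bas_closed relation_mult)

lemma dd_const: "k \<in> K \<Longrightarrow> dd k = \<zero>\<^bsub>\<Omega>\<^esub>"
  unfolding dd_def kaehler_def using K_subset relation_const [of k]
  by (simp add: F.quotient_zero [OF N_submodule] F.quotient_class_eq_iff [OF N_submodule] bas_closed subsetD
      N.a_rcos_const a_minus_def)

lemma dd_hom: "abelian_group_hom R \<Omega> dd"
  by (rule abelian_group_homI') (simp_all add: abelian_group_axioms Omega.M.abelian_group_axioms dd_closed dd_add)

lemma kaehler_induct [consumes 1, case_names zero add smult dd]:
  assumes x: "x \<in> carrier \<Omega>"
    and zero: "P \<zero>\<^bsub>\<Omega>\<^esub>"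
    and add: "\<And>x y. \<lbrakk>x \<in> carrier \<Omega>; y \<in> carrier \<Omega>; P x; P y\<rbrakk> \<Longrightarrow> P (x \<oplus>\<^bsub>\<Omega>\<^esub> y)"
    and smult: "\<And>r x. \<lbrakk>r \<in> carrier R; x \<in> carrier \<Omega>; P x\<rbrakk> \<Longrightarrow> P (r \<odot>\<^bsub>\<Omega>\<^esub> x)"
    and dd: "\<And>g. g \<in> carrier R \<Longrightarrow> P (dd g)"
  shows "P x"
proof -
  note cl = F.quotient_class_closed [OF N_submodule, folded kaehler_def]
  obtain f where f: "f \<in> carrier F" "x = N +>\<^bsub>F\<^esub> f"
    using x unfolding kaehler_def F.quotient_carrier [OF N_submodule] by blast
  have "P (N +>\<^bsub>F\<^esub> f)"
    using f(1)
  proof (induction f rule: free_module_induct)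
    case zero
    then show ?case
      using \<open>P \<zero>\<^bsub>\<Omega>\<^esub>\<close> by (simp add: kaehler_def F.quotient_zero [OF N_submodule])
  next
    case (add f g)
    then show ?case
      using assms(3) [of "N +>\<^bsub>F\<^esub> f" "N +>\<^bsub>F\<^esub> g"] cl
      by (simp add: kaehler_def F.quotient_add [OF N_submodule])
  next
    case (smult r f)
    then show ?case
      using assms(4) [of r "N +>\<^bsub>F\<^esub> f"] cl
      by (simp add: kaehler_def F.quotient_smult [OF N_submodule])
  next
    case (basis g)
    then show ?case using dd by (simp add: dd_def)
  qed
  then show ?thesis by (simp add: f)
qed

text \<open>The linear form with value D g on the symbol of g kills the relations: sums and products
  by additivity and the Leibniz rule, constants by assumption.\<close>

lemma derivation_linear_form:
  assumes D: "abelian_group_hom R R D"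
    and leibniz: "\<And>r s. \<lbrakk>r \<in> carrier R; s \<in> carrier R\<rbrakk> \<Longrightarrow> D (r \<otimes> s) = r \<otimes> D s \<oplus> s \<otimes> D r"
    and const: "\<And>k. k \<in> K \<Longrightarrow> D k = \<zero>"
  obtains l where "abelian_group_hom \<Omega> R l"
    "\<And>r x. \<lbrakk>r \<in> carrier R; x \<in> carrier \<Omega>\<rbrakk> \<Longrightarrow> l (r \<odot>\<^bsub>\<Omega>\<^esub> x) = r \<otimes> l x"
    "\<And>g. g \<in> carrier R \<Longrightarrow> l (dd g) = D g"
proof -
  interpret D: abelian_group_hom R R D by fact
  have id: "(\<lambda>x. x) \<in> ring_hom R R" by (rule ring_hom_memI) simp_all
  have Dc: "D \<in> carrier R \<rightarrow> carrier R" by auto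
  let ?L = "semilinear_form (\<lambda>x. x) D"
  have L: "abelian_group_hom F R ?L"
    by (rule abelian_group_homI')
      (simp_all add: F.M.abelian_group_axioms abelian_group_axioms semilinear_form_closed [OF id Dc]
        semilinear_form_add [OF id Dc])
  have Lb: "?L (bas g) = D g" if "g \<in> carrier R" for g
    using semilinear_form_basis [OF id Dc that] .
  have Ls: "?L (r \<odot>\<^bsub>F\<^esub> f) = r \<otimes> ?L f" if "r \<in> carrier R" "f \<in> carrier F" for r f
    using semilinear_form_smult [OF id Dc that] .
  have zero: "abelian_subgroup {\<zero>} R"
    by (rule abelian_subgroupI3) (auto intro!: additive_subgroupI add.subgroupI simp: abelian_group_axioms)
  have kill: "?L x = \<zero>" if "x \<in> N" for x
  proof -
    have "?L x \<in> {\<zero>}"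
      by (rule hom_kills_relations [OF L zero _ _ _ _ that])
        (use K_subset in \<open>auto simp: Ls Lb bas_closed leibniz const subsetD a_minus_def r_neg\<close>)
    then show ?thesis by simp
  qed
  obtain l where "abelian_group_hom (quotient_module F N) R l"
      and l2: "\<And>x. x \<in> carrier F \<Longrightarrow> l (N +>\<^bsub>F\<^esub> x) = ?L x"
    by (rule F.quotient_induced_hom [OF N_submodule L kill]) (assumption, rule that, assumption, simp)
  then have l: "abelian_group_hom \<Omega> R l" by (simp add: kaehler_def)
  show thesis
  proof (rule that [OF l])
    fix r x assume r: "r \<in> carrier R" and "x \<in> carrier \<Omega>"
    then obtain f where f: "f \<in> carrier F" "x = N +>\<^bsub>F\<^esub> f"
      unfolding kaehler_def F.quotient_carrier [OF N_submodule] by blast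
    have "r \<odot>\<^bsub>\<Omega>\<^esub> x = N +>\<^bsub>F\<^esub> (r \<odot>\<^bsub>F\<^esub> f)"
      unfolding kaehler_def f(2) by (rule F.quotient_smult [OF N_submodule r f(1)])
    then show "l (r \<odot>\<^bsub>\<Omega>\<^esub> x) = r \<otimes> l x"
      using f r by (simp add: l2 Ls)
  qed (simp add: dd_def l2 bas_closed Lb)
qed

end

section \<open>Pullback of differentials along an endomorphism\<close>

locale kaehler_pullback = kaehler_module +
  fixes \<phi> assumes \<phi>: "\<phi> \<in> ring_hom R R" and \<phi>_const: "\<And>k. k \<in> K \<Longrightarrow> \<phi> k \<in> K"
begin

lemma \<phi>_closed: "r \<in> carrier R \<Longrightarrow> \<phi> r \<in> carrier R"
  by (rule ring_hom_closed [OF \<phi>])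

text \<open>Each coordinate of the pullback is a semilinear form, whose weight picks out the fibre
  of \<phi> over h; additivity and semilinearity follow coordinate by coordinate.\<close>

lemma free_pullback_app:
  assumes f: "f \<in> carrier F"
  shows "free_pullback R \<phi> f h =
    (if h \<in> carrier R then semilinear_form \<phi> (\<lambda>g. if \<phi> g = h then \<one> else \<zero>) f else \<zero>)"
proof (cases "h \<in> carrier R")
  case True
  have "free_pullback R \<phi> f h = semilinear_form \<phi> (\<lambda>g. if \<phi> g = h then \<one> else \<zero>) f"
    unfolding free_pullback_def semilinear_form_def
    using f free_module_app [OF f] \<phi>_closed
    by (intro add.finprod_mono_neutral_cong_left)
      (auto simp: free_module_carrier_iff intro: rev_finite_subset)
  then show ?thesis using True by simp
next
  case False
  then have "{g \<in> carrier R. f g \<noteq> \<zero> \<and> \<phi> g = h} = {}" using \<phi>_closed by auto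
  then show ?thesis using False by (simp only: free_pullback_def finsum_empty if_False)
qed

lemma weight_closed: "(\<lambda>g. if \<phi> g = h then \<one> else \<zero>) \<in> carrier R \<rightarrow> carrier R"
  by auto

lemma free_pullback_closed:
  assumes f: "f \<in> carrier F"
  shows "free_pullback R \<phi> f \<in> carrier F"
proof -
  have "{h. free_pullback R \<phi> f h \<noteq> \<zero>} \<subseteq> \<phi> ` {g. f g \<noteq> \<zero>}"
  proof
    fix h assume "h \<in> {h. free_pullback R \<phi> f h \<noteq> \<zero>}"
    then have "{g \<in> carrier R. f g \<noteq> \<zero> \<and> \<phi> g = h} \<noteq> {}"
      unfolding free_pullback_def mem_Collect_eq by (metis (no_types, lifting) finsum_empty)
    then show "h \<in> \<phi> ` {g. f g \<noteq> \<zero>}" by auto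
  qed
  moreover have "finite (\<phi> ` {g. f g \<noteq> \<zero>})"
    using f by (simp add: free_module_carrier_iff)
  ultimately have "finite {h. free_pullback R \<phi> f h \<noteq> \<zero>}" by (rule finite_subset)
  then show ?thesis
    using f by (simp add: free_module_carrier_iff [of "free_pullback R \<phi> f"] free_pullback_app
        semilinear_form_closed [OF \<phi> weight_closed])
qed

lemma free_pullback_hom: "abelian_group_hom F F (free_pullback R \<phi>)"
proof (rule abelian_group_homI' [OF F.M.abelian_group_axioms F.M.abelian_group_axioms free_pullback_closed])
  fix f f' assume "f \<in> carrier F" "f' \<in> carrier F"
  then show "free_pullback R \<phi> (f \<oplus>\<^bsub>F\<^esub> f') = free_pullback R \<phi> f \<oplus>\<^bsub>F\<^esub> free_pullback R \<phi> f'"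
    using F.M.a_closed [of f f']
    by (simp add: fun_eq_iff free_pullback_app semilinear_form_add [OF \<phi> weight_closed] free_module_simps(1) [of _ "free_pullback R \<phi> f"])
qed

lemma free_pullback_smult:
  "\<lbrakk>r \<in> carrier R; f \<in> carrier F\<rbrakk> \<Longrightarrow> free_pullback R \<phi> (r \<odot>\<^bsub>F\<^esub> f) = \<phi> r \<odot>\<^bsub>F\<^esub> free_pullback R \<phi> f"
  using F.smult_closed [of r f] \<phi>_closed [of r]
  by (simp add: fun_eq_iff free_pullback_app semilinear_form_smult [OF \<phi> weight_closed] free_module_simps(3) [of _ "\<phi> r"])

lemma free_pullback_bas:
  assumes "g \<in> carrier R"
  shows "free_pullback R \<phi> (bas g) = bas (\<phi> g)"
proof
  fix h
  have "free_pullback R \<phi> (bas g) h = (if h \<in> carrier R then if \<phi> g = h then \<one> else \<zero> else \<zero>)"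
    using assms by (simp add: free_pullback_app bas_closed semilinear_form_basis [OF \<phi> weight_closed])
  then show "free_pullback R \<phi> (bas g) h = bas (\<phi> g) h"
    using assms \<phi>_closed by (auto simp: basis_symbol_def)
qed

abbreviation "pull \<equiv> coset_map F N (free_pullback R \<phi>)"

lemma free_pullback_N: "x \<in> N \<Longrightarrow> free_pullback R \<phi> x \<in> N"
  by (rule hom_kills_relations [OF free_pullback_hom N.abelian_subgroup_axioms])
    (simp_all add: free_pullback_smult free_pullback_bas bas_closed \<phi>_closed submodule.smult_closed [OF N_submodule]
      ring_hom_add [OF \<phi>] ring_hom_mult [OF \<phi>] relation_add relation_mult relation_const \<phi>_const K_subset [THEN subsetD])

lemma pull_class: "f \<in> carrier F \<Longrightarrow> pull (N +>\<^bsub>F\<^esub> f) = N +>\<^bsub>F\<^esub> free_pullback R \<phi> f"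
  by (rule F.M.coset_map_eq [OF F.M.abelian_group_axioms free_pullback_hom N.abelian_subgroup_axioms
        N.abelian_subgroup_axioms]) (auto simp: free_pullback_N)

lemma kaehler_classE:
  assumes "x \<in> carrier \<Omega>"
  obtains f where "f \<in> carrier F" "x = N +>\<^bsub>F\<^esub> f"
  using assms unfolding kaehler_def F.quotient_carrier [OF N_submodule] by blast

lemma pull_hom: "abelian_group_hom \<Omega> \<Omega> pull"
proof (rule abelian_group_homI' [OF Omega.M.abelian_group_axioms Omega.M.abelian_group_axioms])
  interpret P: abelian_group_hom F F "free_pullback R \<phi>" by (rule free_pullback_hom)
  fix x assume "x \<in> carrier \<Omega>"
  then obtain f where f: "f \<in> carrier F" "x = N +>\<^bsub>F\<^esub> f" by (rule kaehler_classE)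
  then show "pull x \<in> carrier \<Omega>"
    by (simp add: pull_class kaehler_def F.quotient_class_closed [OF N_submodule])
  fix y assume "y \<in> carrier \<Omega>"
  then obtain g where g: "g \<in> carrier F" "y = N +>\<^bsub>F\<^esub> g" by (rule kaehler_classE)
  show "pull (x \<oplus>\<^bsub>\<Omega>\<^esub> y) = pull x \<oplus>\<^bsub>\<Omega>\<^esub> pull y"
    using f g by (simp add: pull_class kaehler_def F.quotient_add [OF N_submodule])
qed

lemma pull_smult:
  assumes r: "r \<in> carrier R" and x: "x \<in> carrier \<Omega>"
  shows "pull (r \<odot>\<^bsub>\<Omega>\<^esub> x) = \<phi> r \<odot>\<^bsub>\<Omega>\<^esub> pull x"
proof -
  interpret P: abelian_group_hom F F "free_pullback R \<phi>" by (rule free_pullback_hom)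
  obtain f where f: "f \<in> carrier F" "x = N +>\<^bsub>F\<^esub> f" using x by (rule kaehler_classE)
  then show ?thesis
    using r by (simp add: pull_class kaehler_def F.quotient_smult [OF N_submodule] \<phi>_closed free_pullback_smult)
qed

lemma pull_dd: "g \<in> carrier R \<Longrightarrow> pull (dd g) = dd (\<phi> g)"
  by (simp add: dd_def pull_class bas_closed free_pullback_bas)

end

section \<open>Functoriality of completions\<close>

lemma completion_map_ring_hom:
  assumes R: "torsion_free_ring R p" and S: "torsion_free_ring S p" and h: "h \<in> ring_hom R S"
  shows "completion_map p S h \<in> ring_hom (ring_completion p R) (ring_completion p S)"
    and "r \<in> carrier R \<Longrightarrow> completion_map p S h (to_completion p R r) = to_completion p S (h r)"
proof -
  interpret R: torsion_free_ring R p by fact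
  interpret S: torsion_free_ring S p by fact
  interpret h: abelian_group_hom R S h
    by (rule ring_hom_abelian_group_hom [OF h R.ring_axioms S.ring_axioms])
  have map: "completion_map p S h (thread_of p R x) = thread_of p S (\<lambda>n. h (x n))"
    if "\<And>n. x n \<in> carrier R" for x
    by (rule R.completion_map_thread [OF h.abelian_group_hom_axioms S.abelian_group_axioms that])
  have coh: "coherent p S (\<lambda>n. h (x n))" if "coherent p R x" for x
    using that by (simp add: coherent_def h.hom_congruent)
  have *: "\<exists>x. coherent p R x \<and> (\<forall>n. x n \<in> carrier R) \<and> s = thread_of p R x"
    if "s \<in> carrier (ring_completion p R)" for s
    using that by (metis R.C.carrier_E)
  show emb: "r \<in> carrier R \<Longrightarrow> completion_map p S h (to_completion p R r) = to_completion p S (h r)" for r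
    by (simp add: to_completion_conv map)
  show "completion_map p S h \<in> ring_hom (ring_completion p R) (ring_completion p S)"
  proof (rule ring_hom_memI)
    fix s assume "s \<in> carrier (ring_completion p R)"
    then obtain x where x: "coherent p R x" "\<And>n. x n \<in> carrier R" "s = thread_of p R x" using * by metis
    show "completion_map p S h s \<in> carrier (ring_completion p S)"
      using x by (simp add: map S.C.thr_closed coh)
    fix t assume "t \<in> carrier (ring_completion p R)"
    then obtain y where y: "coherent p R y" "\<And>n. y n \<in> carrier R" "t = thread_of p R y" using * by metis
    show "completion_map p S h (s \<otimes>\<^bsub>ring_completion p R\<^esub> t) =
        completion_map p S h s \<otimes>\<^bsub>ring_completion p S\<^esub> completion_map p S h t"
      using x y by (simp add: R.thread_mult S.thread_mult map ring_hom_mult [OF h])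
    show "completion_map p S h (s \<oplus>\<^bsub>ring_completion p R\<^esub> t) =
        completion_map p S h s \<oplus>\<^bsub>ring_completion p S\<^esub> completion_map p S h t"
      using x y by (simp add: R.C.thr_add S.C.thr_add map)
  next
    show "completion_map p S h \<one>\<^bsub>ring_completion p R\<^esub> = \<one>\<^bsub>ring_completion p S\<^esub>"
      by (simp add: R.thread_one S.thread_one map ring_hom_one [OF h])
  qed
qed

lemma surjective_dense_ring_hom:
  assumes R: "cring R" and S: "torsion_free_ring S p" and h: "h \<in> ring_hom R S" "h ` carrier R = carrier S"
  shows "dense_ring_hom R (ring_completion p S) (\<lambda>r. to_completion p S (h r)) p"
proof (intro dense_ring_hom.intro dense_ring_hom_axioms.intro R)
  interpret S: torsion_free_ring S p by fact
  show "padic_ring (ring_completion p S) p" by (rule S.completion_padic_ring)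
  show "(\<lambda>r. to_completion p S (h r)) \<in> ring_hom R (ring_completion p S)"
    using ring_hom_trans [OF h(1) S.emb_ring_hom] by (simp add: o_def)
  fix s n assume "s \<in> carrier (ring_completion p S)"
  then obtain t where "t \<in> carrier S" "congruent_mod (p ^ n) (ring_completion p S) s (to_completion p S t)"
    by (rule S.C.emb_dense)
  then show "\<exists>r\<in>carrier R. congruent_mod (p ^ n) (ring_completion p S) s (to_completion p S (h r))"
    using h(2) by (metis imageE)
qed

text \<open>A preimage is built from \<open>p\<close>-adic digits.\<close>

lemma completion_map_surjective:
  assumes R: "torsion_free_ring R p" and S: "torsion_free_ring S p"
    and h: "h \<in> ring_hom R S" "h ` carrier R = carrier S" and y: "y \<in> carrier (ring_completion p S)"
  shows "\<exists>x\<in>carrier (ring_completion p R). completion_map p S h x = y"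
proof -
  interpret R: torsion_free_ring R p by fact
  interpret S: torsion_free_ring S p by fact
  interpret h: abelian_group_hom R S h
    by (rule ring_hom_abelian_group_hom [OF h(1) R.ring_axioms S.ring_axioms])
  interpret d: dense_ring_hom R "ring_completion p S" "\<lambda>r. to_completion p S (h r)" p
    by (rule surjective_dense_ring_hom [OF R.cring_axioms S h])
  let ?T = "ring_completion p S" and ?e = "\<lambda>r. to_completion p S (h r)"
  \<comment> \<open>One digit: s is congruent modulo p to the image of some r, and the remainder
    divided by p is again an element of the completion.\<close>
  have "\<exists>r z. r \<in> carrier R \<and> z \<in> carrier ?T \<and> s = ?e r \<oplus>\<^bsub>?T\<^esub> [p] \<cdot>\<^bsub>?T\<^esub> z" if "s \<in> carrier ?T" for s
    using d.dense [OF that, of 1] by (auto elim!: S.C.C.congruentE)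
  then obtain \<beta> \<gamma> where \<beta>: "\<And>s. s \<in> carrier ?T \<Longrightarrow> \<beta> s \<in> carrier R"
    and \<gamma>: "\<And>s. s \<in> carrier ?T \<Longrightarrow> \<gamma> s \<in> carrier ?T"
    and digit: "\<And>s. s \<in> carrier ?T \<Longrightarrow> s = ?e (\<beta> s) \<oplus>\<^bsub>?T\<^esub> [p] \<cdot>\<^bsub>?T\<^esub> \<gamma> s"
    by metis
  define z where "z n = (\<gamma> ^^ n) y" for n
  have z0: "z 0 = y" and zS: "z (Suc n) = \<gamma> (z n)" for n by (simp_all add: z_def)
  have z: "z n \<in> carrier ?T" for n
    by (induction n) (simp_all add: z0 zS y \<gamma>)
  define x where "x = rec_nat \<zero>\<^bsub>R\<^esub> (\<lambda>n s. s \<oplus>\<^bsub>R\<^esub> [(p ^ n)] \<cdot>\<^bsub>R\<^esub> \<beta> (z n))"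
  have x0: "x 0 = \<zero>\<^bsub>R\<^esub>" and xS: "x (Suc n) = x n \<oplus>\<^bsub>R\<^esub> [(p ^ n)] \<cdot>\<^bsub>R\<^esub> \<beta> (z n)" for n
    by (simp_all add: x_def)
  have xc: "x n \<in> carrier R" for n
    by (induction n) (simp_all add: x0 xS \<beta> z)
  have coh: "coherent p R x"
    unfolding coherent_def xS using xc by (simp add: R.congruent_multiple \<beta> z)
  have y_eq: "y = ?e (x n) \<oplus>\<^bsub>?T\<^esub> [(p ^ n)] \<cdot>\<^bsub>?T\<^esub> z n" for n
  proof (induction n)
    case 0
    then show ?case using y d.\<iota>.hom_zero by (simp add: x0 z0)
  next
    case (Suc n)
    let ?q = "p ^ n"
    have "[?q] \<cdot>\<^bsub>?T\<^esub> z n = [?q] \<cdot>\<^bsub>?T\<^esub> (?e (\<beta> (z n)) \<oplus>\<^bsub>?T\<^esub> [p] \<cdot>\<^bsub>?T\<^esub> z (Suc n))"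
      using digit [OF z] by (simp add: zS)
    also have "\<dots> = ?e ([?q] \<cdot>\<^bsub>R\<^esub> \<beta> (z n)) \<oplus>\<^bsub>?T\<^esub> [(p ^ Suc n)] \<cdot>\<^bsub>?T\<^esub> z (Suc n)"
      using z \<beta> d.\<iota>.hom_closed
      by (simp add: S.C.C.nat_add_pow_add S.C.C.nat_add_pow_mult d.\<iota>.hom_nat_pow mult.commute)
    finally have "y = ?e (x n) \<oplus>\<^bsub>?T\<^esub> (?e ([?q] \<cdot>\<^bsub>R\<^esub> \<beta> (z n)) \<oplus>\<^bsub>?T\<^esub> [(p ^ Suc n)] \<cdot>\<^bsub>?T\<^esub> z (Suc n))"
      using Suc by simp
    then show ?case
      using d.\<iota>.hom_closed d.\<iota>.hom_add xc z \<beta> by (simp add: xS S.C.C.a_assoc)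
  qed
  let ?x = "thread_of p R x"
  have "completion_map p S h ?x = y"
  proof (rule d.S.eqI)
    have map: "completion_map p S h ?x = thread_of p S (\<lambda>n. h (x n))"
      by (rule R.completion_map_thread [OF h.abelian_group_hom_axioms S.abelian_group_axioms xc])
    have coh': "coherent p S (\<lambda>n. h (x n))"
      using coh by (simp add: coherent_def h.hom_congruent)
    show "completion_map p S h ?x \<in> carrier ?T"
      unfolding map by (rule S.C.thr_closed [OF coh'])
    show "y \<in> carrier ?T" by fact
    fix n
    have "congruent_mod (p ^ n) ?T (completion_map p S h ?x) (?e (x n))"
      unfolding map to_completion_conv
      using coh' xc by (simp add: S.C.thr_congruent_iff S.coherent_const S.congruent_refl)
    moreover have "congruent_mod (p ^ n) ?T y (?e (x n))"
      using y_eq [of n] S.C.C.congruent_multiple [of "?e (x n)" "z n" "p ^ n"] d.\<iota>.hom_closed xc z by simp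
    ultimately show "congruent_mod (p ^ n) ?T (completion_map p S h ?x) y"
      using S.C.C.congruent_trans [OF _ S.C.C.congruent_sym] y d.\<iota>.hom_closed xc S.C.thr_closed [OF coh', folded map] by metis
  qed
  moreover have "?x \<in> carrier (ring_completion p R)" by (rule R.C.thr_closed [OF coh])
  ultimately show ?thesis by blast
qed

section \<open>Completions of modules\<close>

context module
begin

lemma multiples_submodule: "submodule (multiples M k) R M"
proof (rule submoduleI)
  fix r x assume "r \<in> carrier R" "x \<in> multiples M k"
  then show "r \<odot>\<^bsub>M\<^esub> x \<in> multiples M k"
    using abelian_group_hom.hom_multiples [OF smult_hom] by blast
qed (auto simp: M.multiples_zero M.multiples_minus M.multiples_add dest: M.multiples_carrier)

lemma module_completion_smult:
  assumes "r \<in> carrier R" "x \<in> carrier M"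
  shows "r \<odot>\<^bsub>module_completion p M\<^esub> to_completion p M x = to_completion p M (r \<odot>\<^bsub>M\<^esub> x)"
  using quotient_smult [OF multiples_submodule assms]
  by (simp add: module_completion_def to_completion_def)

lemma module_completion: "completion M p (module_completion p M)"
  by unfold_locales (simp_all add: module_completion_def quotient_module_def)

lemma smult_nat_pow_l:
  assumes "r \<in> carrier R" "x \<in> carrier M"
  shows "([(k::nat)] \<cdot> r) \<odot>\<^bsub>M\<^esub> x = [k] \<cdot>\<^bsub>M\<^esub> (r \<odot>\<^bsub>M\<^esub> x)"
  using assms by (induction k) (simp_all add: smult_l_distr)

lemma congruent_smult_l:
  assumes "congruent_mod k R r s" "r \<in> carrier R" "s \<in> carrier R" "x \<in> carrier M"
  shows "congruent_mod k M (r \<odot>\<^bsub>M\<^esub> x) (s \<odot>\<^bsub>M\<^esub> x)"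
proof -
  obtain z where "z \<in> carrier R" "r = s \<oplus> [k] \<cdot> z"
    using assms(1) by (rule R.congruentE)
  then show ?thesis
    using assms by (simp add: smult_l_distr smult_nat_pow_l M.congruent_multiple)
qed

end

section \<open>Forms on a level set\<close>

text \<open>Both \<phi> and \<open>\<delta>X\<close> are fixed: the constructions on the level set
  are defined through \<open>\<delta>X\<close>, while the proofs use the homomorphism \<phi>, which
  equals the Frobenius map of \<open>\<delta>X\<close> on the carrier. The conditions
  \<open>\<sigma>_c\<close> restate that \<delta> vanishes at c1 and c2.\<close>

locale level_set = level_sets_frobenius +
  fixes \<phi> \<delta>X and c1 c2 :: 'a
  assumes \<phi>: "\<phi> \<in> ring_hom (OX_hat p a) (OX_hat p a)"
    and \<phi>_cst: "\<And>b. \<phi> (emb_X (fr (cst b))) = emb_X (fr (cst (\<sigma> b)))"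
    and \<phi>_x3: "\<phi> (emb_X (fr x3)) = emb_X frob_x3"
    and \<phi>_H1: "\<phi> (emb_X (fr (H1 a))) = emb_X (fr (H1 a) ^ p)"
    and \<phi>_H2: "\<phi> (emb_X (fr H2)) = emb_X (fr H2 ^ p)"
    and \<phi>_frob: "\<And>s. s \<in> carrier (OX_hat p a) \<Longrightarrow> congruent_mod p (OX_hat p a) (\<phi> s) (s [^]\<^bsub>OX_hat p a\<^esub> p)"
    and \<phi>_\<delta>X: "\<And>s. s \<in> carrier (OX_hat p a) \<Longrightarrow> frobenius_of p (OX_hat p a) \<delta>X s = \<phi> s"
    and \<sigma>_c: "\<sigma> c1 = c1 ^ p" "\<sigma> c2 = c2 ^ p"
begin

abbreviation "g1 \<equiv> fr (H1 a - cst c1)"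
abbreviation "g2 \<equiv> fr (H2 - cst c2)"
abbreviation "I \<equiv> level_ideal p a c1 c2"

lemma I_ideal: "ideal I (OX p a)"
  unfolding level_ideal_def by (rule X.genideal_ideal) (simp add: carrier_OX)

lemma I_iff: "x \<in> I \<longleftrightarrow> (\<exists>u\<in>B. \<exists>v\<in>B. x = u * g1 + v * g2)"
proof
  let ?J = "{x. \<exists>u\<in>B. \<exists>v\<in>B. x = u * g1 + v * g2}"
  have "ideal ?J (OX p a)"
  proof (rule idealI)
    show "ring (OX p a)" by (rule X.ring_axioms)
    show "subgroup ?J (add_monoid (OX p a))"
    proof (rule X.add.subgroupI)
      show "?J \<subseteq> carrier (OX p a)" by (auto simp: carrier_OX)
      have "0 = 0 * g1 + 0 * g2" by simp
      then show "?J \<noteq> {}" using B_closed(2) by blast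
      fix x assume "x \<in> ?J"
      then obtain u v where uv: "u \<in> B" "v \<in> B" "x = u * g1 + v * g2" by blast
      have xB: "x \<in> B" using uv by simp
      have "\<ominus>\<^bsub>OX p a\<^esub> x = - x"
        using type_ring_minus [of B x] cring_OX xB by (simp add: OX_eq)
      also have "\<dots> = (- u) * g1 + (- v) * g2" using uv(3) by simp
      finally show "\<ominus>\<^bsub>OX p a\<^esub> x \<in> ?J" using uv(1,2) B_closed(4) by blast
      fix y assume "y \<in> ?J"
      then obtain u' v' where uv': "u' \<in> B" "v' \<in> B" "y = u' * g1 + v' * g2" by blast
      then have "x \<oplus>\<^bsub>OX p a\<^esub> y = (u + u') * g1 + (v + v') * g2"
        using uv by (simp add: OX_eq algebra_simps)
      then show "x \<oplus>\<^bsub>OX p a\<^esub> y \<in> ?J" using uv uv' B_closed(5) by blast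
    qed
    fix x y assume "x \<in> ?J" and y: "y \<in> carrier (OX p a)"
    then obtain u v where uv: "u \<in> B" "v \<in> B" "x = u * g1 + v * g2" by blast
    have "y \<otimes>\<^bsub>OX p a\<^esub> x = (y * u) * g1 + (y * v) * g2" "x \<otimes>\<^bsub>OX p a\<^esub> y = (y * u) * g1 + (y * v) * g2"
      using uv by (simp_all add: OX_eq algebra_simps)
    moreover have "y * u \<in> B" "y * v \<in> B" using uv y by (simp_all add: carrier_OX)
    ultimately show "y \<otimes>\<^bsub>OX p a\<^esub> x \<in> ?J" "x \<otimes>\<^bsub>OX p a\<^esub> y \<in> ?J" by blast+
  qed
  moreover have "{g1, g2} \<subseteq> ?J"
  proof -
    have "g1 = 1 * g1 + 0 * g2" "g2 = 0 * g1 + 1 * g2" by simp_all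
    then show ?thesis using B_closed(2,3) by blast
  qed
  ultimately have "I \<subseteq> ?J"
    unfolding level_ideal_def by (rule X.genideal_minimal)
  then show "\<exists>u\<in>B. \<exists>v\<in>B. x = u * g1 + v * g2" if "x \<in> I" using that by blast
next
  assume "\<exists>u\<in>B. \<exists>v\<in>B. x = u * g1 + v * g2"
  then obtain u v where uv: "u \<in> B" "v \<in> B" "x = u * g1 + v * g2" by blast
  interpret I: ideal I "OX p a" by (rule I_ideal)
  have "{g1, g2} \<subseteq> I"
    unfolding level_ideal_def by (rule X.genideal_self) (simp add: carrier_OX)
  then have "u * g1 \<in> I" "v * g2 \<in> I"
    using I.I_l_closed [of g1 u] I.I_l_closed [of g2 v] uv by (simp_all add: OX_eq)
  then have "u * g1 \<oplus>\<^bsub>OX p a\<^esub> v * g2 \<in> I" by (rule I.a_closed)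
  then show "x \<in> I" by (simp add: OX_eq uv)
qed

sublocale I: ideal "level_ideal p a c1 c2" "OX p a"
  by (rule I_ideal)

lemma generators_I: "g1 \<in> I" "g2 \<in> I"
proof -
  have "g1 = 1 * g1 + 0 * g2" "g2 = 0 * g1 + 1 * g2" by simp_all
  then show "g1 \<in> I" "g2 \<in> I" unfolding I_iff using B_closed(2,3) by blast+
qed

lemma I_B: "x \<in> I \<Longrightarrow> x \<in> B"
  by (auto simp: I_iff)

text \<open>Multiplying by a power of Q clears all denominators and reduces the claim to the
  saturation of the ideal in the polynomial ring; the power of Q is a unit of \<open>B\<close> and
  is removed at the end.\<close>

lemma I_torsion_free:
  assumes x: "x \<in> B" and px: "of_nat p * x \<in> I"
  shows "x \<in> I"
proof -
  have den: "\<exists>f n. y = Fract f (Qpoly p a ^ n)" if "y \<in> B" for y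
    using that by (auto simp: B_def)
  obtain u v where uv: "u \<in> B" "v \<in> B" "of_nat p * x = u * g1 + v * g2"
    using px by (auto simp: I_iff)
  obtain f k where f: "x = Fract f (Qpoly p a ^ k)" using den [OF x] by blast
  obtain u' l where u': "u = Fract u' (Qpoly p a ^ l)" using den [OF uv(1)] by blast
  obtain v' m where v': "v = Fract v' (Qpoly p a ^ m)" using den [OF uv(2)] by blast
  let ?q = "Qpoly p a"
  define n where "n = k + l + m"
  have clear: "Fract g (?q ^ j) * fr ?q ^ (j + i) = fr (g * ?q ^ i)" for g i j
  proof -
    have "Fract g (?q ^ j) * fr (?q ^ j) = fr g"
      using Qpoly_nonzero by (simp add: mult_fract eq_fract)
    then show ?thesis by (simp add: fr_simps power_add mult.assoc [symmetric])
  qed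
  have x: "x * fr ?q ^ n = fr (f * ?q ^ (l + m))"
    using clear [of f k "l + m"] by (simp add: f n_def add.assoc)
  have u: "u * fr ?q ^ n = fr (u' * ?q ^ (k + m))"
    using clear [of u' l "k + m"] by (simp add: u' n_def ac_simps)
  have v: "v * fr ?q ^ n = fr (v' * ?q ^ (k + l))"
    using clear [of v' m "k + l"] by (simp add: v' n_def ac_simps)
  have "of_nat p * (x * fr ?q ^ n) = (u * fr ?q ^ n) * g1 + (v * fr ?q ^ n) * g2"
    using arg_cong [OF uv(3), of "\<lambda>z. z * fr ?q ^ n"] by (simp add: algebra_simps)
  then have "fr (of_nat p * (f * ?q ^ (l + m))) =
      fr (u' * ?q ^ (k + m) * (H1 a - cst c1) + v' * ?q ^ (k + l) * (H2 - cst c2))"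
    unfolding x u v by (simp only: fr_simps type_hom_of_nat [OF type_hom_fr])
  then have "of_nat p * (f * ?q ^ (l + m)) =
      u' * ?q ^ (k + m) * (H1 a - cst c1) + v' * ?q ^ (k + l) * (H2 - cst c2)"
    by (simp add: eq_fract)
  from level_torsion_free [OF this]
  obtain s t where st: "f * ?q ^ (l + m) = s * (H1 a - cst c1) + t * (H2 - cst c2)" by blast
  have qn: "Fract 1 (?q ^ n) \<in> B" unfolding B_def by blast
  have "fr ?q ^ n * Fract 1 (?q ^ n) = 1"
    using clear [of 1 n 0] by (simp add: One_fract_def mult.commute)
  then have "x = (x * fr ?q ^ n) * Fract 1 (?q ^ n)" by (simp add: mult.assoc)
  also have "\<dots> = (Fract 1 (?q ^ n) * fr s) * g1 + (Fract 1 (?q ^ n) * fr t) * g2"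
    unfolding x st by (simp only: fr_simps) (simp add: algebra_simps)
  finally show ?thesis
    unfolding I_iff using B_closed(6) [OF qn B_closed(1)] by blast
qed

lemma cring_OE: "cring (OE p a c1 c2)"
  unfolding OE_def by (rule I.quotient_is_cring [OF X.cring_axioms])

abbreviation "cls b \<equiv> I +>\<^bsub>OX p a\<^esub> b"

lemma cls_hom: "(\<lambda>b. cls b) \<in> ring_hom (OX p a) (OE p a c1 c2)"
  unfolding OE_def using I.rcos_ring_hom .

lemma carrier_OE: "carrier (OE p a c1 c2) = (\<lambda>b. cls b) ` carrier (OX p a)"
  by (auto simp: OE_def FactRing_def A_RCOSETS_def RCOSETS_def a_r_coset_def)

lemma OX_diff: "\<lbrakk>x \<in> B; y \<in> B\<rbrakk> \<Longrightarrow> x \<ominus>\<^bsub>OX p a\<^esub> y = x - y"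
  using type_ring_minus [of B y] cring_OX by (simp add: OX_eq a_minus_def)

lemma cls_eq_iff: "\<lbrakk>x \<in> B; y \<in> B\<rbrakk> \<Longrightarrow> cls x = cls y \<longleftrightarrow> x - y \<in> I"
  using abelian_subgroup.coset_eq_iff [OF I.abelian_subgroup_axioms, of x y]
  by (simp add: carrier_OX OX_diff)

lemma cls_zero: "cls 0 = \<zero>\<^bsub>OE p a c1 c2\<^esub>"
  using ring_hom_zero [OF cls_hom X.ring_axioms cring.axioms(1) [OF cring_OE]] by (simp add: OX_eq)

sublocale E: torsion_free_ring "OE p a c1 c2" p
proof (intro torsion_free_ring.intro torsion_free_ring_axioms.intro cring_OE)
  interpret h: abelian_group_hom "OX p a" "OE p a c1 c2" "\<lambda>b. cls b"
    by (rule ring_hom_abelian_group_hom [OF cls_hom X.ring_axioms cring.axioms(1) [OF cring_OE]])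
  fix s assume s: "s \<in> carrier (OE p a c1 c2)" and ps: "[p] \<cdot>\<^bsub>OE p a c1 c2\<^esub> s = \<zero>\<^bsub>OE p a c1 c2\<^esub>"
  obtain b where b: "b \<in> B" "s = cls b" using s by (auto simp: carrier_OE carrier_OX)
  have "cls (of_nat p * b) = cls 0"
    using h.hom_nat_pow [of b p] ps b by (simp add: carrier_OX OX_eq) (simp add: OX_eq [symmetric] cls_zero)
  then have "of_nat p * b \<in> I" using b by (simp add: cls_eq_iff)
  then have "b \<in> I" using b(1) by (rule I_torsion_free [rotated])
  then have "cls b = cls 0" using b by (simp add: cls_eq_iff)
  then show "s = \<zero>\<^bsub>OE p a c1 c2\<^esub>" by (simp add: b cls_zero)
qed

abbreviation "S \<equiv> OE_hat p a c1 c2"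

definition emb_E :: "'a poly poly poly fract \<Rightarrow> nat \<Rightarrow> 'a poly poly poly fract set set" where
  "emb_E b = to_completion p (OE p a c1 c2) (cls b)"

sublocale E: dense_ring_hom "OX p a" "OE_hat p a c1 c2" emb_E p
  unfolding OE_hat_def emb_E_def
  using surjective_dense_ring_hom [OF X.cring_axioms E.torsion_free_ring_axioms cls_hom] carrier_OE by simp

lemma fun_E_eq: "fun_E p a c1 c2 f = emb_E (fr f)"
  by (simp add: fun_E_def emb_E_def)

lemma emb_E_closed: "b \<in> B \<Longrightarrow> emb_E b \<in> carrier S"
  using ring_hom_closed [OF E.\<iota>] by (simp add: carrier_OX)

lemma emb_E_add: "\<lbrakk>x \<in> B; y \<in> B\<rbrakk> \<Longrightarrow> emb_E (x + y) = emb_E x \<oplus>\<^bsub>S\<^esub> emb_E y"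
  and emb_E_mult: "\<lbrakk>x \<in> B; y \<in> B\<rbrakk> \<Longrightarrow> emb_E (x * y) = emb_E x \<otimes>\<^bsub>S\<^esub> emb_E y"
  and emb_E_one: "emb_E 1 = \<one>\<^bsub>S\<^esub>"
  and emb_E_zero: "emb_E 0 = \<zero>\<^bsub>S\<^esub>"
  using ring_hom_add [OF E.\<iota>, of x y] ring_hom_mult [OF E.\<iota>, of x y] ring_hom_one [OF E.\<iota>]
    ring_hom_zero [OF E.\<iota> X.ring_axioms E.S.ring_axioms]
  by (simp_all add: OX_eq)

lemma emb_E_nat_multiple: "x \<in> B \<Longrightarrow> emb_E (of_nat k * x) = [k] \<cdot>\<^bsub>S\<^esub> emb_E x"
  using E.\<iota>.hom_nat_pow [of x k] by (simp add: OX_eq)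

lemma emb_E_power: "x \<in> B \<Longrightarrow> emb_E (x ^ n) = emb_E x [^]\<^bsub>S\<^esub> n"
  by (induction n) (simp_all add: emb_E_one emb_E_mult emb_E_closed E.S.m_comm)

lemma emb_E_ideal: "i \<in> I \<Longrightarrow> emb_E i = \<zero>\<^bsub>S\<^esub>"
  using cls_eq_iff [of i 0] I_B [of i] emb_E_zero by (simp add: emb_E_def)

lemma emb_E_eqI: "\<lbrakk>x \<in> B; y \<in> B; x - y \<in> I\<rbrakk> \<Longrightarrow> emb_E x = emb_E y"
  using cls_eq_iff [of x y] by (simp add: emb_E_def)

text \<open>Completion creates no new divisibility by p^n, so divisibility is already visible in the
  quotient of \<open>B\<close> by \<open>I\<close>. This replaces exactness of completion when a map
  is passed from X to the level set.\<close>

lemma emb_E_multiple: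
  assumes b: "b \<in> B" and mult: "emb_E b \<in> multiples S (p ^ n)"
  obtains i z where "i \<in> I" "z \<in> B" "b = i + of_nat (p ^ n) * z"
proof -
  interpret h: abelian_group_hom "OX p a" "OE p a c1 c2" "\<lambda>b. cls b"
    by (rule ring_hom_abelian_group_hom [OF cls_hom X.ring_axioms E.ring_axioms])
  have "cls b \<in> multiples (OE p a c1 c2) (p ^ n)"
    using mult b h.hom_closed [of b] E.C.emb_multiple_iff [of "cls b" n]
    by (simp add: emb_E_def OE_hat_def carrier_OX)
  then obtain s where s: "s \<in> carrier (OE p a c1 c2)" "cls b = [(p ^ n)] \<cdot>\<^bsub>OE p a c1 c2\<^esub> s"
    by (rule E.multiplesE)
  obtain z where z: "z \<in> B" "s = cls z" using s(1) by (auto simp: carrier_OE carrier_OX)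
  have "cls b = cls (of_nat (p ^ n) * z)"
    using s(2) z h.hom_nat_pow [of z "p ^ n"] by (simp add: OX_eq)
  then have "b - of_nat (p ^ n) * z \<in> I"
    using b z B_of_nat [of "p ^ n"] by (simp add: cls_eq_iff del: of_nat_power)
  then show thesis
    by (rule that [OF _ z(1)]) simp
qed

section \<open>The Frobenius lift on a level set\<close>

abbreviation "res \<equiv> restrict_to_E p a c1 c2"

lemma res_hom: "res \<in> ring_hom (OX_hat p a) S"
  and res_emb: "b \<in> B \<Longrightarrow> res (emb_X b) = emb_E b"
  using completion_map_ring_hom [OF X.torsion_free_ring_axioms E.torsion_free_ring_axioms cls_hom]
  by (simp_all add: restrict_to_E_def OX_hat_def OE_hat_def emb_E_def carrier_OX)

lemma res_surjective: "y \<in> carrier S \<Longrightarrow> \<exists>x\<in>carrier (OX_hat p a). res x = y"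
  using completion_map_surjective [OF X.torsion_free_ring_axioms E.torsion_free_ring_axioms cls_hom] carrier_OE
  by (simp add: restrict_to_E_def OX_hat_def OE_hat_def)

sublocale res: abelian_group_hom "OX_hat p a" "OE_hat p a c1 c2" "restrict_to_E p a c1 c2"
  by (rule ring_hom_abelian_group_hom [OF res_hom X.S.ring_axioms E.S.ring_axioms])

sublocale \<phi>: abelian_group_hom "OX_hat p a" "OX_hat p a" \<phi>
  by (rule ring_hom_abelian_group_hom [OF \<phi> X.S.ring_axioms X.S.ring_axioms])

text \<open>Since \<phi> H = H^p and \<phi> c = c^p, and H = c on the level set, \<phi> (H - c)
  restricts to c^p - c^p.\<close>

lemma res_\<phi>_generators: "res (\<phi> (emb_X g1)) = \<zero>\<^bsub>S\<^esub>" "res (\<phi> (emb_X g2)) = \<zero>\<^bsub>S\<^esub>"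
proof -
  have gen: "res (\<phi> (emb_X (fr (H - cst c)))) = \<zero>\<^bsub>S\<^esub>"
    if H: "\<phi> (emb_X (fr H)) = emb_X (fr H ^ p)" and c: "\<sigma> c = c ^ p" and I: "fr (H - cst c) \<in> I" for H c
  proof -
    have eq: "emb_E (fr H) = emb_E (fr (cst c))"
      using I by (intro emb_E_eqI) (simp_all add: fr_simps)
    have "fr H = fr (H - cst c) + fr (cst c)" by (simp add: fr_simps)
    then have "emb_X (fr H) = emb_X (fr (H - cst c)) \<oplus>\<^bsub>OX_hat p a\<^esub> emb_X (fr (cst c))"
      by (metis emb_X_add B_closed(1))
    then have "res (\<phi> (emb_X (fr H))) = res (\<phi> (emb_X (fr (H - cst c)))) \<oplus>\<^bsub>S\<^esub> res (\<phi> (emb_X (fr (cst c))))"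
      by (simp add: emb_X_closed)
    moreover have "res (\<phi> (emb_X (fr H))) = emb_E (fr (cst c)) [^]\<^bsub>S\<^esub> p"
      by (simp add: H res_emb emb_E_power eq)
    moreover have "res (\<phi> (emb_X (fr (cst c)))) = emb_E (fr (cst c)) [^]\<^bsub>S\<^esub> p"
      by (simp add: \<phi>_cst c res_emb cst_simps fr_simps emb_E_power)
    ultimately have "emb_E (fr (cst c)) [^]\<^bsub>S\<^esub> p =
        res (\<phi> (emb_X (fr (H - cst c)))) \<oplus>\<^bsub>S\<^esub> emb_E (fr (cst c)) [^]\<^bsub>S\<^esub> p" by simp
    then show ?thesis
      by (simp add: emb_E_closed emb_X_closed E.S.add.l_cancel_one)
  qed
  show "res (\<phi> (emb_X g1)) = \<zero>\<^bsub>S\<^esub>" "res (\<phi> (emb_X g2)) = \<zero>\<^bsub>S\<^esub>"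
    using gen [OF \<phi>_H1 \<sigma>_c(1) generators_I(1)] gen [OF \<phi>_H2 \<sigma>_c(2) generators_I(2)] .
qed

lemma res_\<phi>_ideal:
  assumes "i \<in> I"
  shows "res (\<phi> (emb_X i)) = \<zero>\<^bsub>S\<^esub>"
proof -
  obtain u v where uv: "u \<in> B" "v \<in> B" "i = u * g1 + v * g2" using assms by (auto simp: I_iff)
  have *: "res (\<phi> (emb_X x \<otimes>\<^bsub>OX_hat p a\<^esub> emb_X y)) = res (\<phi> (emb_X x)) \<otimes>\<^bsub>S\<^esub> res (\<phi> (emb_X y))"
    if "x \<in> B" "y \<in> B" for x y
    using that by (simp add: emb_X_closed ring_hom_mult [OF \<phi>] ring_hom_mult [OF res_hom])
  show ?thesis
    using uv by (simp add: emb_X_add emb_X_mult emb_X_closed * res_\<phi>_generators)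
qed

text \<open>The kernel of the completed restriction is not described by generators. Instead x is
  approximated modulo p^n by some b in \<open>B\<close>; then b lies in \<open>I\<close> up to a
  multiple of p^n, the composition of \<phi> with restriction kills \<open>I\<close>, and so the
  restriction of \<phi> x is divisible by every p^n.\<close>

lemma res_\<phi>_kernel:
  assumes x: "x \<in> carrier (OX_hat p a)" and rx: "res x = \<zero>\<^bsub>S\<^esub>"
  shows "res (\<phi> x) = \<zero>\<^bsub>S\<^esub>"
proof (rule E.S.separated)
  show "res (\<phi> x) \<in> carrier S" using x by simp
  fix n
  obtain b where b: "b \<in> B" "congruent_mod (p ^ n) (OX_hat p a) x (emb_X b)"
    using X.dense [OF x] by (auto simp: carrier_OX)
  have "congruent_mod (p ^ n) S (res x) (emb_E b)"
    using res.hom_congruent [OF b(2) x] b(1) by (simp add: emb_X_closed res_emb)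
  then have "emb_E b \<in> multiples S (p ^ n)"
    using E.S.congruent_sym [of "p ^ n" "\<zero>\<^bsub>S\<^esub>" "emb_E b"] b(1) by (simp add: rx emb_E_closed E.S.congruent_zero_iff)
  then obtain i z where iz: "i \<in> I" "z \<in> B" "b = i + of_nat (p ^ n) * z"
    by (rule emb_E_multiple [OF b(1)])
  have "emb_X b = emb_X i \<oplus>\<^bsub>OX_hat p a\<^esub> [(p ^ n)] \<cdot>\<^bsub>OX_hat p a\<^esub> emb_X z"
    unfolding iz(3) using iz(1,2) I_B B_of_nat [of "p ^ n"]
    by (simp add: emb_X_add emb_X_nat_multiple del: of_nat_power)
  then have "res (\<phi> (emb_X b)) = [(p ^ n)] \<cdot>\<^bsub>S\<^esub> res (\<phi> (emb_X z))"
    using iz(1,2) I_B by (simp add: emb_X_closed \<phi>.hom_nat_pow res.hom_nat_pow res_\<phi>_ideal)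
  then have "res (\<phi> (emb_X b)) \<in> multiples S (p ^ n)"
    using iz(2) by (simp add: emb_X_closed E.S.multiplesI)
  moreover have "congruent_mod (p ^ n) S (res (\<phi> x)) (res (\<phi> (emb_X b)))"
    using x b by (intro res.hom_congruent \<phi>.hom_congruent) (simp_all add: emb_X_closed)
  ultimately show "res (\<phi> x) \<in> multiples S (p ^ n)"
    by (rule E.S.multiples_congruent [rotated])
qed

abbreviation "\<Phi> \<equiv> frobenius_E p a c1 c2 \<delta>X"

text \<open>Two lifts of the same function differ by an element of the kernel of restriction, so the
  description in \<open>frobenius_E\<close> determines a unique value.\<close>

lemma \<Phi>_res:
  assumes x: "x \<in> carrier (OX_hat p a)"
  shows "\<Phi> (res x) = res (\<phi> x)"
  unfolding frobenius_E_def
proof (rule the_equality)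
  show "\<exists>x'\<in>carrier (OX_hat p a). res x' = res x \<and> res (\<phi> x) = res (frobenius_of p (OX_hat p a) \<delta>X x')"
    using x by (intro bexI [of _ x]) (simp_all add: \<phi>_\<delta>X)
next
  fix z assume "\<exists>x'\<in>carrier (OX_hat p a). res x' = res x \<and> z = res (frobenius_of p (OX_hat p a) \<delta>X x')"
  then obtain x' where x': "x' \<in> carrier (OX_hat p a)" "res x' = res x" "z = res (\<phi> x')"
    by (auto simp: \<phi>_\<delta>X)
  have "res (x' \<ominus>\<^bsub>OX_hat p a\<^esub> x) = \<zero>\<^bsub>S\<^esub>"
    using x x' by (simp add: res.hom_diff E.S.r_neg a_minus_def)
  then have "res (\<phi> (x' \<ominus>\<^bsub>OX_hat p a\<^esub> x)) = \<zero>\<^bsub>S\<^esub>"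
    using x x' by (intro res_\<phi>_kernel) simp_all
  then have "res (\<phi> x') \<ominus>\<^bsub>S\<^esub> res (\<phi> x) = \<zero>\<^bsub>S\<^esub>"
    using x x' by (simp add: res.hom_diff \<phi>.hom_diff)
  then have "res (\<phi> x') = res (\<phi> x)"
    by (rule E.S.diff_zero_imp_eq) (use x x' in simp_all)
  then show "z = res (\<phi> x)" by (simp add: x'(3))
qed

lemma \<Phi>_emb: "b \<in> B \<Longrightarrow> \<Phi> (emb_E b) = res (\<phi> (emb_X b))"
  using \<Phi>_res [of "emb_X b"] by (simp add: emb_X_closed res_emb)

lemma \<Phi>_hom: "\<Phi> \<in> ring_hom S S"
proof (rule ring_hom_memI)
  fix s assume "s \<in> carrier S"
  then obtain x where x: "x \<in> carrier (OX_hat p a)" "s = res x" using res_surjective by metis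
  show "\<Phi> s \<in> carrier S" using x by (simp add: \<Phi>_res)
  fix t assume "t \<in> carrier S"
  then obtain y where y: "y \<in> carrier (OX_hat p a)" "t = res y" using res_surjective by metis
  show "\<Phi> (s \<otimes>\<^bsub>S\<^esub> t) = \<Phi> s \<otimes>\<^bsub>S\<^esub> \<Phi> t"
    using \<Phi>_res [of "x \<otimes>\<^bsub>OX_hat p a\<^esub> y"] x y
    by (simp add: ring_hom_mult [OF res_hom] \<Phi>_res ring_hom_mult [OF \<phi>])
  show "\<Phi> (s \<oplus>\<^bsub>S\<^esub> t) = \<Phi> s \<oplus>\<^bsub>S\<^esub> \<Phi> t"
    using \<Phi>_res [of "x \<oplus>\<^bsub>OX_hat p a\<^esub> y"] x y by (simp add: \<Phi>_res)
next
  show "\<Phi> \<one>\<^bsub>S\<^esub> = \<one>\<^bsub>S\<^esub>"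
    using \<Phi>_res [of "\<one>\<^bsub>OX_hat p a\<^esub>"] by (simp add: ring_hom_one [OF res_hom] ring_hom_one [OF \<phi>])
qed

lemma \<Phi>_frob: "b \<in> B \<Longrightarrow> congruent_mod p S (\<Phi> (emb_E b)) (emb_E (b ^ p))"
  using res.hom_congruent [OF \<phi>_frob [of "emb_X b"]]
  by (simp add: \<Phi>_emb emb_X_closed emb_X_power [symmetric] res_emb)

end

section \<open>Differentials on a level set\<close>

context level_set
begin

abbreviation "K \<equiv> base_E p a c1 c2"

lemma K_iff: "k \<in> K \<longleftrightarrow> (\<exists>b. k = emb_E (fr (cst b)))"
  by (auto simp: base_E_def fun_E_eq)

sublocale K: kaehler_pullback "OE_hat p a c1 c2" "base_E p a c1 c2" "frobenius_E p a c1 c2 \<delta>X"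
proof (intro kaehler_pullback.intro kaehler_module.intro kaehler_module_axioms.intro kaehler_pullback_axioms.intro)
  show "cring S" by (rule E.S.cring_axioms)
  show "K \<subseteq> carrier S" by (auto simp: K_iff emb_E_closed)
  show "\<Phi> \<in> ring_hom S S" by (rule \<Phi>_hom)
  show "\<Phi> k \<in> K" if "k \<in> K" for k
    using that by (auto simp: K_iff \<Phi>_emb \<phi>_cst res_emb)
qed

abbreviation "\<Omega> \<equiv> kaehler S K"

text \<open>The vector field is tangent to the level set: it kills both generators, so by the
  Leibniz rule only the coefficients are differentiated.\<close>

lemma D_I:
  assumes "i \<in> I"
  shows "D i \<in> I"
proof -
  obtain u v where uv: "u \<in> B" "v \<in> B" "i = u * g1 + v * g2" using assms by (auto simp: I_iff)
  have "D g1 = 0" "D g2 = 0"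
    by (simp_all add: D_fr derivation_diff [OF derivation_vector_field] vector_field_H1 vector_field_H2
        vector_field_cst fr_eq_0_iff)
  then have "D i = D u * g1 + D v * g2"
    by (simp add: uv(3) derivation_add [OF derivation_D] derivation_mult [OF derivation_D] mult.commute)
  then show ?thesis unfolding I_iff using D_B uv(1,2) by blast
qed

text \<open>\<open>D\<close> maps \<open>I\<close> into itself and commutes with multiplication by
  p^n, so it preserves divisibility on the level set and extends by continuity.\<close>

lemma completed_derivation:
  obtains G where "abelian_group_hom S S G" "\<And>b. b \<in> B \<Longrightarrow> G (emb_E b) = emb_E (D b)"
    "\<And>s t. \<lbrakk>s \<in> carrier S; t \<in> carrier S\<rbrakk> \<Longrightarrow> G (s \<otimes>\<^bsub>S\<^esub> t) = s \<otimes>\<^bsub>S\<^esub> G t \<oplus>\<^bsub>S\<^esub> t \<otimes>\<^bsub>S\<^esub> G s"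
proof -
  have g: "abelian_group_hom (OX p a) S (\<lambda>b. emb_E (D b))"
    by (rule abelian_group_homI' [OF X.abelian_group_axioms E.S.abelian_group_axioms])
      (simp_all add: carrier_OX emb_E_closed D_B OX_eq derivation_add [OF derivation_D] emb_E_add)
  have compat: "emb_E (D b) \<in> multiples S (p ^ n)"
    if b: "b \<in> carrier (OX p a)" and m: "emb_E b \<in> multiples S (p ^ n)" for b n
  proof -
    have bB: "b \<in> B" using b by (simp add: carrier_OX)
    obtain i z where iz: "i \<in> I" "z \<in> B" "b = i + of_nat (p ^ n) * z"
      using emb_E_multiple [OF bB m] .
    have "D b = D i + of_nat (p ^ n) * D z"
      unfolding iz(3) by (simp only: derivation_add [OF derivation_D] derivation_mult [OF derivation_D] D_fr_of_nat) simp
    then have "emb_E (D b) = emb_E (D i) \<oplus>\<^bsub>S\<^esub> [(p ^ n)] \<cdot>\<^bsub>S\<^esub> emb_E (D z)"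
      using iz I_B B_of_nat [of "p ^ n"] by (simp add: emb_E_add emb_E_nat_multiple D_B del: of_nat_power)
    then show ?thesis
      using iz by (simp add: emb_E_ideal D_I emb_E_closed D_B E.S.multiplesI)
  qed
  obtain G where G: "abelian_group_hom S S G" "\<And>b. b \<in> carrier (OX p a) \<Longrightarrow> G (emb_E b) = emb_E (D b)"
    by (rule E.extend_hom [OF g E.S.padic_group_axioms compat]) auto
  have G2: "G (emb_E b) = emb_E (D b)" if "b \<in> B" for b
    using G(2) that by (simp add: carrier_OX)
  have "G (s \<otimes>\<^bsub>S\<^esub> t) = s \<otimes>\<^bsub>S\<^esub> G t \<oplus>\<^bsub>S\<^esub> t \<otimes>\<^bsub>S\<^esub> G s" if "s \<in> carrier S" "t \<in> carrier S" for s t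
    by (rule E.extension_derivation [OF G(1) _ that])
      (simp add: carrier_OX OX_eq G2 derivation_mult [OF derivation_D], simp add: emb_E_add emb_E_mult D_B)
  with G(1) G2 show thesis using that by blast
qed

definition tangent_inverse :: "'a poly poly poly fract" where
  "tangent_inverse = (SOME \<tau>. \<tau> \<in> B \<and> fr tangent * \<tau> = 1)"

lemma unit_difference:
  obtains v where "(a 1 - a 2) * v = 1"
  using differences_dvd_1(1) by (metis dvdE)

lemma tangent_inverse: "tangent_inverse \<in> B" "fr tangent * tangent_inverse = 1"
proof -
  obtain v where v: "(a 1 - a 2) * v = 1" by (rule unit_difference)
  let ?g = "at_H a (Npoly a) * at_H a (hasse p a)"
  have Q: "(x1 * x2) * ?g = Qpoly p a" by (simp add: Qpoly_def algebra_simps)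
  have "fr tangent * (fr (cst v) * Fract ?g (Qpoly p a)) =
      fr (cst ((a 1 - a 2) * v)) * (fr (x1 * x2) * Fract ?g (Qpoly p a))"
    unfolding tangent_def by (simp only: cst_simps fr_simps ac_simps)
  also have "\<dots> = 1" unfolding B_divisor(2) [OF Q] v by (simp add: cst_simps fr_simps)
  finally have "fr (cst v) * Fract ?g (Qpoly p a) \<in> B \<and> fr tangent * (fr (cst v) * Fract ?g (Qpoly p a)) = 1"
    using B_divisor(1) [OF Q] by simp
  from someI [of "\<lambda>\<tau>. \<tau> \<in> B \<and> fr tangent * \<tau> = 1", OF this]
  show "tangent_inverse \<in> B" "fr tangent * tangent_inverse = 1"
    by (simp_all add: tangent_inverse_def)
qed

text \<open>The canonical form in the uncompleted module; \<open>omega\<close> is its image in the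
  completion.\<close>

definition omega0 where
  "omega0 = emb_E tangent_inverse \<odot>\<^bsub>\<Omega>\<^esub> K.dd (emb_E (fr x3))"

lemma omega0_closed: "omega0 \<in> carrier \<Omega>"
  by (simp add: omega0_def emb_E_closed tangent_inverse K.dd_closed)

text \<open>The failure of db = D b \<omega>. As a function of b it is additive and satisfies the
  Leibniz rule, so its vanishing can be reduced to the coordinates and the constants.\<close>

definition defect where
  "defect b = K.dd (emb_E b) \<ominus>\<^bsub>\<Omega>\<^esub> emb_E (D b) \<odot>\<^bsub>\<Omega>\<^esub> omega0"

lemma defect_closed: "b \<in> B \<Longrightarrow> defect b \<in> carrier \<Omega>"
  by (simp add: defect_def emb_E_closed D_B K.dd_closed omega0_closed)

lemma defect_add:
  assumes "b \<in> B" "b' \<in> B"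
  shows "defect (b + b') = defect b \<oplus>\<^bsub>\<Omega>\<^esub> defect b'"
proof -
  have "defect (b + b') = (K.dd (emb_E b) \<oplus>\<^bsub>\<Omega>\<^esub> K.dd (emb_E b')) \<ominus>\<^bsub>\<Omega>\<^esub>
      (emb_E (D b) \<odot>\<^bsub>\<Omega>\<^esub> omega0 \<oplus>\<^bsub>\<Omega>\<^esub> emb_E (D b') \<odot>\<^bsub>\<Omega>\<^esub> omega0)"
    using assms by (simp add: defect_def derivation_add [OF derivation_D] emb_E_add D_B K.dd_add emb_E_closed
        K.Omega.smult_l_distr omega0_closed)
  then show ?thesis
    using assms by (simp add: defect_def emb_E_closed D_B K.dd_closed omega0_closed
        a_minus_def K.Omega.M.minus_add K.Omega.M.a_ac)
qed

lemma defect_mult: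
  assumes "b \<in> B" "b' \<in> B"
  shows "defect (b * b') = emb_E b \<odot>\<^bsub>\<Omega>\<^esub> defect b' \<oplus>\<^bsub>\<Omega>\<^esub> emb_E b' \<odot>\<^bsub>\<Omega>\<^esub> defect b"
proof -
  have "defect (b * b') = (emb_E b \<odot>\<^bsub>\<Omega>\<^esub> K.dd (emb_E b') \<oplus>\<^bsub>\<Omega>\<^esub> emb_E b' \<odot>\<^bsub>\<Omega>\<^esub> K.dd (emb_E b)) \<ominus>\<^bsub>\<Omega>\<^esub>
      (emb_E b \<odot>\<^bsub>\<Omega>\<^esub> (emb_E (D b') \<odot>\<^bsub>\<Omega>\<^esub> omega0) \<oplus>\<^bsub>\<Omega>\<^esub> emb_E b' \<odot>\<^bsub>\<Omega>\<^esub> (emb_E (D b) \<odot>\<^bsub>\<Omega>\<^esub> omega0))"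
    using assms by (simp add: defect_def derivation_mult [OF derivation_D] emb_E_add emb_E_mult D_B K.dd_mult emb_E_closed
        K.Omega.smult_l_distr K.Omega.smult_assoc1 omega0_closed)
  then show ?thesis
    using assms by (simp add: defect_def emb_E_closed D_B K.dd_closed omega0_closed K.Omega.smult_r_distr
        K.Omega.smult_r_minus a_minus_def K.Omega.M.minus_add K.Omega.M.a_ac)
qed

lemma defect_cst: "defect (fr (cst c)) = \<zero>\<^bsub>\<Omega>\<^esub>"
proof -
  have "emb_E (fr (cst c)) \<in> K" by (auto simp: K_iff)
  then show ?thesis
    by (simp add: defect_def K.dd_const D_fr vector_field_cst fr_simps emb_E_zero omega0_closed K.Omega.smult_l_null
        a_minus_def K.Omega.M.r_neg)
qed

lemma defect_x3: "defect (fr x3) = \<zero>\<^bsub>\<Omega>\<^esub>"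
proof -
  have "emb_E (fr tangent) \<odot>\<^bsub>\<Omega>\<^esub> omega0 = emb_E (fr tangent * tangent_inverse) \<odot>\<^bsub>\<Omega>\<^esub> K.dd (emb_E (fr x3))"
    by (simp add: omega0_def emb_E_mult tangent_inverse(1) K.Omega.smult_assoc1 emb_E_closed K.dd_closed)
  also have "\<dots> = K.dd (emb_E (fr x3))"
    by (simp add: tangent_inverse(2) emb_E_one K.dd_closed emb_E_closed)
  finally show ?thesis
    unfolding defect_def D_fr vector_field_x3 tangent_def [symmetric]
    by (simp add: a_minus_def K.Omega.M.r_neg K.dd_closed emb_E_closed)
qed

lemma unit_cancel:
  assumes "b \<in> B" "b' \<in> B" "b * b' = 1" "x \<in> carrier \<Omega>" "emb_E b \<odot>\<^bsub>\<Omega>\<^esub> x = \<zero>\<^bsub>\<Omega>\<^esub>"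
  shows "x = \<zero>\<^bsub>\<Omega>\<^esub>"
proof -
  have "emb_E b' \<odot>\<^bsub>\<Omega>\<^esub> (emb_E b \<odot>\<^bsub>\<Omega>\<^esub> x) = emb_E (b * b') \<odot>\<^bsub>\<Omega>\<^esub> x"
    using assms(1,2,4) by (simp add: emb_E_mult K.Omega.smult_assoc1 [symmetric] emb_E_closed E.S.m_comm)
  then show ?thesis
    using assms by (simp add: emb_E_one emb_E_closed)
qed

lemma B_double: "b \<in> B \<Longrightarrow> 2 * b \<in> B"
  unfolding mult_2 by (rule B_closed(5))

lemma defect_square: "b \<in> B \<Longrightarrow> defect (b ^ 2) = emb_E (2 * b) \<odot>\<^bsub>\<Omega>\<^esub> defect b"
  unfolding power2_eq_square mult_2
  by (simp only: defect_mult emb_E_add K.Omega.smult_l_distr emb_E_closed defect_closed)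

text \<open>The defect depends on b only through its restriction to the level set and
  \<open>D b\<close>; for H1 and H2 both are those of a constant.\<close>

lemma defect_H: "defect (fr (H1 a)) = \<zero>\<^bsub>\<Omega>\<^esub>" "defect (fr H2) = \<zero>\<^bsub>\<Omega>\<^esub>"
proof -
  have gen: "defect (fr H) = \<zero>\<^bsub>\<Omega>\<^esub>" if "vector_field a H = 0" "fr (H - cst c) \<in> I" for H c
  proof -
    have "emb_E (fr H) = emb_E (fr (cst c))"
      using that(2) by (intro emb_E_eqI) (simp_all add: fr_simps)
    moreover have "D (fr H) = D (fr (cst c))"
      using that(1) by (simp add: D_fr vector_field_cst)
    ultimately have "defect (fr H) = defect (fr (cst c))" by (simp add: defect_def)
    then show ?thesis by (simp add: defect_cst)
  qed
  show "defect (fr (H1 a)) = \<zero>\<^bsub>\<Omega>\<^esub>" "defect (fr H2) = \<zero>\<^bsub>\<Omega>\<^esub>"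
    using gen [OF vector_field_H1 generators_I(1)] gen [OF vector_field_H2 generators_I(2)] .
qed

text \<open>As the defect of x3 vanishes, those of H1 and H2 give two linear equations for the
  defects of x1^2 and x2^2, with determinant a1 - a2, a unit. From the squares one descends because
  2 x1 and 2 x2 are invertible.\<close>

lemma defect_x12: "defect (fr x1) = \<zero>\<^bsub>\<Omega>\<^esub>" "defect (fr x2) = \<zero>\<^bsub>\<Omega>\<^esub>"
proof -
  let ?X = "defect (fr x1 ^ 2)" and ?Y = "defect (fr x2 ^ 2)"
  have closed: "?X \<in> carrier \<Omega>" "?Y \<in> carrier \<Omega>" by (simp_all add: defect_closed)
  have Z: "defect (fr x3 ^ 2) = \<zero>\<^bsub>\<Omega>\<^esub>" by (simp add: defect_square defect_x3 emb_E_closed B_double K.Omega.smult_r_null)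
  have cst_mult: "defect (fr (cst c) * b) = emb_E (fr (cst c)) \<odot>\<^bsub>\<Omega>\<^esub> defect b" if "b \<in> B" for c b
    using that by (simp add: defect_mult defect_cst emb_E_closed K.Omega.smult_r_null defect_closed)
  have "fr (H1 a) = fr (cst (a 1)) * fr x1 ^ 2 + fr (cst (a 2)) * fr x2 ^ 2 + fr (cst (a 3)) * fr x3 ^ 2"
    unfolding H1_def by (simp only: fr_simps)
  then have "defect (fr (H1 a)) = emb_E (fr (cst (a 1))) \<odot>\<^bsub>\<Omega>\<^esub> ?X \<oplus>\<^bsub>\<Omega>\<^esub> emb_E (fr (cst (a 2))) \<odot>\<^bsub>\<Omega>\<^esub> ?Y"
    using closed by (simp add: defect_add cst_mult Z emb_E_closed K.Omega.smult_r_null)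
  then have 1: "emb_E (fr (cst (a 1))) \<odot>\<^bsub>\<Omega>\<^esub> ?X \<oplus>\<^bsub>\<Omega>\<^esub> emb_E (fr (cst (a 2))) \<odot>\<^bsub>\<Omega>\<^esub> ?Y = \<zero>\<^bsub>\<Omega>\<^esub>"
    by (simp add: defect_H)
  have "fr (H2 :: 'a poly poly poly) = fr x1 ^ 2 + fr x2 ^ 2 + fr x3 ^ 2"
    unfolding H2_def by (simp only: fr_simps)
  then have "defect (fr H2) = ?X \<oplus>\<^bsub>\<Omega>\<^esub> ?Y"
    using closed by (simp add: defect_add Z)
  then have 2: "?X \<oplus>\<^bsub>\<Omega>\<^esub> ?Y = \<zero>\<^bsub>\<Omega>\<^esub>" by (simp add: defect_H)
  then have Y: "?Y = \<ominus>\<^bsub>\<Omega>\<^esub> ?X"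
    using closed K.Omega.M.minus_equality [of ?Y ?X] by (simp add: K.Omega.M.a_comm)
  have a: "fr (cst (a 1)) = fr (cst (a 1 - a 2)) + fr (cst (a 2))" by (simp add: cst_simps fr_simps)
  have "emb_E (fr (cst (a 1 - a 2))) \<odot>\<^bsub>\<Omega>\<^esub> ?X = \<zero>\<^bsub>\<Omega>\<^esub>"
    using 1 closed(1) unfolding Y a
    by (simp add: emb_E_add emb_E_closed K.Omega.smult_l_distr K.Omega.smult_r_minus K.Omega.M.a_assoc K.Omega.M.r_neg)
  moreover obtain v where v: "(a 1 - a 2) * v = 1" by (rule unit_difference)
  have "fr (cst ((a 1 - a 2) * v)) = 1" unfolding v by (simp add: cst_simps fr_simps)
  then have "fr (cst (a 1 - a 2)) * fr (cst v) = 1" by (simp only: cst_simps fr_simps)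
  ultimately have X: "?X = \<zero>\<^bsub>\<Omega>\<^esub>"
    using closed(1) unit_cancel [of "fr (cst (a 1 - a 2))" "fr (cst v)" ?X] by simp
  then have Y: "?Y = \<zero>\<^bsub>\<Omega>\<^esub>" using Y by simp
  have *: "defect (fr x) = \<zero>\<^bsub>\<Omega>\<^esub>" if x: "x * g = Qpoly p a" and sq: "defect (fr x ^ 2) = \<zero>\<^bsub>\<Omega>\<^esub>" for x g
  proof (rule unit_cancel [of "2 * fr x" "fr (cst (nat_inverse 2)) * Fract g (Qpoly p a)"])
    have "(2 * fr x) * (fr (cst (nat_inverse 2)) * Fract g (Qpoly p a)) =
        (2 * fr (cst (nat_inverse 2))) * (fr x * Fract g (Qpoly p a))" by (simp only: ac_simps)
    then show "(2 * fr x) * (fr (cst (nat_inverse 2)) * Fract g (Qpoly p a)) = 1"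
      unfolding fr_half B_divisor(2) [OF x] by simp
    show "2 * fr x \<in> B" by (rule B_double) simp
    show "emb_E (2 * fr x) \<odot>\<^bsub>\<Omega>\<^esub> defect (fr x) = \<zero>\<^bsub>\<Omega>\<^esub>" using sq by (simp add: defect_square)
  qed (simp_all add: B_divisor(1) [OF x] defect_closed)
  have "x1 * (x2 * at_H a (Npoly a) * at_H a (hasse p a)) = Qpoly p a"
    "x2 * (x1 * at_H a (Npoly a) * at_H a (hasse p a)) = Qpoly p a"
    by (simp_all add: Qpoly_def algebra_simps)
  then show "defect (fr x1) = \<zero>\<^bsub>\<Omega>\<^esub>" "defect (fr x2) = \<zero>\<^bsub>\<Omega>\<^esub>"
    using * X Y by blast+
qed

text \<open>Polynomials follow by induction from the generators. For a fraction b with denominator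
  q, the Leibniz rule applied to b q leaves q times the defect of b, and q is a unit.\<close>

lemma defect_zero:
  assumes b: "b \<in> B"
  shows "defect b = \<zero>\<^bsub>\<Omega>\<^esub>"
proof -
  have fr: "defect (fr f) = \<zero>\<^bsub>\<Omega>\<^esub>" for f
  proof (induction f rule: poly3_induct)
    case (add f g)
    then show ?case by (simp add: fr_simps defect_add)
  next
    case (mult f g)
    then show ?case by (simp add: fr_simps defect_mult emb_E_closed K.Omega.smult_r_null)
  qed (simp_all add: defect_cst defect_x12 defect_x3)
  obtain f n where f: "b = Fract f (Qpoly p a ^ n)" using b by (auto simp: B_def)
  let ?q = "Qpoly p a ^ n"
  have q: "?q \<noteq> 0" using Qpoly_nonzero by simp
  have "b * fr ?q = fr f" using q by (simp add: f mult_fract eq_fract)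
  then have "defect (b * fr ?q) = \<zero>\<^bsub>\<Omega>\<^esub>" using fr by simp
  then have "emb_E (fr ?q) \<odot>\<^bsub>\<Omega>\<^esub> defect b = \<zero>\<^bsub>\<Omega>\<^esub>"
    using b by (simp add: defect_mult fr emb_E_closed K.Omega.smult_r_null defect_closed)
  moreover have "Fract 1 ?q \<in> B" unfolding B_def by blast
  moreover have "fr ?q * Fract 1 ?q = 1" using q by (simp add: One_fract_def mult_fract eq_fract)
  ultimately show ?thesis
    using unit_cancel [of "fr ?q" "Fract 1 ?q" "defect b"] b by (simp add: defect_closed)
qed

lemma dd_emb: "b \<in> B \<Longrightarrow> K.dd (emb_E b) = emb_E (D b) \<odot>\<^bsub>\<Omega>\<^esub> omega0"
  by (rule K.Omega.M.diff_zero_imp_eq [OF defect_zero [unfolded defect_def]])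
    (simp_all add: K.dd_closed emb_E_closed D_B omega0_closed)

text \<open>Modulo p^n the form \<open>omega0\<close> generates the differentials, and the linear
  form l induced by \<open>D\<close> gives the coefficient. If p x is divisible by p^(n + 1), so is
  p l x in the torsion-free ring of functions; hence l x, and with it x, is divisible by
  p^n.\<close>

lemma Omega_torsion:
  assumes x: "x \<in> carrier \<Omega>" and px: "[p] \<cdot>\<^bsub>\<Omega>\<^esub> x \<in> multiples \<Omega> (p ^ Suc n)"
  shows "x \<in> multiples \<Omega> (p ^ n)"
proof -
  obtain G where G: "abelian_group_hom S S G" "\<And>b. b \<in> B \<Longrightarrow> G (emb_E b) = emb_E (D b)"
    "\<And>s t. \<lbrakk>s \<in> carrier S; t \<in> carrier S\<rbrakk> \<Longrightarrow> G (s \<otimes>\<^bsub>S\<^esub> t) = s \<otimes>\<^bsub>S\<^esub> G t \<oplus>\<^bsub>S\<^esub> t \<otimes>\<^bsub>S\<^esub> G s"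
    by (rule completed_derivation) blast
  have Gk: "G k = \<zero>\<^bsub>S\<^esub>" if "k \<in> K" for k
    using that by (auto simp: K_iff G(2) D_fr vector_field_cst fr_simps emb_E_zero)
  obtain l where l: "abelian_group_hom \<Omega> S l"
    "\<And>r x. \<lbrakk>r \<in> carrier S; x \<in> carrier \<Omega>\<rbrakk> \<Longrightarrow> l (r \<odot>\<^bsub>\<Omega>\<^esub> x) = r \<otimes>\<^bsub>S\<^esub> l x"
    "\<And>g. g \<in> carrier S \<Longrightarrow> l (K.dd g) = G g"
    by (rule K.derivation_linear_form [OF G(1) G(3) Gk]) auto
  interpret G: abelian_group_hom S S G by (rule G(1))
  interpret l: abelian_group_hom \<Omega> S l by (rule l(1))
  interpret dd: abelian_group_hom S \<Omega> K.dd by (rule K.dd_hom)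
  have generator: "congruent_mod (p ^ n) \<Omega> y (l y \<odot>\<^bsub>\<Omega>\<^esub> omega0)" if "y \<in> carrier \<Omega>" for y
    using that
  proof (induction y rule: K.kaehler_induct)
    case zero
    then show ?case
      by (simp add: omega0_closed K.Omega.smult_l_null K.Omega.M.congruent_refl)
  next
    case (add x y)
    then show ?case
      by (simp add: omega0_closed K.Omega.smult_l_distr K.Omega.M.congruent_add)
  next
    case (smult r x)
    then have "congruent_mod (p ^ n) \<Omega> (r \<odot>\<^bsub>\<Omega>\<^esub> x) (r \<odot>\<^bsub>\<Omega>\<^esub> (l x \<odot>\<^bsub>\<Omega>\<^esub> omega0))"
      by (intro abelian_group_hom.hom_congruent [OF K.Omega.smult_hom]) (simp_all add: omega0_closed)
    then show ?case
      using smult by (simp add: l(2) K.Omega.smult_assoc1 omega0_closed)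
  next
    case (dd g)
    \<comment> \<open>For a function g of the completed ring, dg is compared with db for an
      approximation b in \<open>B\<close>, where \<open>dd_emb\<close> applies; additivity of the
      differential and of \<open>G\<close> preserves congruences modulo p^n.\<close>
    obtain b where b: "b \<in> B" "congruent_mod (p ^ n) S g (emb_E b)"
      using E.dense [OF dd] by (auto simp: carrier_OX)
    have 1: "congruent_mod (p ^ n) \<Omega> (K.dd g) (K.dd (emb_E b))"
      using dd.hom_congruent [OF b(2)] dd b(1) by (simp add: emb_E_closed)
    have "congruent_mod (p ^ n) S (G g) (G (emb_E b))"
      using G.hom_congruent [OF b(2)] dd b(1) by (simp add: emb_E_closed)
    then have "congruent_mod (p ^ n) S (G (emb_E b)) (G g)"
      by (rule E.S.congruent_sym) (use dd b(1) in \<open>simp_all add: emb_E_closed\<close>)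
    then have 2: "congruent_mod (p ^ n) \<Omega> (G (emb_E b) \<odot>\<^bsub>\<Omega>\<^esub> omega0) (G g \<odot>\<^bsub>\<Omega>\<^esub> omega0)"
      using dd b(1) by (intro K.Omega.congruent_smult_l) (simp_all add: emb_E_closed omega0_closed)
    have "K.dd (emb_E b) = G (emb_E b) \<odot>\<^bsub>\<Omega>\<^esub> omega0"
      using b(1) by (simp add: G(2) dd_emb)
    then show ?case
      using K.Omega.M.congruent_trans [OF 1, of "G g \<odot>\<^bsub>\<Omega>\<^esub> omega0"] 2 dd b(1)
      by (simp add: l(3) emb_E_closed omega0_closed)
  qed
  have "[p] \<cdot>\<^bsub>S\<^esub> l x \<in> multiples S (p ^ Suc n)"
    using l.hom_multiples [OF px] x by (simp add: l.hom_nat_pow)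
  then have "l x \<in> multiples S (p ^ n)"
    by (rule E.S.torsion_imp_multiples [rotated 2]) (use x E.S.torsion_free in auto)
  then obtain z where z: "z \<in> carrier S" "l x = [(p ^ n)] \<cdot>\<^bsub>S\<^esub> z" by (rule E.S.multiplesE)
  then have "l x \<odot>\<^bsub>\<Omega>\<^esub> omega0 \<in> multiples \<Omega> (p ^ n)"
    by (simp add: K.Omega.smult_nat_pow_l omega0_closed K.Omega.M.multiplesI)
  then show ?thesis
    using generator [OF x] by (rule K.Omega.M.multiples_congruent [rotated])
qed

section \<open>The congruence for \<omega>\<close>

sublocale M: torsion_free_completion "kaehler (OE_hat p a c1 c2) (base_E p a c1 c2)" p
  "module_completion p (kaehler (OE_hat p a c1 c2) (base_E p a c1 c2))"
  by (rule torsion_free_completion.intro [OF K.Omega.module_completion torsion_free_completion_axioms.intro])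
    (rule Omega_torsion)

lemma forms_E_eq: "forms_E p a c1 c2 = module_completion p \<Omega>"
  by (simp add: completed_forms_def)

lemma inverse_unique:
  assumes "b \<in> B" "b' \<in> B" "b * b' = 1"
  shows "inv\<^bsub>S\<^esub> (emb_E b) = emb_E b'"
proof (rule E.S.comm_inv_char)
  show "emb_E b \<otimes>\<^bsub>S\<^esub> emb_E b' = \<one>\<^bsub>S\<^esub>"
    using assms by (simp add: emb_E_mult [symmetric] emb_E_one)
qed (use assms in \<open>simp_all add: emb_E_closed\<close>)

lemma omega_eq: "omega p a c1 c2 = to_completion p \<Omega> omega0"
proof -
  have "inv\<^bsub>S\<^esub> (fun_E p a c1 c2 (cst (a 1 - a 2) * x1 * x2)) = emb_E tangent_inverse"
    unfolding fun_E_eq tangent_def [symmetric]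
    by (rule inverse_unique) (simp_all add: tangent_inverse)
  moreover have "differential p S K (fun_E p a c1 c2 x3) = to_completion p \<Omega> (K.dd (emb_E (fr x3)))"
    by (simp add: differential_def fun_E_eq K.dd_def)
  ultimately show ?thesis
    unfolding omega_def forms_E_eq omega0_def
    by (simp add: K.Omega.module_completion_smult emb_E_closed tangent_inverse K.dd_closed)
qed

text \<open>The two sides are homomorphisms on A[z1, z2] that agree on constants, z1 and z2, because
  H1 = c1 and H2 = c2 on the level set. This turns the Hasse invariant of (H1, H2) into the scalar
  of the claim.\<close>

lemma emb_at_H: "emb_E (fr (at_H a f)) = emb_E (fr (cst (eval2 id f c1 c2)))"
proof -
  have id: "type_hom (id :: 'a \<Rightarrow> 'a)" by (rule type_homI) simp_all
  have emb: "(\<lambda>f. emb_E (fr f)) \<in> ring_hom (type_ring UNIV) S"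
    by (intro ring_hom_memI) (simp_all add: emb_E_closed fr_simps emb_E_add emb_E_mult emb_E_one)
  have H: "emb_E (fr (H1 a)) = emb_E (fr (cst c1))" "emb_E (fr H2) = emb_E (fr (cst c2))"
    using emb_E_eqI [of "fr (H1 a)" "fr (cst c1)"] emb_E_eqI [of "fr H2" "fr (cst c2)"] generators_I
    by (simp_all add: fr_simps)
  have "((\<lambda>f. emb_E (fr f)) \<circ> at_H a) f = ((\<lambda>f. emb_E (fr f)) \<circ> (cst \<circ> (\<lambda>f. eval2 id f c1 c2))) f"
    by (rule hom_poly2_eqI [OF E.S.cring_axioms ring_hom_trans [OF type_hom_at_H emb]
          ring_hom_trans [OF ring_hom_trans [OF type_hom_eval2 [OF id] type_hom_cst] emb]])
      (simp_all add: eval2_generators [OF type_hom_cst] eval2_generators [OF id] H)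
  then show ?thesis by simp
qed

text \<open>With \<omega> = dx3 / t, its pullback is \<phi> (1/t) d (\<phi> x3), and
  \<open>D_frob_x3\<close> supplies the factor p of d (\<phi> x3).\<close>

lemma pull_omega0:
  "K.pull omega0 = [p] \<cdot>\<^bsub>\<Omega>\<^esub> ((\<Phi> (emb_E tangent_inverse) \<otimes>\<^bsub>S\<^esub> emb_E (eta * fr tangent ^ p)) \<odot>\<^bsub>\<Omega>\<^esub> omega0)"
proof -
  let ?h = "\<Phi> (emb_E tangent_inverse)" and ?u = "eta * fr tangent ^ p"
  have h: "?h \<in> carrier S" by (rule K.\<phi>_closed) (simp add: emb_E_closed tangent_inverse)
  have u: "?u \<in> B" using eta by simp
  have "K.pull omega0 = ?h \<odot>\<^bsub>\<Omega>\<^esub> K.dd (\<Phi> (emb_E (fr x3)))"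
    by (simp add: omega0_def K.pull_smult K.pull_dd emb_E_closed tangent_inverse K.dd_closed)
  also have "\<Phi> (emb_E (fr x3)) = emb_E frob_x3"
    by (simp add: \<Phi>_emb \<phi>_x3 res_emb frob_x3_B)
  also have "K.dd (emb_E frob_x3) = ([p] \<cdot>\<^bsub>S\<^esub> emb_E ?u) \<odot>\<^bsub>\<Omega>\<^esub> omega0"
    using u by (simp add: dd_emb frob_x3_B D_frob_x3 emb_E_nat_multiple)
  also have "?h \<odot>\<^bsub>\<Omega>\<^esub> (([p] \<cdot>\<^bsub>S\<^esub> emb_E ?u) \<odot>\<^bsub>\<Omega>\<^esub> omega0) = ([p] \<cdot>\<^bsub>S\<^esub> (?h \<otimes>\<^bsub>S\<^esub> emb_E ?u)) \<odot>\<^bsub>\<Omega>\<^esub> omega0"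
    using h u by (simp add: K.Omega.smult_assoc1 [symmetric] emb_E_closed omega0_closed E.S.add_pow_rdistr)
  finally show ?thesis
    using h u by (simp add: K.Omega.smult_nat_pow_l emb_E_closed omega0_closed)
qed

text \<open>Modulo p, \<phi> (1/t) is t^(-p), which cancels the factor t^p in
  \<open>pull_omega0\<close> and leaves \<open>eta\<close>, the inverse of the Hasse
  invariant.\<close>

lemma frobenius_omega:
  "congruent_mod p (forms_E p a c1 c2)
     (frobenius_pullback_div_p p a c1 c2 \<delta>X (omega p a c1 c2))
     (inv\<^bsub>S\<^esub> (fun_E p a c1 c2 (cst (eval2 id (hasse p a) c1 c2)))
        \<odot>\<^bsub>forms_E p a c1 c2\<^esub> omega p a c1 c2)"
proof -
  let ?h = "\<Phi> (emb_E tangent_inverse)" and ?u = "eta * fr tangent ^ p"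
  let ?r = "?h \<otimes>\<^bsub>S\<^esub> emb_E ?u"
  have h: "?h \<in> carrier S" by (rule K.\<phi>_closed) (simp add: emb_E_closed tangent_inverse)
  have u: "?u \<in> B" using eta by simp
  have r: "?r \<in> carrier S" using h u by (simp add: emb_E_closed)
  let ?y = "to_completion p \<Omega> (?r \<odot>\<^bsub>\<Omega>\<^esub> omega0)"
  have y: "?y \<in> carrier (module_completion p \<Omega>)"
    using r by (simp add: M.emb_closed omega0_closed)
  have pull: "forms_pullback p S K \<Phi> (omega p a c1 c2) = [p] \<cdot>\<^bsub>module_completion p \<Omega>\<^esub> ?y"
    unfolding forms_pullback_def omega_eq to_completion_conv
    using K.Omega.M.completion_map_thread [OF K.pull_hom K.Omega.M.abelian_group_axioms, of "\<lambda>_. omega0" p] r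
    by (simp add: omega0_closed pull_omega0 M.thr_nat_pow)
  interpret Mp: padic_group "module_completion p \<Omega>" p by (rule M.completion_padic_group)
  have div: "frobenius_pullback_div_p p a c1 c2 \<delta>X (omega p a c1 c2) = ?y"
    unfolding frobenius_pullback_div_p_def forms_E_eq divide_by_def pull
    using y by (intro the_equality) (auto intro: Mp.cancel)
  have "congruent_mod p S ?h (emb_E (tangent_inverse ^ p))"
    by (rule \<Phi>_frob [OF tangent_inverse(1)])
  then have "congruent_mod p S ?r (emb_E (tangent_inverse ^ p) \<otimes>\<^bsub>S\<^esub> emb_E ?u)"
    using h u by (intro E.S.congruent_mult E.S.congruent_refl) (simp_all add: emb_E_closed tangent_inverse)
  also have "emb_E (tangent_inverse ^ p) \<otimes>\<^bsub>S\<^esub> emb_E ?u = emb_E (eta * (fr tangent * tangent_inverse) ^ p)"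
    using u tangent_inverse(1) by (simp add: emb_E_mult [symmetric] power_mult_distrib ac_simps)
  finally have "congruent_mod p S ?r (emb_E eta)" by (simp add: tangent_inverse(2))
  then have "congruent_mod p \<Omega> (?r \<odot>\<^bsub>\<Omega>\<^esub> omega0) (emb_E eta \<odot>\<^bsub>\<Omega>\<^esub> omega0)"
    using r by (intro K.Omega.congruent_smult_l) (simp_all add: emb_E_closed eta omega0_closed)
  then have "congruent_mod p (module_completion p \<Omega>) ?y (to_completion p \<Omega> (emb_E eta \<odot>\<^bsub>\<Omega>\<^esub> omega0))"
    using r by (intro M.emb_congruent) (simp_all add: emb_E_closed eta omega0_closed)
  moreover have "inv\<^bsub>S\<^esub> (fun_E p a c1 c2 (cst (eval2 id (hasse p a) c1 c2))) = emb_E eta"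
    unfolding fun_E_eq emb_at_H [symmetric] by (rule inverse_unique) (simp_all add: eta)
  ultimately show ?thesis
    unfolding div forms_E_eq
    by (simp add: omega_eq K.Omega.module_completion_smult emb_E_closed eta omega0_closed)
qed

end

section \<open>The base ring and the final assembly\<close>

lemma local_of_complete:
  fixes p :: nat
  assumes max: "maximalideal (PIdl\<^bsub>type_ring UNIV\<^esub> (of_nat p)) (type_ring (UNIV :: 'a::idom set))"
    and complete: "padically_complete p (type_ring (UNIV :: 'a set))"
    and p: "of_nat p \<noteq> (0::'a)"
  shows "\<not> of_nat p dvd (1::'a)" and "\<not> of_nat p dvd (x::'a) \<Longrightarrow> x dvd 1"
proof -
  let ?A = "type_ring (UNIV :: 'a set)"
  interpret A: torsion_free_ring ?A p
    by (intro torsion_free_ring.intro torsion_free_ring_axioms.intro cring_type_ring_UNIV) (use p in simp)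
  interpret A: padic_ring ?A p by (rule A.padic_ring_of_complete [OF complete])
  interpret M: maximalideal "PIdl\<^bsub>?A\<^esub> (of_nat p)" ?A by fact
  have PIdl: "PIdl\<^bsub>?A\<^esub> y = {z. y dvd z}" for y :: 'a
    by (auto simp: cgenideal_def dvd_def mult.commute)
  show "\<not> of_nat p dvd (1::'a)"
    using M.I_notcarr by (auto simp: PIdl intro: dvd_trans [OF _ one_dvd])
  assume x: "\<not> of_nat p dvd x"
  \<comment> \<open>The ideal (x, p). Being strictly larger than the maximal ideal (p), it contains
    1, so x is invertible modulo p; completeness then makes it a unit.\<close>
  let ?J = "{z. \<exists>u v. z = u * x + v * of_nat p}"
  have "ideal ?J ?A"
  proof (rule idealI)
    show "ring ?A" by (rule A.ring_axioms)
    show "subgroup ?J (add_monoid ?A)"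
    proof (rule A.add.subgroupI)
      fix y assume "y \<in> ?J"
      then obtain u v where "y = u * x + v * of_nat p" by blast
      moreover have "\<ominus>\<^bsub>?A\<^esub> y = - y" using type_ring_minus [OF cring_type_ring_UNIV] by blast
      ultimately have "\<ominus>\<^bsub>?A\<^esub> y = (- u) * x + (- v) * of_nat p" by simp
      then show "\<ominus>\<^bsub>?A\<^esub> y \<in> ?J" by blast
      fix y' assume "y' \<in> ?J"
      then obtain u' v' where "y' = u' * x + v' * of_nat p" by blast
      with \<open>y = _\<close> have "y + y' = (u + u') * x + (v + v') * of_nat p" by (simp add: algebra_simps)
      then show "y \<oplus>\<^bsub>?A\<^esub> y' \<in> ?J" by auto
    qed auto
    fix y z assume "y \<in> ?J" and "z \<in> carrier ?A"
    then obtain u v where "y = u * x + v * of_nat p" by blast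
    then have "z * y = (z * u) * x + (z * v) * of_nat p" "y * z = (z * u) * x + (z * v) * of_nat p"
      by (simp_all add: algebra_simps)
    then show "z \<otimes>\<^bsub>?A\<^esub> y \<in> ?J" "y \<otimes>\<^bsub>?A\<^esub> z \<in> ?J" by auto
  qed
  moreover have "PIdl\<^bsub>?A\<^esub> (of_nat p) \<subseteq> ?J"
  proof
    fix z assume "z \<in> PIdl\<^bsub>?A\<^esub> (of_nat p)"
    then obtain v where "z = 0 * x + v * of_nat p" by (auto simp: PIdl dvd_def mult.commute)
    then show "z \<in> ?J" by blast
  qed
  ultimately have "?J = PIdl\<^bsub>?A\<^esub> (of_nat p) \<or> ?J = UNIV"
    using M.I_maximal [of ?J] by simp
  moreover have "x = 1 * x + 0 * of_nat p" by simp
  then have "x \<in> ?J" by blast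
  then have "?J \<noteq> PIdl\<^bsub>?A\<^esub> (of_nat p)" using x by (auto simp: PIdl)
  ultimately have "1 \<in> ?J" by simp
  then obtain u v where uv: "1 = u * x + v * of_nat p" by blast
  have "x \<in> Units ?A"
    by (rule A.unit_of_congruent_unit [of _ u])
      (auto simp: type_ring_congruent uv intro!: exI [of _ "- v"] simp: algebra_simps)
  then show "x dvd 1" by (auto simp: Units_def dvd_def)
qed

theorem theorem6p1:
  fixes p :: nat and a :: "nat \<Rightarrow> 'a::idom" and \<delta> :: "'a \<Rightarrow> 'a"
  assumes "Factorial_Ring.prime p" and "odd p"
    and "discrete_valuation_ring (type_ring (UNIV :: 'a set))"
    and "maximalideal (PIdl\<^bsub>type_ring UNIV\<^esub> (of_nat p)) (type_ring (UNIV :: 'a set))"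
    and "padically_complete p (type_ring (UNIV :: 'a set))"
    and "residue_field_algebraic p (type_ring (UNIV :: 'a set))"
    and "p_derivation p (type_ring UNIV) \<delta>"
    and "(a 1 - a 2) * (a 2 - a 3) * (a 3 - a 1) dvd 1"
  shows "\<exists>\<delta>X. p_derivation p (OX_hat p a) \<delta>X \<and>
    (\<forall>b. \<delta>X (fun_X p a (cst b)) = fun_X p a (cst (\<delta> b))) \<and>
    \<delta>X (fun_X p a (H1 a)) = \<zero>\<^bsub>OX_hat p a\<^esub> \<and>
    \<delta>X (fun_X p a H2) = \<zero>\<^bsub>OX_hat p a\<^esub> \<and>
    (\<forall>c1 c2. \<delta> c1 = 0 \<longrightarrow> \<delta> c2 = 0 \<longrightarrow>
       \<not> of_nat p dvd eval2 id (Npoly a) c1 c2 * eval2 id (hasse p a) c1 c2 \<longrightarrow>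
       congruent_mod p (forms_E p a c1 c2)
         (frobenius_pullback_div_p p a c1 c2 \<delta>X (omega p a c1 c2))
         (inv\<^bsub>OE_hat p a c1 c2\<^esub> (fun_E p a c1 c2 (cst (eval2 id (hasse p a) c1 c2)))
            \<odot>\<^bsub>forms_E p a c1 c2\<^esub> omega p a c1 c2))"
proof -
  let ?A = "type_ring (UNIV :: 'a set)"
  \<comment> \<open>If p were zero, the zero ideal would be maximal and the base a field, which a
    discrete valuation ring is not.\<close>
  have p0: "of_nat p \<noteq> (0::'a)"
  proof
    assume "of_nat p = (0::'a)"
    then have "maximalideal {0} ?A"
      using assms(4) by (simp add: cgenideal_def)
    then have "field ?A"
      using cring.zeromaximalideal_fieldI [OF cring_type_ring_UNIV] by simp
    then show False using assms(3) by (simp add: discrete_valuation_ring_def)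
  qed
  define \<sigma> where "\<sigma> b = b ^ p + of_nat p * \<delta> b" for b
  have \<sigma>: "type_hom \<sigma>"
  proof -
    have "frobenius_of p ?A \<delta> = \<sigma>" by (simp add: frobenius_of_def \<sigma>_def fun_eq_iff)
    then show ?thesis using assms(7) by (simp add: p_derivation_def)
  qed
  interpret level_sets_frobenius p a \<sigma> \<delta>
    using local_of_complete [OF assms(4,5) p0] assms(1,2,8) p0 \<sigma>
    by unfold_locales (simp_all add: \<sigma>_def)
  let ?S = "OX_hat p a"
  obtain \<phi> where \<phi>: "\<phi> \<in> ring_hom ?S ?S"
    "\<And>s. s \<in> carrier ?S \<Longrightarrow> congruent_mod p ?S (\<phi> s) (s [^]\<^bsub>?S\<^esub> p)"
    "\<And>b. \<phi> (emb_X (fr (cst b))) = emb_X (fr (cst (\<sigma> b)))"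
    "\<phi> (emb_X (fr x3)) = emb_X frob_x3"
    "\<phi> (emb_X (fr (H1 a))) = emb_X (fr (H1 a) ^ p)" "\<phi> (emb_X (fr H2)) = emb_X (fr H2 ^ p)"
    by (rule exists_frobenius_lift) blast
  have \<phi>_closed: "\<phi> s \<in> carrier ?S" if "s \<in> carrier ?S" for s
    by (rule ring_hom_closed [OF \<phi>(1) that])
  \<comment> \<open>The quotient of \<phi> s - s^p by p, chosen elementwise; it exists because
    \<phi> is a Frobenius lift.\<close>
  define \<delta>X where "\<delta>X s = (SOME t. t \<in> carrier ?S \<and> \<phi> s = s [^]\<^bsub>?S\<^esub> p \<oplus>\<^bsub>?S\<^esub> [p] \<cdot>\<^bsub>?S\<^esub> t)" for s
  have \<delta>X: "\<delta>X s \<in> carrier ?S \<and> \<phi> s = s [^]\<^bsub>?S\<^esub> p \<oplus>\<^bsub>?S\<^esub> [p] \<cdot>\<^bsub>?S\<^esub> \<delta>X s" if s: "s \<in> carrier ?S" for s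
  proof -
    have "\<exists>t. t \<in> carrier ?S \<and> \<phi> s = s [^]\<^bsub>?S\<^esub> p \<oplus>\<^bsub>?S\<^esub> [p] \<cdot>\<^bsub>?S\<^esub> t"
      using \<phi>(2) [OF s] by (auto elim: X.S.congruentE)
    then show ?thesis unfolding \<delta>X_def by (rule someI_ex)
  qed
  have frob: "frobenius_of p ?S \<delta>X s = \<phi> s" if "s \<in> carrier ?S" for s
    using \<delta>X [OF that] by (simp add: frobenius_of_def)
  \<comment> \<open>The completion has no p-torsion, so \<delta>X is determined by \<phi>, and its
    values on constants, H1 and H2 can be read off from those of \<phi>.\<close>
  have \<delta>X_eq: "\<delta>X (emb_X b) = emb_X e"
    if b: "b \<in> B" "e \<in> B" and eq: "\<phi> (emb_X b) = emb_X (b ^ p + of_nat p * e)" for b e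
  proof -
    have "\<phi> (emb_X b) = emb_X b [^]\<^bsub>?S\<^esub> p \<oplus>\<^bsub>?S\<^esub> [p] \<cdot>\<^bsub>?S\<^esub> emb_X e"
      using b by (simp add: eq emb_X_add emb_X_power emb_X_nat_multiple)
    then have "emb_X b [^]\<^bsub>?S\<^esub> p \<oplus>\<^bsub>?S\<^esub> [p] \<cdot>\<^bsub>?S\<^esub> \<delta>X (emb_X b) = emb_X b [^]\<^bsub>?S\<^esub> p \<oplus>\<^bsub>?S\<^esub> [p] \<cdot>\<^bsub>?S\<^esub> emb_X e"
      using \<delta>X [of "emb_X b"] b by (simp add: emb_X_closed)
    moreover have closed: "\<delta>X (emb_X b) \<in> carrier ?S" "emb_X b \<in> carrier ?S" "emb_X e \<in> carrier ?S"
      using \<delta>X [of "emb_X b"] b by (simp_all add: emb_X_closed)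
    ultimately have "[p] \<cdot>\<^bsub>?S\<^esub> \<delta>X (emb_X b) = [p] \<cdot>\<^bsub>?S\<^esub> emb_X e"
      by (metis X.S.add.l_cancel X.S.add.nat_pow_closed X.S.nat_pow_closed)
    then show ?thesis
      by (rule X.S.cancel [OF closed(1,3)])
  qed
  have fun_X: "fun_X p a f = emb_X (fr f)" for f by (simp add: fun_X_def)
  show ?thesis
  proof (intro exI [of _ \<delta>X] conjI allI impI)
    have "frobenius_of p ?S \<delta>X \<in> ring_hom ?S ?S"
      using \<phi>(1) by (intro ring_hom_memI)
        (simp_all add: frob \<phi>_closed ring_hom_mult ring_hom_add ring_hom_one)
    then show "p_derivation p ?S \<delta>X" using \<delta>X by (simp add: p_derivation_def)
    show "\<delta>X (fun_X p a (cst b)) = fun_X p a (cst (\<delta> b))" for b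
      unfolding fun_X
      by (rule \<delta>X_eq) (simp_all add: \<phi>(3) \<sigma>_def cst_simps fr_simps type_hom_of_nat [OF type_hom_cst]
          type_hom_of_nat [OF type_hom_fr])
    show "\<delta>X (fun_X p a (H1 a)) = \<zero>\<^bsub>?S\<^esub>" "\<delta>X (fun_X p a H2) = \<zero>\<^bsub>?S\<^esub>"
      unfolding fun_X emb_X_zero [symmetric] by (rule \<delta>X_eq; simp add: \<phi>(5,6))+
    fix c1 c2 assume "\<delta> c1 = 0" "\<delta> c2 = 0"
    then interpret level_set p a \<sigma> \<delta> \<phi> \<delta>X c1 c2
      by unfold_locales (use \<phi> frob in \<open>simp_all add: \<sigma>_def\<close>)
    show "congruent_mod p (forms_E p a c1 c2)
         (frobenius_pullback_div_p p a c1 c2 \<delta>X (omega p a c1 c2))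
         (inv\<^bsub>OE_hat p a c1 c2\<^esub> (fun_E p a c1 c2 (cst (eval2 id (hasse p a) c1 c2)))
            \<odot>\<^bsub>forms_E p a c1 c2\<^esub> omega p a c1 c2)"
      by (rule frobenius_omega)
  qed
qed

end
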